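(* Let $m>0$, $a_1,a_2\in(-\infty,4m^2)$, $\tilde b_0,\tilde b_1\in\mathbb{R}$, and let $b_0,b_1,b_2\in\mathbb{R}$ and distinct real $\gamma_0,\gamma_1,\gamma_2\in(-\infty,4m^2)$ satisfy $\gamma_i(a_1-\gamma_i)(a_2-\gamma_i)J(\gamma_i)=b_0+b_1\gamma_i+b_2\gamma_i^2$ for $i=0,1,2$. Let $\epsilon>0$. Then for every $\mathsf S\in C^\infty_{\mathrm{pc}}(\mathcal M)$ with support in $\{t\ge-\epsilon\}$ the equation $$\phi+W_{\mathrm{ret}}(\phi)=\mathsf S$$ has a unique solution $\phi\in C^\infty_{\mathrm{pc}}(\mathcal M)$; it is supported in $\{t\ge-\epsilon\}$ and is given by the series $\phi=\sum_{n\ge0}(-1)^nW_{\mathrm{ret}}^n(\mathsf S)$, which converges absolutely in $C^\infty_{\mathrm{pc}}(\mathcal M)$.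
   Context: $\mathcal M=\mathbb{R}^{1+3}$ Minkowski, $\square=-\partial_t^2+\Delta$; $C^\infty_{\mathrm{pc}}(\mathcal M)$ carries its LF-topology (strict inductive limit over past-compact sets $K$ of the Fréchet spaces of smooth functions supported in $K$, with seminorms $\sup_K|\partial^\alpha\varphi|$). For $M\in\mathbb{R}$, $\mathsf G^M_{\mathrm{ret}}$ is the retarded Green operator of $\square-M$ on past-compact functions. $\rho(M)=\frac{1}{16\pi^2}\sqrt{1-\frac{4m^2}{M}}\frac1M$, $J(\gamma)=\int_{4m^2}^\infty\frac{\rho(M)}{M-\gamma}dM$. Put $\varsigma(M)=\frac{M(M-a_1)(M-a_2)}{(M-\gamma_0)(M-\gamma_1)(M-\gamma_2)}\rho(M)$ on $[4m^2,\infty)$, $g(z)=\int_{4m^2}^\infty\frac{\varsigma(M)}{M-z}dM$, $\mathrm{p.v.}\,g(M)$ its principal value on $(4m^2,\infty)$, fix $c\in(0,4m^2)$ and $\mu_{\mathrm{con}}(M)=\frac{\varsigma(M)}{(M-c)\left((\mathrm{p.v.}\,g(M))^2+\pi^2\varsigma(M)^2\right)}$. Define $\mathcal G_\varsigma^{-1}:C^\infty_{\mathrm{pc}}\to C^\infty_{\mathrm{pc}}$ by $\mathcal G_\varsigma^{-1}\Phi=-\frac{1}{g(c)}\Phi-\int_{4m^2}^\infty\mu_{\mathrm{con}}(M)\mathsf G^M_{\mathrm{ret}}((\square-c)\Phi)\,dM$ (the retarded inverse of $\phi\mapsto\int_{4m^2}^\infty\varsigma(M)\mathsf G^M_{\mathrm{ret}}\phi\,dM$).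 Let $\mathsf G_{L,\mathrm{ret}}$ be the retarded Green operator of $L=(\square-\gamma_0)(\square-\gamma_1)(\square-\gamma_2)$, i.e. $\mathsf G_{L,\mathrm{ret}}=\sum_i c_i\mathsf G^{\gamma_i}_{\mathrm{ret}}$ with $\frac{1}{\prod_i(M-\gamma_i)}=\sum_i\frac{c_i}{M-\gamma_i}$. Finally $W_{\mathrm{ret}}(\phi):=\mathsf G_{L,\mathrm{ret}}\big(\mathcal G_\varsigma^{-1}\big((\tilde b_1-b_1)\square\phi+(\tilde b_0-b_0)\phi\big)\big)$.
   Formalization: Absolute convergence in C^∞_pc is read as: all terms are supported in one past-compact set K and the sums of sup|∂^α φ| over every compact ball are finite, since sup over a non-compact past-compact K can be infinite and so does not define a seminorm. *)

theory Defs
  imports "HOL-Analysis.Analysis" "HOL-Library.Numeral_Type"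
begin

text \<open>Minkowski space R^(1+3): points are real^4, coordinate 0 is time t,
coordinates 1,2,3 are space.\<close>

type_synonym pt = "real^4"

definition partial :: "4 \<Rightarrow> (pt \<Rightarrow> real) \<Rightarrow> pt \<Rightarrow> real" where
  "partial i f x = deriv (\<lambda>s. f (x + s *\<^sub>R axis i 1)) 0"

fun iter_partial :: "4 list \<Rightarrow> (pt \<Rightarrow> real) \<Rightarrow> pt \<Rightarrow> real" where
  "iter_partial [] f = f"
| "iter_partial (i # is) f = partial i (iter_partial is f)"

definition smooth :: "(pt \<Rightarrow> real) \<Rightarrow> bool" where
  "smooth f \<longleftrightarrow> (\<forall>ks. continuous_on UNIV (iter_partial ks f) \<and>
      (\<forall>i x. (\<lambda>s. iter_partial ks f (x + s *\<^sub>R axis i 1)) differentiable (at 0)))"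

definition dalembert :: "(pt \<Rightarrow> real) \<Rightarrow> pt \<Rightarrow> real" where
  "dalembert f x = - partial 0 (partial 0 f) x + (\<Sum>i\<in>{1,2,3::4}. partial i (partial i f) x)"

definition tsupp :: "(pt \<Rightarrow> real) \<Rightarrow> pt set" where
  "tsupp f = closure {x. f x \<noteq> 0}"

definition causal_past :: "pt \<Rightarrow> pt set" where
  "causal_past p = {x. x $ 0 \<le> p $ 0 \<and>
      (\<Sum>i\<in>{1,2,3::4}. (p $ i - x $ i)^2) \<le> (p $ 0 - x $ 0)^2}"

definition past_compact :: "pt set \<Rightarrow> bool" where
  "past_compact A \<longleftrightarrow> (\<forall>p. compact (A \<inter> causal_past p))"

definition Cpc :: "(pt \<Rightarrow> real) set" where
  "Cpc = {f. smooth f \<and> past_compact (tsupp f)}"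

definition Gret :: "real \<Rightarrow> (pt \<Rightarrow> real) \<Rightarrow> pt \<Rightarrow> real" where
  "Gret M \<phi> = (THE u. u \<in> Cpc \<and> (\<forall>x. dalembert u x - M * u x = \<phi> x))"

definition rho :: "real \<Rightarrow> real \<Rightarrow> real" where
  "rho m M = 1 / (16 * pi^2) * sqrt (1 - 4 * m^2 / M) * (1 / M)"

definition Jfun :: "real \<Rightarrow> real \<Rightarrow> real" where
  "Jfun m \<gamma> = (LINT M:{4 * m^2..}|lborel. rho m M / (M - \<gamma>))"

definition vsig :: "real \<Rightarrow> real \<Rightarrow> real \<Rightarrow> real \<Rightarrow> real \<Rightarrow> real \<Rightarrow> real \<Rightarrow> real" where
  "vsig m a1 a2 g0 g1 g2 M =
     M * (M - a1) * (M - a2) / ((M - g0) * (M - g1) * (M - g2)) * rho m M"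

definition gfun :: "real \<Rightarrow> real \<Rightarrow> real \<Rightarrow> real \<Rightarrow> real \<Rightarrow> real \<Rightarrow> real \<Rightarrow> real" where
  "gfun m a1 a2 g0 g1 g2 z = (LINT s:{4 * m^2..}|lborel. vsig m a1 a2 g0 g1 g2 s / (s - z))"

definition pv_g :: "real \<Rightarrow> real \<Rightarrow> real \<Rightarrow> real \<Rightarrow> real \<Rightarrow> real \<Rightarrow> real \<Rightarrow> real" where
  "pv_g m a1 a2 g0 g1 g2 M = Lim (at_right 0) (\<lambda>\<delta>.
     (LINT s:{4 * m^2..M - \<delta>}|lborel. vsig m a1 a2 g0 g1 g2 s / (s - M)) +
     (LINT s:{M + \<delta>..}|lborel. vsig m a1 a2 g0 g1 g2 s / (s - M)))"

definition mu_con :: "real \<Rightarrow> real \<Rightarrow> real \<Rightarrow> real \<Rightarrow> real \<Rightarrow> real \<Rightarrow> real \<Rightarrow> real \<Rightarrow> real" where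
  "mu_con m a1 a2 g0 g1 g2 c M =
     vsig m a1 a2 g0 g1 g2 M /
       ((M - c) * ((pv_g m a1 a2 g0 g1 g2 M)^2 + pi^2 * (vsig m a1 a2 g0 g1 g2 M)^2))"

text \<open>Retarded inverse of phi |-> int varsigma(M) G^M_ret phi dM.\<close>
definition Ginv :: "real \<Rightarrow> real \<Rightarrow> real \<Rightarrow> real \<Rightarrow> real \<Rightarrow> real \<Rightarrow> real \<Rightarrow>
                    (pt \<Rightarrow> real) \<Rightarrow> pt \<Rightarrow> real" where
  "Ginv m a1 a2 g0 g1 g2 c \<Phi> x =
     - (1 / gfun m a1 a2 g0 g1 g2 c) * \<Phi> x
     - (LINT M:{4 * m^2..}|lborel.
          mu_con m a1 a2 g0 g1 g2 c M * Gret M (\<lambda>y. dalembert \<Phi> y - c * \<Phi> y) x)"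

text \<open>Retarded Green operator of L = (box-g0)(box-g1)(box-g2) via partial fractions.\<close>
definition GLret :: "real \<Rightarrow> real \<Rightarrow> real \<Rightarrow> (pt \<Rightarrow> real) \<Rightarrow> pt \<Rightarrow> real" where
  "GLret g0 g1 g2 \<phi> x =
       1 / ((g0 - g1) * (g0 - g2)) * Gret g0 \<phi> x
     + 1 / ((g1 - g0) * (g1 - g2)) * Gret g1 \<phi> x
     + 1 / ((g2 - g0) * (g2 - g1)) * Gret g2 \<phi> x"

definition Wret :: "real \<Rightarrow> real \<Rightarrow> real \<Rightarrow> real \<Rightarrow> real \<Rightarrow> real \<Rightarrow> real \<Rightarrow>
                    real \<Rightarrow> real \<Rightarrow> real \<Rightarrow> real \<Rightarrow> (pt \<Rightarrow> real) \<Rightarrow> pt \<Rightarrow> real" where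
  "Wret m a1 a2 g0 g1 g2 c b0 b1 bt0 bt1 \<phi> =
     GLret g0 g1 g2 (Ginv m a1 a2 g0 g1 g2 c
        (\<lambda>x. (bt1 - b1) * dalembert \<phi> x + (bt0 - b0) * \<phi> x))"

text \<open>Absolute convergence of the series sum_n u_n in the LF space C^infty_pc:
all terms lie in C_pc with supports in one common past-compact set K, and
for every derivative and every compact set (ball) the seminorms are summable.\<close>
definition abs_conv_Cpc :: "(nat \<Rightarrow> pt \<Rightarrow> real) \<Rightarrow> bool" where
  "abs_conv_Cpc u \<longleftrightarrow> (\<exists>K. past_compact K \<and> (\<forall>n. u n \<in> Cpc \<and> tsupp (u n) \<subseteq> K) \<and>
      (\<forall>ks R. R > 0 \<longrightarrow>
         summable (\<lambda>n. SUP x\<in>cball 0 R. \<bar>iter_partial ks (u n) x\<bar>)))"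

end

theory Submission
  imports Defs
begin

text \<open>
  The retarded Green operator of \<open>\<box> - M\<close> is written as an integral over the mass hyperboloids
  \<open>y\<^sub>0\<^sup>2 - |y|\<^sup>2 = s\<close>. With \<open>A\<^sub>s f\<close> the integral of \<open>f (x - y)\<close> against \<open>dy / y\<^sub>0\<close>, the
  divergence theorem gives \<open>A\<^sub>s (\<box> f) = - 4 s \<partial>\<^sub>s\<^sup>2 (A\<^sub>s f)\<close>, so that inverting \<open>\<box> - M\<close> becomes an
  ordinary differential equation in \<open>s\<close> solved by Bessel functions.

  The operator \<open>W\<close> is reduced by partial fractions to a superposition \<open>\<integral> w(\<tau>) G\<^sup>M d\<tau>\<close> with \<open>M = \<theta>(\<tau>)\<close> and
  \<open>w\<close> integrable: the weight \<open>\<mu>_con\<close> is controlled by \<open>\<pi>\<^sup>2 vsig\<^sup>2\<close> in its denominator near the threshold and by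
  the logarithmic growth of \<open>M pv g(M)\<close> at infinity. A single \<open>G\<^sup>M\<close> is not bounded in the sup norm uniformly
  in \<open>M\<close>, but \<open>G\<^sup>M G\<^sup>N = (G\<^sup>M - G\<^sup>N) / (M - N)\<close> has a kernel on the light cone bounded uniformly in
  \<open>M\<close> and \<open>N\<close>. Hence \<open>W\<^sup>2\<close> is a contraction in a sup norm with weight \<open>exp (- \<alpha> t)\<close>, without loss of
  derivatives, and the Neumann series converges together with all derivatives.
\<close>

section \<open>Smooth functions\<close>

text \<open>Why \<open>W\<close> has an integrable weight: as a function of the squared mass, the
  inverse of L falls like M^-3, while the factors \<beta>1 box + \<beta>0 and box - c each cost one
  power, and \<open>mu_con\<close> divided by M is only just integrable, bounded by a multiple of 1
  / (M (ln M)^2). Each partial fraction alone is too large. The sum is saved by sum c_i = sum c_i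
  gamma_i = 0, which removes the local terms and the superposition with the bad weight and leaves
  \<open>mu_con\<close> divided by M - gamma_i. The uniform bound on products holds because the
  light-cone part of G^M does not depend on M and the Bessel tail has mass derivative J_0, bounded
  by 1 on the positive axis. Smallness comes from the cone kernel 1 / |y|, integrable in three
  dimensions and damped by the exponential weight. Because \<open>W\<close> itself cannot be passed
  through the series in sup norm, only W^2 is commuted with it; existence and uniqueness then both
  reduce to the vanishing of fixed points of W^2.\<close>

lemma iter_partial_append: "iter_partial (js @ ks) f = iter_partial js (iter_partial ks f)"
  by (induction js) auto

lemma smooth_iter_partial: "smooth f \<Longrightarrow> smooth (iter_partial ks f)"
  unfolding smooth_def iter_partial_append[symmetric] by blast

lemma smooth_partial: "smooth f \<Longrightarrow> smooth (partial i f)"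
  using smooth_iter_partial[of f "[i]"] by simp

lemma smooth_continuous: "smooth f \<Longrightarrow> continuous_on A f"
  unfolding smooth_def by (metis iter_partial.simps(1) continuous_on_subset subset_UNIV)

lemma smooth_DERIV:
  assumes "smooth f"
  shows "((\<lambda>u. f (x + u *\<^sub>R axis i 1)) has_real_derivative partial i f (x + u *\<^sub>R axis i 1)) (at u)"
proof -
  have "(\<lambda>s. f ((x + u *\<^sub>R axis i 1) + s *\<^sub>R axis i 1)) differentiable at 0"
    using assms unfolding smooth_def by (metis iter_partial.simps(1))
  then have "((\<lambda>s. f ((x + u *\<^sub>R axis i 1) + s *\<^sub>R axis i 1)) has_real_derivative
      partial i f (x + u *\<^sub>R axis i 1)) (at 0)"
    unfolding partial_def by (metis DERIV_deriv_iff_real_differentiable)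
  then have "((\<lambda>s. f (x + (s + u) *\<^sub>R axis i 1)) has_real_derivative
      partial i f (x + u *\<^sub>R axis i 1)) (at 0)"
    by (simp add: algebra_simps)
  then show ?thesis
    using DERIV_shift[of "\<lambda>u. f (x + u *\<^sub>R axis i 1)" _ 0 u] by simp
qed

lemma partial_eqI:
  assumes "\<And>x. ((\<lambda>s. g (x + s *\<^sub>R axis i 1)) has_real_derivative g' x) (at 0)"
  shows "partial i g = g'"
  using assms unfolding partial_def by (intro ext DERIV_imp_deriv)

text \<open>Smoothness by coinduction: a class of continuous functions closed under directional
  derivatives consists of smooth functions. For operators commuting with derivatives the class is
  the image of \<open>Cpc\<close>, and no formula for iterated derivatives has to be found.\<close>

lemma smooth_coinduct:
  assumes "g \<in> P"
    and cont: "\<And>g. g \<in> P \<Longrightarrow> continuous_on UNIV g"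
    and der: "\<And>g i. g \<in> P \<Longrightarrow> \<exists>g'\<in>P. \<forall>x. ((\<lambda>s. g (x + s *\<^sub>R axis i 1)) has_real_derivative g' x) (at 0)"
  shows "smooth g"
proof -
  have P: "iter_partial ks g \<in> P" for ks
  proof (induction ks)
    case (Cons i ks)
    from der[OF Cons, of i] show ?case using partial_eqI by fastforce
  qed (use assms in auto)
  show ?thesis
    unfolding smooth_def using P cont der real_differentiable_def by blast
qed

lemma partial_lincomb:
  assumes "smooth f" "smooth g"
  shows "partial i (\<lambda>x. a * f x + b * g x) = (\<lambda>x. a * partial i f x + b * partial i g x)"
  by (rule partial_eqI)
     (use smooth_DERIV[OF assms(1), where u = 0] smooth_DERIV[OF assms(2), where u = 0]
      in \<open>auto intro!: derivative_eq_intros\<close>)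

lemma smooth_lincomb:
  assumes "smooth f" "smooth g"
  shows "smooth (\<lambda>x. a * f x + b * g x)"
proof (rule smooth_coinduct[where P = "{\<lambda>x. a * f x + b * g x | f g. smooth f \<and> smooth g}"])
  show "\<exists>g'\<in>{\<lambda>x. a * f x + b * g x | f g. smooth f \<and> smooth g}.
       \<forall>x. ((\<lambda>s. h (x + s *\<^sub>R axis i 1)) has_real_derivative g' x) (at 0)"
    if "h \<in> {\<lambda>x. a * f x + b * g x | f g. smooth f \<and> smooth g}" for h i
  proof -
    from that obtain f g where h: "h = (\<lambda>x. a * f x + b * g x)" "smooth f" "smooth g" by blast
    show ?thesis
      using smooth_DERIV[OF h(2), where u = 0] smooth_DERIV[OF h(3), where u = 0]
      by (intro bexI[of _ "\<lambda>x. a * partial i f x + b * partial i g x"])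
         (use smooth_partial[OF h(2), of i] smooth_partial[OF h(3), of i] in
           \<open>force simp: h(1) intro!: derivative_eq_intros\<close>)+
  qed
qed (use assms in \<open>auto intro!: continuous_intros intro: smooth_continuous\<close>)

lemma dalembert_altdef:
  "dalembert f = (\<lambda>x. (-1) * partial 0 (partial 0 f) x + 1 * (1 * partial 1 (partial 1 f) x
     + 1 * (1 * partial 2 (partial 2 f) x + 1 * partial 3 (partial 3 f) x)))"
  unfolding dalembert_def by auto

lemma iter_partial_cmult:
  assumes "smooth f"
  shows "iter_partial ks (\<lambda>x. a * f x) = (\<lambda>x. a * iter_partial ks f x)"
proof (induction ks)
  case (Cons i ks)
  show ?case
    using partial_lincomb[OF smooth_iter_partial[OF assms, of ks] smooth_iter_partial[OF assms, of ks], of i a 0]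
    by (simp add: Cons)
qed auto

text \<open>Continuous partials give a total derivative: the increment is telescoped over the
  coordinates, one mean value step for each. It is used for the chain rule along curves on the
  hyperboloid.\<close>

lemma smooth_has_derivative:
  assumes "smooth f"
  shows "(f has_derivative (\<lambda>h. \<Sum>i\<in>UNIV. h $ i * partial i f x)) (at x)"
proof -
  have "((\<lambda>h. f (x + (\<Sum>i\<in>J. h $ i *\<^sub>R axis i 1))) has_derivative
      (\<lambda>h. \<Sum>i\<in>J. h $ i * partial i f x)) (at 0)" if "finite J" for J
    using that
  proof (induction J rule: finite_induct)
    case (insert j J)
    let ?P = "\<lambda>h::pt. \<Sum>i\<in>J. h $ i *\<^sub>R axis i (1::real)"
    have "((\<lambda>h. f (x + ?P h + h $ j *\<^sub>R axis j 1) - f (x + ?P h)) has_derivative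
      (\<lambda>h. h $ j * partial j f x)) (at 0)"
      unfolding has_derivative_at_alt
    proof (intro conjI allI impI)
      show "bounded_linear (\<lambda>h::pt. h $ j * partial j f x)"
        by (intro bounded_linear_mult_const bounded_linear_vec_nth)
      fix e :: real assume "e > 0"
      moreover have "isCont (partial j f) x"
        using smooth_continuous[OF smooth_partial[OF assms], of UNIV] 
        by (simp add: continuous_on_eq_continuous_at)
      ultimately obtain d where d: "d > 0"
        "\<And>y. dist y x < d \<Longrightarrow> dist (partial j f y) (partial j f x) < e"
        unfolding continuous_at_eps_delta by blast
      \<comment> \<open>The displacement already made is at most \<open>4 * norm h\<close> and the
        mean value point adds at most \<open>norm h\<close>, whence the radius
        \<open>d / 5\<close>.\<close>
      have "norm (f (x + ?P h + h $ j *\<^sub>R axis j 1) - f (x + ?P h) - h $ j * partial j f x) \<le> e * norm h"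
        if h: "norm h < d / 5" for h
      proof -
        have "\<exists>\<xi>. \<bar>\<xi>\<bar> \<le> \<bar>h $ j\<bar> \<and> f (x + ?P h + h $ j *\<^sub>R axis j 1) - f (x + ?P h)
             = h $ j * partial j f (x + ?P h + \<xi> *\<^sub>R axis j 1)"
        proof (cases "h $ j" "0::real" rule: linorder_cases)
          case less
          from MVT2[OF less, of "\<lambda>u. f (x + ?P h + u *\<^sub>R axis j 1)"
              "\<lambda>u. partial j f (x + ?P h + u *\<^sub>R axis j 1)"] smooth_DERIV[OF assms]
          obtain z where "z > h $ j" "z < 0" "f (x + ?P h) - f (x + ?P h + h $ j *\<^sub>R axis j 1)
             = (0 - h $ j) * partial j f (x + ?P h + z *\<^sub>R axis j 1)" by auto
          then show ?thesis by (intro exI[of _ z]) auto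
        next
          case greater
          from MVT2[OF greater, of "\<lambda>u. f (x + ?P h + u *\<^sub>R axis j 1)"
              "\<lambda>u. partial j f (x + ?P h + u *\<^sub>R axis j 1)"] smooth_DERIV[OF assms]
          obtain z where "z < h $ j" "z > 0" "f (x + ?P h + h $ j *\<^sub>R axis j 1) - f (x + ?P h)
             = (h $ j - 0) * partial j f (x + ?P h + z *\<^sub>R axis j 1)" by auto
          then show ?thesis by (intro exI[of _ z]) auto
        qed (auto intro!: exI[of _ 0])
        then obtain \<xi> where xi: "\<bar>\<xi>\<bar> \<le> \<bar>h $ j\<bar>" "f (x + ?P h + h $ j *\<^sub>R axis j 1) - f (x + ?P h)
             = h $ j * partial j f (x + ?P h + \<xi> *\<^sub>R axis j 1)" by blast
        have "norm (?P h) \<le> (\<Sum>i\<in>J. norm h)"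
          by (intro sum_norm_le) (auto simp: norm_axis_1 component_le_norm_cart)
        also have "\<dots> \<le> 4 * norm h"
          using card_mono[of "UNIV::4 set" J] by (simp add: mult_right_mono)
        finally have "norm (?P h + \<xi> *\<^sub>R axis j 1) \<le> 4 * norm h + norm h"
          using xi(1) component_le_norm_cart[of h j]
          by (intro order_trans[OF norm_triangle_ineq]) (auto simp: norm_axis_1)
        then have "dist (x + ?P h + \<xi> *\<^sub>R axis j 1) x < d"
          using h by (auto simp: dist_norm algebra_simps)
        from d(2)[OF this] have "\<bar>partial j f (x + ?P h + \<xi> *\<^sub>R axis j 1) - partial j f x\<bar> \<le> e"
          by (simp add: dist_real_def)
        moreover have "f (x + ?P h + h $ j *\<^sub>R axis j 1) - f (x + ?P h) - h $ j * partial j f x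
          = h $ j * (partial j f (x + ?P h + \<xi> *\<^sub>R axis j 1) - partial j f x)"
          unfolding xi(2) by (simp add: algebra_simps)
        ultimately show ?thesis
          using component_le_norm_cart[of h j] by (auto simp: abs_mult mult.commute[of e] intro!: mult_mono)
      qed
      then show "\<exists>d>0. \<forall>y. norm (y - 0) < d \<longrightarrow>
          norm (f (x + ?P y + y $ j *\<^sub>R axis j 1) - f (x + ?P y) -
             (f (x + ?P 0 + 0 $ j *\<^sub>R axis j 1) - f (x + ?P 0)) - (y - 0) $ j * partial j f x) \<le> e * norm (y - 0)"
        using d(1) by (intro exI[of _ "d / 5"]) auto
    qed
    from has_derivative_add[OF this insert.IH] show ?case
      using insert.hyps by (simp add: algebra_simps)
  qed auto
  from this[of UNIV] have "((\<lambda>h. f (x + h)) has_derivative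
      (\<lambda>h. \<Sum>i\<in>UNIV. h $ i * partial i f x)) (at 0)"
    by (simp add: basis_expansion scalar_mult_eq_scaleR[symmetric])
  then have "((\<lambda>h. f (x + h)) has_derivative (\<lambda>h. \<Sum>i\<in>UNIV. h $ i * partial i f x)) (at (x - x))"
    by simp
  then have "((\<lambda>z. (\<lambda>h. f (x + h)) (z - x)) has_derivative (\<lambda>h. \<Sum>i\<in>UNIV. h $ i * partial i f x)) (at x)"
    by (rule has_derivative_compose[rotated]) (auto intro!: derivative_eq_intros)
  then show ?thesis by simp
qed

text \<open>Two mean value steps on a difference expression that is symmetric in \<open>i\<close>
  and \<open>j\<close>; reading it in both orders is what makes the partials commute.\<close>

lemma smooth_second_difference:
  assumes "smooth f" "h > 0"
  shows "\<exists>\<xi> \<eta>. \<bar>\<xi>\<bar> < h \<and> \<bar>\<eta>\<bar> < h \<and>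
    f (x + h *\<^sub>R axis i 1 + h *\<^sub>R axis j 1) - f (x + h *\<^sub>R axis i 1) - f (x + h *\<^sub>R axis j 1) + f x
     = h * h * partial j (partial i f) (x + \<xi> *\<^sub>R axis i 1 + \<eta> *\<^sub>R axis j 1)"
proof -
  let ?g = "\<lambda>u. f ((x + h *\<^sub>R axis j 1) + u *\<^sub>R axis i 1) - f (x + u *\<^sub>R axis i 1)"
  let ?g' = "\<lambda>u. partial i f ((x + h *\<^sub>R axis j 1) + u *\<^sub>R axis i 1) - partial i f (x + u *\<^sub>R axis i 1)"
  have "(?g has_real_derivative ?g' u) (at u)" for u
    by (intro DERIV_diff smooth_DERIV assms)
  from MVT2[OF assms(2), of ?g ?g'] this obtain \<xi> where xi: "0 < \<xi>" "\<xi> < h" "?g h - ?g 0 = h * ?g' \<xi>" by auto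
  let ?k = "\<lambda>u. partial i f ((x + \<xi> *\<^sub>R axis i 1) + u *\<^sub>R axis j 1)"
  have "\<exists>z>0. z < h \<and> ?k h - ?k 0 = (h - 0) * partial j (partial i f) (x + \<xi> *\<^sub>R axis i 1 + z *\<^sub>R axis j 1)"
    using assms by (intro MVT2 smooth_DERIV smooth_partial) auto
  moreover have "?g' \<xi> = ?k h - ?k 0" by (simp add: algebra_simps)
  ultimately obtain \<eta> where eta: "0 < \<eta>" "\<eta> < h"
    "?g' \<xi> = h * partial j (partial i f) (x + \<xi> *\<^sub>R axis i 1 + \<eta> *\<^sub>R axis j 1)"
    by (metis diff_zero)
  show ?thesis
    using xi eta by (intro exI[of _ \<xi>] exI[of _ \<eta>]) (auto simp: algebra_simps)
qed

text \<open>Needed for the mixed derivatives to cancel in the divergence computation on the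
  hyperboloid.\<close>

lemma partial_commute:
  assumes "smooth f"
  shows "partial i (partial j f) = partial j (partial i f)"
proof (rule ext, rule ccontr)
  fix x
  let ?P = "partial i (partial j f)" and ?Q = "partial j (partial i f)"
  assume neq: "?P x \<noteq> ?Q x"
  define e where "e = dist (?P x) (?Q x) / 2"
  have e: "e > 0" using neq by (simp add: e_def)
  have c: "isCont ?P x" "isCont ?Q x"
    using smooth_continuous[OF smooth_partial[OF smooth_partial[OF assms]], of UNIV]
    by (simp_all add: continuous_on_eq_continuous_at)
  from c(1) e obtain d1 where d1: "d1 > 0" "\<And>y. dist y x < d1 \<Longrightarrow> dist (?P y) (?P x) < e"
    unfolding continuous_at_eps_delta by blast
  from c(2) e obtain d2 where d2: "d2 > 0" "\<And>y. dist y x < d2 \<Longrightarrow> dist (?Q y) (?Q x) < e"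
    unfolding continuous_at_eps_delta by blast
  define h where "h = min d1 d2 / 2"
  have h: "h > 0" using d1 d2 by (simp add: h_def)
  have near: "dist (x + \<xi> *\<^sub>R axis a 1 + \<eta> *\<^sub>R axis b 1) x < min d1 d2" if "\<bar>\<xi>\<bar> < h" "\<bar>\<eta>\<bar> < h" for \<xi> \<eta> a b
  proof -
    have "norm (\<xi> *\<^sub>R axis a (1::real) + \<eta> *\<^sub>R axis b 1 :: pt) \<le> \<bar>\<xi>\<bar> + \<bar>\<eta>\<bar>"
      by (intro order_trans[OF norm_triangle_ineq]) (auto simp: norm_axis_1)
    also have "\<dots> < min d1 d2" using that unfolding h_def by linarith
    finally show ?thesis by (simp add: dist_norm algebra_simps)
  qed
  from smooth_second_difference[OF assms h, of x i j] obtain \<xi> \<eta> where 1: "\<bar>\<xi>\<bar> < h" "\<bar>\<eta>\<bar> < h"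
    "f (x + h *\<^sub>R axis i 1 + h *\<^sub>R axis j 1) - f (x + h *\<^sub>R axis i 1) - f (x + h *\<^sub>R axis j 1) + f x
     = h * h * ?Q (x + \<xi> *\<^sub>R axis i 1 + \<eta> *\<^sub>R axis j 1)" by blast
  from smooth_second_difference[OF assms h, of x j i] obtain \<xi>' \<eta>' where 2: "\<bar>\<xi>'\<bar> < h" "\<bar>\<eta>'\<bar> < h"
    "f (x + h *\<^sub>R axis j 1 + h *\<^sub>R axis i 1) - f (x + h *\<^sub>R axis j 1) - f (x + h *\<^sub>R axis i 1) + f x
     = h * h * ?P (x + \<xi>' *\<^sub>R axis j 1 + \<eta>' *\<^sub>R axis i 1)" by blast
  have "h * h * ?Q (x + \<xi> *\<^sub>R axis i 1 + \<eta> *\<^sub>R axis j 1) = h * h * ?P (x + \<xi>' *\<^sub>R axis j 1 + \<eta>' *\<^sub>R axis i 1)"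
    unfolding 1(3)[symmetric] 2(3)[symmetric] by (simp add: algebra_simps)
  then have eq: "?Q (x + \<xi> *\<^sub>R axis i 1 + \<eta> *\<^sub>R axis j 1) = ?P (x + \<xi>' *\<^sub>R axis j 1 + \<eta>' *\<^sub>R axis i 1)"
    using h by simp
  have "dist (?Q (x + \<xi> *\<^sub>R axis i 1 + \<eta> *\<^sub>R axis j 1)) (?Q x) < e"
    using near[OF 1(1,2)] by (intro d2) auto
  moreover have "dist (?P (x + \<xi>' *\<^sub>R axis j 1 + \<eta>' *\<^sub>R axis i 1)) (?P x) < e"
    using near[OF 2(1,2)] by (intro d1) auto
  ultimately show False
    unfolding eq e_def dist_real_def by (smt (verit) field_sum_of_halves)
qed

section \<open>Causal structure\<close>

text \<open>\<open>Vp\<close> is the closed future light cone and \<open>Jp A\<close> the causal future of \<open>A\<close>.\<close>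

definition Vp :: "pt set" where
  "Vp = {v. L2_set (($) v) {1,2,3} \<le> v $ 0}"

definition Jp :: "pt set \<Rightarrow> pt set" where
  "Jp A = {a + v | a v. a \<in> A \<and> v \<in> Vp}"

lemma index4_distinct [simp]:
  "(1::4) \<noteq> 2" "(1::4) \<noteq> 3" "(2::4) \<noteq> 3" "(0::4) \<noteq> 1" "(0::4) \<noteq> 2" "(0::4) \<noteq> 3"
  "(2::4) \<noteq> 1" "(3::4) \<noteq> 1" "(3::4) \<noteq> 2" "(1::4) \<noteq> 0" "(2::4) \<noteq> 0" "(3::4) \<noteq> 0"
  by simp_all

lemma sum_index4: "(\<Sum>i\<in>(UNIV::4 set). f i) = f 0 + f 1 + f 2 + f 3"
proof -
  have 4: "(4::4) = 0" by simp
  show ?thesis unfolding sum_4 4 by (simp only: add_ac)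
qed

lemma Vp_time_nonneg: "v \<in> Vp \<Longrightarrow> 0 \<le> v $ 0"
  unfolding Vp_def mem_Collect_eq by (rule order_trans[OF L2_set_nonneg])

lemma Vp_iff: "v \<in> Vp \<longleftrightarrow> 0 \<le> v $ 0 \<and> (\<Sum>i\<in>{1,2,3}. (v $ i)^2) \<le> (v $ 0)^2"
proof -
  have "sqrt a \<le> b \<longleftrightarrow> 0 \<le> b \<and> a \<le> b^2" if "a \<ge> 0" for a b :: real
    using that by (meson order_trans real_le_lsqrt real_sqrt_ge_zero sqrt_le_D)
  then show ?thesis unfolding Vp_def L2_set_def by (simp add: sum_nonneg)
qed

lemma causal_past_iff: "x \<in> causal_past p \<longleftrightarrow> p - x \<in> Vp"
  unfolding causal_past_def Vp_iff by simp

lemma zero_in_Vp: "0 \<in> Vp" by (simp add: Vp_iff)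

lemma Vp_add: "v \<in> Vp \<Longrightarrow> w \<in> Vp \<Longrightarrow> v + w \<in> Vp"
  unfolding Vp_def using L2_set_triangle_ineq[of "($) v" "($) w" "{1,2,3}"] by auto

text \<open>The constant 4 is crude: the norm is at most the sum of the four coordinates in absolute
  value, each bounded by the time.\<close>

lemma norm_Vp_le:
  assumes "v \<in> Vp" shows "norm v \<le> 4 * v $ 0"
proof -
  have "\<bar>v $ i\<bar> \<le> v $ 0" if "i \<in> {1,2,3}" for i
    using member_le_L2_set[of "{1,2,3}" i "\<lambda>i. \<bar>v $ i\<bar>"] that assms unfolding Vp_def L2_set_def by auto
  from this[of 1] this[of 2] this[of 3] show ?thesis
    using norm_le_l1_cart[of v] Vp_time_nonneg[OF assms] by (simp add: sum_index4)
qed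

lemma closed_Vp: "closed Vp"
  unfolding Vp_def L2_set_def by (intro closed_Collect_le continuous_intros)

lemma causal_past_trans: "x \<in> causal_past p \<Longrightarrow> v \<in> Vp \<Longrightarrow> x - v \<in> causal_past p"
  unfolding causal_past_iff using Vp_add[of "p - x" v] by (simp add: algebra_simps)

lemma closed_causal_past: "closed (causal_past p)"
proof -
  have "causal_past p = (\<lambda>x. p - x) -` Vp" using causal_past_iff by auto
  then show ?thesis by (simp add: closed_Vp closed_vimage continuous_intros)
qed

text \<open>Causal pasts take the place of balls as exhausting family, because they meet a
  past-compact set in a compact set. The apex time 4 R is 3 R for the spatial coordinates plus R for
  the time of the point.\<close>

lemma cball_subset_causal_past: "\<exists>q. cball 0 R \<subseteq> causal_past q"
proof (intro exI[of _ "axis 0 (4 * R)"] subsetI)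
  fix x :: pt assume "x \<in> cball 0 R"
  then have R: "\<bar>x $ i\<bar> \<le> R" for i
    using component_le_norm_cart[of x i] by (auto simp: dist_norm)
  have "L2_set (($) (axis 0 (4 * R) - x)) {1,2,3} \<le> (\<Sum>i\<in>{1,2,3}. \<bar>(axis 0 (4 * R) - x) $ i\<bar>)"
    by (rule L2_set_le_sum_abs)
  also have "\<dots> \<le> 3 * R" using R[of 1] R[of 2] R[of 3] by (simp add: axis_def)
  also have "\<dots> \<le> (axis 0 (4 * R) - x) $ 0" using R[of 0] by (simp add: axis_def)
  finally show "x \<in> causal_past (axis 0 (4 * R))" unfolding causal_past_iff Vp_def by simp
qed

lemma nhds_causal_past: "\<exists>q. ball x 1 \<subseteq> causal_past q"
proof -
  have "ball x 1 \<subseteq> cball 0 (norm x + 1)"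
  proof
    fix y assume "y \<in> ball x 1"
    then show "y \<in> cball 0 (norm x + 1)"
      using norm_triangle_ineq2[of y x] by (simp add: dist_norm norm_minus_commute)
  qed
  then show ?thesis using cball_subset_causal_past[of "norm x + 1"] by blast
qed

lemma line_in_causal_past:
  "\<exists>q. \<forall>v. \<bar>v - u\<bar> < 1 \<longrightarrow> x + v *\<^sub>R axis i (1::real) \<in> causal_past q"
proof -
  obtain q where q: "ball (x + u *\<^sub>R axis i 1) 1 \<subseteq> causal_past q" using nhds_causal_past by blast
  have "dist (x + u *\<^sub>R axis i 1) (x + v *\<^sub>R axis i (1::real)) = \<bar>v - u\<bar>" for v
    by (simp add: dist_norm norm_axis_1 scaleR_left_diff_distrib[symmetric] abs_minus_commute)
  then show ?thesis using q by (intro exI[of _ q]) auto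
qed

lemma in_some_causal_past: "\<exists>q. x \<in> causal_past q"
  using nhds_causal_past[of x] by (meson centre_in_ball subsetD zero_less_one)

text \<open>A convergent sequence is bounded, hence stays in one causal past, where the set is
  compact.\<close>

lemma past_compact_closed:
  assumes "past_compact A" shows "closed A"
  unfolding closed_sequential_limits
proof safe
  fix a l assume a: "\<forall>n. a n \<in> A" "a \<longlonglongrightarrow> l"
  from convergent_imp_bounded[OF a(2)] obtain R where R: "\<And>n. norm (a n) \<le> R"
    by (auto simp: bounded_iff)
  obtain q where q: "cball 0 R \<subseteq> causal_past q" using cball_subset_causal_past by blast
  have "closed (A \<inter> causal_past q)"
    using assms compact_imp_closed unfolding past_compact_def by blast
  moreover have "a n \<in> A \<inter> causal_past q" for n using a R q by (auto simp: dist_norm)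
  ultimately have "l \<in> A \<inter> causal_past q" using a(2) closed_sequentially by blast
  then show "l \<in> A" by blast
qed

lemma past_compact_subset:
  assumes "past_compact A" "closed B" "B \<subseteq> A" shows "past_compact B"
proof -
  have "B \<inter> causal_past p = B \<inter> (A \<inter> causal_past p)" for p using assms by blast
  then show ?thesis
    using assms unfolding past_compact_def by (metis closed_Int_compact)
qed

lemma past_compact_Un: "past_compact A \<Longrightarrow> past_compact B \<Longrightarrow> past_compact (A \<union> B)"
  unfolding past_compact_def by (simp add: Int_Un_distrib2 compact_Un)

lemma Jp_superset: "A \<subseteq> Jp A"
  unfolding Jp_def using zero_in_Vp by force

lemma Jp_Jp: "Jp (Jp A) = Jp A"
proof
  show "Jp (Jp A) \<subseteq> Jp A"
  proof
    fix x assume "x \<in> Jp (Jp A)"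
    then obtain a v w where "x = (a + v) + w" "a \<in> A" "v \<in> Vp" "w \<in> Vp" unfolding Jp_def by blast
    then have "x = a + (v + w)" "a \<in> A" "v + w \<in> Vp" using Vp_add by (auto simp: add.assoc)
    then show "x \<in> Jp A" unfolding Jp_def by blast
  qed
qed (rule Jp_superset)

lemma Jp_mono: "A \<subseteq> B \<Longrightarrow> Jp A \<subseteq> Jp B"
  unfolding Jp_def by blast

lemma Jp_time:
  assumes "A \<subseteq> {x. x $ 0 \<ge> t}" shows "Jp A \<subseteq> {x. x $ 0 \<ge> t}"
  using assms Vp_time_nonneg unfolding Jp_def by fastforce

text \<open>Only the compact piece of \<open>A\<close> inside the causal past of \<open>p\<close>
  can reach that past. Its future is a compact set plus the closed cone, hence closed; and the time
  of the cone vector is bounded, which bounds its norm.\<close>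

lemma past_compact_Jp:
  assumes "past_compact A" shows "past_compact (Jp A)"
  unfolding past_compact_def
proof
  fix p
  let ?K = "A \<inter> causal_past p"
  have K: "compact ?K" using assms by (simp add: past_compact_def)
  have eq: "Jp A \<inter> causal_past p = Jp ?K \<inter> causal_past p"
  proof -
    have "a \<in> causal_past p" if "a + v \<in> causal_past p" "v \<in> Vp" for a v
      using causal_past_trans[OF that] by simp
    then show ?thesis unfolding Jp_def by blast
  qed
  have "closed (Jp ?K)" 
  proof -
    have "Jp ?K = (\<Union>x\<in>?K. \<Union>y\<in>Vp. {x + y})" unfolding Jp_def by blast
    then show ?thesis using compact_closed_sums[OF K closed_Vp] by simp
  qed
  then have cl: "closed (Jp ?K \<inter> causal_past p)" by (simp add: closed_Int closed_causal_past)
  obtain D where D: "\<And>a. a \<in> ?K \<Longrightarrow> norm a \<le> D"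
    using compact_imp_bounded[OF K] by (auto simp: bounded_iff)
  have "norm x \<le> D + 4 * (p $ 0 + D)" if x: "x \<in> Jp ?K \<inter> causal_past p" for x
  proof -
    obtain a v where av: "x = a + v" "a \<in> ?K" "v \<in> Vp" using x unfolding Jp_def by blast
    have "p $ 0 - x $ 0 \<ge> 0" using x Vp_time_nonneg[of "p - x"] by (simp add: causal_past_iff)
    moreover have "\<bar>a $ 0\<bar> \<le> D" using D[OF av(2)] component_le_norm_cart[of a 0] by linarith
    ultimately have "v $ 0 \<le> p $ 0 + D" using av(1) by auto
    then show ?thesis using norm_Vp_le[OF av(3)] D[OF av(2)] av(1) norm_triangle_ineq[of a v] by simp
  qed
  then have "bounded (Jp ?K \<inter> causal_past p)" by (auto simp: bounded_iff)
  then show "compact (Jp A \<inter> causal_past p)" unfolding eq using cl compact_eq_bounded_closed by blast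
qed

text \<open>This turns retarded integrals into integrals over bounded sets, with one radius for all
  points of a causal past.\<close>

lemma past_compact_support_radius:
  assumes "past_compact K"
  shows "\<exists>T>0. \<forall>x\<in>causal_past q. \<forall>v\<in>Vp. x - v \<in> K \<longrightarrow> norm v \<le> T"
proof -
  have "compact (K \<inter> causal_past q)" using assms by (simp add: past_compact_def)
  then obtain D where D: "\<And>a. a \<in> K \<inter> causal_past q \<Longrightarrow> norm a \<le> D"
    using compact_imp_bounded by (metis bounded_iff)
  have "norm v \<le> max 1 (4 * (q $ 0 + D))" if "x \<in> causal_past q" "v \<in> Vp" "x - v \<in> K" for x v
  proof -
    have "norm (x - v) \<le> D" using D causal_past_trans that by blast
    then have "\<bar>(x - v) $ 0\<bar> \<le> D" using component_le_norm_cart[of "x - v" 0] by linarith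
    moreover have "q $ 0 - x $ 0 \<ge> 0" using that Vp_time_nonneg[of "q - x"] by (simp add: causal_past_iff)
    ultimately have "v $ 0 \<le> q $ 0 + D" by auto
    then show ?thesis using norm_Vp_le[OF that(2)] by simp
  qed
  then show ?thesis by (intro exI[of _ "max 1 (4 * (q $ 0 + D))"]) auto
qed

section \<open>Supports and the space \<open>Cpc\<close>\<close>

lemma tsupp_subsetI: "closed A \<Longrightarrow> (\<And>x. f x \<noteq> 0 \<Longrightarrow> x \<in> A) \<Longrightarrow> tsupp f \<subseteq> A"
  unfolding tsupp_def by (rule closure_minimal) auto

lemma in_tsupp: "f x \<noteq> 0 \<Longrightarrow> x \<in> tsupp f"
  unfolding tsupp_def by (rule subsetD[OF closure_subset]) simp

lemma closed_tsupp: "closed (tsupp f)"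
  unfolding tsupp_def by simp

lemma CpcI:
  assumes "smooth f" "past_compact A" "\<And>x. f x \<noteq> 0 \<Longrightarrow> x \<in> A" shows "f \<in> Cpc"
proof -
  have "tsupp f \<subseteq> A"
    by (rule tsupp_subsetI[OF past_compact_closed[OF assms(2)] assms(3)])
  then show ?thesis
    unfolding Cpc_def using past_compact_subset[OF assms(2) closed_tsupp] assms(1) by blast
qed

lemma Cpc_smooth: "f \<in> Cpc \<Longrightarrow> smooth f" and Cpc_past_compact: "f \<in> Cpc \<Longrightarrow> past_compact (tsupp f)"
  by (auto simp: Cpc_def)

lemma Cpc_lincomb:
  assumes "f \<in> Cpc" "g \<in> Cpc" shows "(\<lambda>x. a * f x + b * g x) \<in> Cpc"
proof (rule CpcI[OF smooth_lincomb past_compact_Un])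
  show "x \<in> tsupp f \<union> tsupp g" if "a * f x + b * g x \<noteq> 0" for x
    using that in_tsupp[of f x] in_tsupp[of g x] by (cases "f x = 0") auto
qed (use assms[THEN Cpc_smooth] assms[THEN Cpc_past_compact] in simp_all)

lemma Cpc_cmult: "f \<in> Cpc \<Longrightarrow> (\<lambda>x. a * f x) \<in> Cpc"
  using Cpc_lincomb[of f f a 0] by simp

lemma partial_eq_0_outside_tsupp:
  assumes "x \<notin> tsupp f" shows "partial i f x = 0"
proof -
  have "isCont (\<lambda>s. x + s *\<^sub>R axis i (1::real)) 0" by (intro continuous_intros)
  moreover have "open (- tsupp f)" using closed_tsupp by auto
  ultimately have "eventually (\<lambda>s. x + s *\<^sub>R axis i 1 \<in> - tsupp f) (nhds (0::real))"
    using assms unfolding continuous_at_open eventually_nhds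
    by (metis ComplI add.right_neutral scale_zero_left)
  then have "eventually (\<lambda>s. f (x + s *\<^sub>R axis i 1) = 0) (nhds 0)"
    by (rule eventually_mono) (use in_tsupp in auto)
  then have "deriv (\<lambda>s. f (x + s *\<^sub>R axis i 1)) 0 = deriv (\<lambda>s::real. 0) 0"
    by (rule deriv_cong_ev) auto
  then show ?thesis unfolding partial_def by simp
qed

lemma tsupp_partial: "tsupp (partial i f) \<subseteq> tsupp f"
  by (rule tsupp_subsetI[OF closed_tsupp]) (use partial_eq_0_outside_tsupp in blast)

lemma Cpc_partial:
  assumes "f \<in> Cpc" shows "partial i f \<in> Cpc"
  by (rule CpcI[OF smooth_partial[OF Cpc_smooth[OF assms]] Cpc_past_compact[OF assms]])
     (use partial_eq_0_outside_tsupp in blast)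

lemma Cpc_iter_partial: "f \<in> Cpc \<Longrightarrow> iter_partial ks f \<in> Cpc"
  by (induction ks) (auto intro: Cpc_partial)

lemma Cpc_dalembert: "f \<in> Cpc \<Longrightarrow> dalembert f \<in> Cpc"
  unfolding dalembert_altdef by (intro Cpc_lincomb Cpc_partial)

text \<open>Common template for \<open>Gk\<close>, \<open>mix\<close> and \<open>neumann\<close>:
  each is differentiated by differentiating its argument and propagates supports only into the
  causal future.\<close>

lemma Cpc_operatorI:
  assumes f: "f \<in> Cpc" and cont: "\<And>f. f \<in> Cpc \<Longrightarrow> continuous_on UNIV (A f)"
    and der: "\<And>f x i u. f \<in> Cpc \<Longrightarrow> ((\<lambda>u. A f (x + u *\<^sub>R axis i 1)) has_real_derivative
        A (partial i f) (x + u *\<^sub>R axis i 1)) (at u)"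
    and supp: "\<And>x. A f x \<noteq> 0 \<Longrightarrow> x \<in> Jp (tsupp f)"
  shows "A f \<in> Cpc" "partial i (A f) = A (partial i f)" "tsupp (A f) \<subseteq> Jp (tsupp f)"
proof -
  have pc: "past_compact (Jp (tsupp f))" by (rule past_compact_Jp[OF Cpc_past_compact[OF f]])
  have "smooth (A f)"
  proof (rule smooth_coinduct[where P = "A ` Cpc"])
    show "\<exists>g'\<in>A ` Cpc. \<forall>x. ((\<lambda>s. g (x + s *\<^sub>R axis i 1)) has_real_derivative g' x) (at 0)" if "g \<in> A ` Cpc" for g i
    proof -
      from that obtain f where "g = A f" "f \<in> Cpc" by blast
      then show ?thesis using der[of f _ i 0] Cpc_partial[of f i] by auto
    qed
  qed (use f cont in auto)
  then show "A f \<in> Cpc" by (rule CpcI[OF _ pc supp])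
  show "partial i (A f) = A (partial i f)" by (rule partial_eqI) (use der[OF f, of _ i 0] in simp)
  show "tsupp (A f) \<subseteq> Jp (tsupp f)" by (rule tsupp_subsetI[OF past_compact_closed[OF pc] supp])
qed

lemma Cpc_bounded:
  assumes "f \<in> Cpc" shows "\<exists>B\<ge>0. \<forall>y\<in>causal_past q. \<bar>f y\<bar> \<le> B"
proof -
  let ?K = "tsupp f \<inter> causal_past q"
  have "compact ?K" using Cpc_past_compact[OF assms] by (simp add: past_compact_def)
  then have "compact (f ` ?K)"
    using smooth_continuous[OF Cpc_smooth[OF assms]] compact_continuous_image by blast
  then obtain B where "\<And>y. y \<in> ?K \<Longrightarrow> \<bar>f y\<bar> \<le> B"
    using compact_imp_bounded[of "f ` ?K"] unfolding bounded_iff by (metis image_eqI real_norm_def)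
  then have "\<bar>f y\<bar> \<le> max 0 B" if "y \<in> causal_past q" for y
    using that in_tsupp[of f y] by (cases "f y = 0") (auto simp: le_max_iff_disj)
  then show ?thesis by (intro exI[of _ "max 0 B"]) auto
qed

section \<open>Parameter integrals\<close>

lemma cball_in_borel [measurable]: "cball c r \<in> sets borel"
  by simp

text \<open>General in the measure, so as to cover Lebesgue integrals as well as series, read as
  integrals over the counting measure. The majorant may vary with the point, as bounds are available
  only on causal pasts.\<close>

lemma continuous_on_integral_dominated:
  fixes g :: "'a::metric_space \<Rightarrow> 'b \<Rightarrow> real"
  assumes meas: "\<And>p. p \<in> S \<Longrightarrow> g p \<in> borel_measurable N"
    and cont: "AE b in N. continuous_on S (\<lambda>p. g p b)"
    and dom: "\<And>p. p \<in> S \<Longrightarrow> \<exists>r>0. \<exists>B. integrable N B \<and>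
        (\<forall>p'\<in>S. dist p' p < r \<longrightarrow> (AE b in N. \<bar>g p' b\<bar> \<le> B b))"
  shows "continuous_on S (\<lambda>p. \<integral>b. g p b \<partial>N)"
  unfolding continuous_on_sequentially
proof (intro allI ballI impI, elim conjE)
  fix x a assume a: "a \<in> S" "\<forall>n. x n \<in> S" "x \<longlonglongrightarrow> a"
  from dom[OF a(1)] obtain r B where r: "r > 0" "integrable N B"
    "\<And>p'. p' \<in> S \<Longrightarrow> dist p' a < r \<Longrightarrow> (AE b in N. \<bar>g p' b\<bar> \<le> B b)" by blast
  from metric_LIMSEQ_D[OF a(3) r(1)] obtain k where k: "\<And>n. n \<ge> k \<Longrightarrow> dist (x n) a < r" by blast
  have "(\<lambda>n. \<integral>b. g (x (n + k)) b \<partial>N) \<longlonglongrightarrow> (\<integral>b. g a b \<partial>N)"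
  proof (rule integral_dominated_convergence[OF _ _ r(2)])
    show "AE b in N. (\<lambda>n. g (x (n + k)) b) \<longlonglongrightarrow> g a b"
      using cont
    proof (eventually_elim)
      case (elim b)
      then have "(\<lambda>n. g (x n) b) \<longlonglongrightarrow> g a b"
        using a unfolding continuous_on_sequentially by (auto simp: o_def)
      then show ?case by (rule LIMSEQ_ignore_initial_segment)
    qed
  qed (use a r(3) k meas in auto)
  then show "((\<lambda>p. \<integral>b. g p b \<partial>N) \<circ> x) \<longlonglongrightarrow> (\<integral>b. g a b \<partial>N)"
    unfolding o_def by (rule LIMSEQ_offset)
qed

text \<open>The mean value inequality bounds the difference quotients by the majorant of the
  derivative; dominated convergence then applies along every null sequence.\<close>

lemma has_real_derivative_integral:
  fixes g :: "real \<Rightarrow> 'b \<Rightarrow> real"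
  assumes r: "r > 0"
    and int: "\<And>u. \<bar>u - u0\<bar> < r \<Longrightarrow> integrable N (g u)"
    and meas: "g' u0 \<in> borel_measurable N"
    and der: "AE b in N. \<forall>u. \<bar>u - u0\<bar> < r \<longrightarrow> ((\<lambda>u. g u b) has_real_derivative g' u b) (at u)"
    and dom: "AE b in N. \<forall>u. \<bar>u - u0\<bar> < r \<longrightarrow> \<bar>g' u b\<bar> \<le> B b" and B: "integrable N B"
  shows "((\<lambda>u. \<integral>b. g u b \<partial>N) has_real_derivative (\<integral>b. g' u0 b \<partial>N)) (at u0)"
  unfolding DERIV_def tendsto_at_iff_sequentially
proof (intro allI impI)
  fix X assume X: "\<forall>i. X i \<in> UNIV - {0::real}" "X \<longlonglongrightarrow> 0"
  from LIMSEQ_D[OF X(2) r] obtain k where k: "\<And>n. n \<ge> k \<Longrightarrow> \<bar>X n\<bar> < r" by auto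
  have "(\<lambda>n. \<integral>b. (g (u0 + X (n + k)) b - g u0 b) / X (n + k) \<partial>N) \<longlonglongrightarrow> (\<integral>b. g' u0 b \<partial>N)"
  proof (rule integral_dominated_convergence[OF meas _ B])
    show "(\<lambda>b. (g (u0 + X (n + k)) b - g u0 b) / X (n + k)) \<in> borel_measurable N" for n
      using int[of "u0 + X (n + k)"] int[of u0] k[of "n + k"] r by auto
    show "AE b in N. (\<lambda>n. (g (u0 + X (n + k)) b - g u0 b) / X (n + k)) \<longlonglongrightarrow> g' u0 b"
      using der
    proof eventually_elim
      case (elim b)
      then have "((\<lambda>u. g u b) has_real_derivative g' u0 b) (at u0)" using r by simp
      then have "(\<lambda>n. (g (u0 + X n) b - g u0 b) / X n) \<longlonglongrightarrow> g' u0 b"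
        using X unfolding DERIV_def tendsto_at_iff_sequentially by (auto simp: o_def)
      then show ?case by (rule LIMSEQ_ignore_initial_segment)
    qed
    show "AE b in N. norm ((g (u0 + X (n + k)) b - g u0 b) / X (n + k)) \<le> B b" for n
      using der dom
    proof eventually_elim
      case (elim b)
      let ?h = "X (n + k)"
      have h: "?h \<noteq> 0" "\<bar>?h\<bar> < r" using X k[of "n + k"] by auto
      have "norm (g (u0 + ?h) b - g u0 b) \<le> B b * norm (u0 + ?h - u0)"
      proof (rule field_differentiable_bound[of "ball u0 r" _ "\<lambda>u. g' u b"])
        show "((\<lambda>u. g u b) has_real_derivative g' z b) (at z within ball u0 r)" if "z \<in> ball u0 r" for z
        proof -
          have "\<bar>z - u0\<bar> < r" using that by (simp add: dist_real_def abs_minus_commute)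
          then show ?thesis using elim(1) has_field_derivative_at_within by blast
        qed
        show "norm (g' z b) \<le> B b" if "z \<in> ball u0 r" for z
          using elim(2) that by (auto simp: dist_real_def abs_minus_commute)
      qed (use h r in \<open>auto simp: dist_real_def\<close>)
      then show ?case using h by (simp add: divide_le_eq)
    qed
  qed
  also have "(\<lambda>n. \<integral>b. (g (u0 + X (n + k)) b - g u0 b) / X (n + k) \<partial>N) =
     (\<lambda>n. ((\<integral>b. g (u0 + X (n + k)) b \<partial>N) - (\<integral>b. g u0 b \<partial>N)) / X (n + k))"
    using int k r by (intro ext) (simp add: Bochner_Integration.integral_diff)
  finally show "((\<lambda>h. ((\<integral>b. g (u0 + h) b \<partial>N) - (\<integral>b. g u0 b \<partial>N)) / h) \<circ> X) \<longlonglongrightarrow> (\<integral>b. g' u0 b \<partial>N)"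
    unfolding o_def by (rule LIMSEQ_offset)
qed

lemma integrable_lborel_translation:
  fixes g :: "'a::euclidean_space \<Rightarrow> real"
  assumes "integrable lborel g"
  shows "integrable lborel (\<lambda>y. g (y + c))" "(\<integral>y. g (y + c) \<partial>lborel) = (\<integral>y. g y \<partial>lborel)"
proof -
  have "integrable (distr lborel borel ((+) c)) g" using assms by (simp add: lborel_distr_plus)
  then show "integrable lborel (\<lambda>y. g (y + c))"
    by (subst (asm) integrable_distr_eq) (use assms in \<open>auto simp: add.commute\<close>)
  have "(\<integral>y. g y \<partial>lborel) = (\<integral>y. g y \<partial>distr lborel borel ((+) c))" by (simp add: lborel_distr_plus)
  also have "\<dots> = (\<integral>y. g (c + y) \<partial>lborel)"
    by (subst integral_distr) (use assms in auto)
  finally show "(\<integral>y. g (y + c) \<partial>lborel) = (\<integral>y. g y \<partial>lborel)" by (simp add: add.commute)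
qed

lemma integrable_bounded_support:
  fixes g :: "'a::euclidean_space \<Rightarrow> real"
  assumes "g \<in> borel_measurable lborel" "\<And>y. \<bar>g y\<bar> \<le> C * indicat_real (cball 0 T) y"
  shows "integrable lborel g"
proof (rule Bochner_Integration.integrable_bound[OF _ assms(1)])
  have "emeasure lborel (cball (0::'a) T) < \<infinity>"
    by (rule emeasure_bounded_finite) simp
  then show "integrable lborel (\<lambda>y::'a. C * indicat_real (cball 0 T) y)" by simp
  show "AE y in lborel. norm (g y) \<le> norm (C * indicat_real (cball 0 T) y)"
    using assms(2) by (intro AE_I2) (metis abs_ge_self order_trans real_norm_def)
qed

text \<open>The integral of a translate does not depend on the translation, so differentiating under
  the integral at zero shift gives 0. This serves as the divergence theorem without boundary
  terms.\<close>

lemma integral_directional_derivative_eq_0: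
  fixes g :: "'a::euclidean_space \<Rightarrow> real"
  assumes g: "integrable lborel g" and g': "g' \<in> borel_measurable lborel"
    and der: "\<And>y u. ((\<lambda>u. g (y + u *\<^sub>R b)) has_real_derivative g' (y + u *\<^sub>R b)) (at u)"
    and bound: "\<And>y. \<bar>g' y\<bar> \<le> C * indicat_real (cball 0 T) y"
  shows "(\<integral>y. g' y \<partial>lborel) = 0"
proof -
  have "((\<lambda>u. \<integral>y. g (y + u *\<^sub>R b) \<partial>lborel) has_real_derivative (\<integral>y. g' (y + 0 *\<^sub>R b) \<partial>lborel)) (at 0)"
  proof (rule has_real_derivative_integral[where r = 1 and B = "\<lambda>y. \<bar>C\<bar> * indicat_real (cball 0 (T + norm b)) y"])
    show "integrable lborel (\<lambda>y. \<bar>C\<bar> * indicat_real (cball 0 (T + norm b)) y)"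
      by (rule integrable_bounded_support[where C = "\<bar>C\<bar>" and T = "T + norm b"]) (auto simp: indicator_def)
    show "AE y in lborel. \<forall>u. \<bar>u - 0\<bar> < 1 \<longrightarrow> \<bar>g' (y + u *\<^sub>R b)\<bar> \<le> \<bar>C\<bar> * indicat_real (cball 0 (T + norm b)) y"
    proof (intro AE_I2 allI impI)
      fix y :: 'a and u :: real assume u: "\<bar>u - 0\<bar> < 1"
      have "norm y \<le> norm (y + u *\<^sub>R b) + norm (u *\<^sub>R b)"
        using norm_triangle_ineq4[of "y + u *\<^sub>R b" "u *\<^sub>R b"] by simp
      also have "norm (u *\<^sub>R b) \<le> 1 * norm b" unfolding norm_scaleR using u by (intro mult_right_mono) auto
      finally have "norm y \<le> norm (y + u *\<^sub>R b) + norm b" by simp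
      then show "\<bar>g' (y + u *\<^sub>R b)\<bar> \<le> \<bar>C\<bar> * indicat_real (cball 0 (T + norm b)) y"
        using bound[of "y + u *\<^sub>R b"]
        by (cases "norm (y + u *\<^sub>R b) \<le> T") (auto simp: indicator_def)
    qed
  qed (use integrable_lborel_translation[OF g] der g' in auto)
  then have "((\<lambda>u::real. \<integral>y. g y \<partial>lborel) has_real_derivative (\<integral>y. g' y \<partial>lborel)) (at 0)"
    by (simp add: integrable_lborel_translation[OF g])
  then show ?thesis using DERIV_const DERIV_unique by blast
qed

section \<open>Scaling and radial weights in three dimensions\<close>

lemma integral_lborel_scale:
  fixes g :: "'a::euclidean_space \<Rightarrow> real"
  assumes "c > 0" "g \<in> borel_measurable borel"
  shows "(\<integral>y. g y \<partial>lborel) = c ^ DIM('a) * (\<integral>y. g (c *\<^sub>R y) \<partial>lborel)"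
proof -
  have "(\<integral>y. g y \<partial>lborel) = (\<integral>y. g y \<partial>density (distr lborel borel (\<lambda>x. 0 + c *\<^sub>R x)) (\<lambda>_. ennreal (\<bar>c\<bar> ^ DIM('a))))"
    using lborel_affine[of c "0::'a"] assms(1) by (metis less_irrefl)
  also have "\<dots> = (\<integral>y. c ^ DIM('a) * g y \<partial>distr lborel borel (\<lambda>x. 0 + c *\<^sub>R x))"
    by (subst integral_density) (use assms in \<open>auto\<close>)
  also have "\<dots> = (\<integral>y. c ^ DIM('a) * g (c *\<^sub>R y) \<partial>lborel)"
    by (subst integral_distr) (use assms in auto)
  finally show ?thesis by simp
qed

text \<open>Balls of radius \<open>R k\<close> with levels \<open>w k\<close> dominate the function,
  and finiteness becomes a series of ball volumes. Shrinking radii handle a singularity at the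
  origin, growing radii decay at infinity.\<close>

lemma integrable_dyadic_majorant:
  fixes h :: "real^3 \<Rightarrow> real"
  assumes h: "h \<in> borel_measurable lborel" and nonneg: "\<And>k. 0 \<le> w k" "\<And>k. 0 \<le> R k"
    and sum: "summable (\<lambda>k. w k * R k ^ 3)"
    and bound: "\<And>y. y \<noteq> 0 \<Longrightarrow> h y \<noteq> 0 \<Longrightarrow> \<exists>k. norm y \<le> R k \<and> \<bar>h y\<bar> \<le> w k"
  shows "integrable lborel h"
proof (rule integrableI_bounded[OF h])
  let ?m = "\<lambda>k y. ennreal (w k) * indicator (cball (0::real^3) (R k)) y"
  have "(\<integral>\<^sup>+y. ennreal (norm (h y)) \<partial>lborel) \<le> (\<integral>\<^sup>+y. (\<Sum>k. ?m k y) \<partial>lborel)"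
  proof (rule nn_integral_mono_AE)
    have "ennreal (norm (h y)) \<le> (\<Sum>k. ?m k y)" if y: "y \<noteq> 0" for y
    proof (cases "h y = 0")
      case False
      from bound[OF y this] obtain k where k: "norm y \<le> R k" "\<bar>h y\<bar> \<le> w k" by blast
      then have "ennreal (norm (h y)) \<le> ?m k y" by (auto intro: ennreal_leI)
      also have "?m k y \<le> (\<Sum>k. ?m k y)"
      proof -
        have "f k \<le> (\<Sum>k. f k)" for f :: "nat \<Rightarrow> ennreal"
          using sum_le_suminf[of f "{k}"] by simp
        from this[of "\<lambda>k. ?m k y"] show ?thesis .
      qed
      finally show ?thesis .
    qed simp
    moreover have "AE y in lborel. y \<noteq> (0::real^3)" by (rule AE_lborel_singleton)
    ultimately show "AE y in lborel. ennreal (norm (h y)) \<le> (\<Sum>k. ?m k y)" by auto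
  qed
  also have "\<dots> = (\<Sum>k. \<integral>\<^sup>+y. ?m k y \<partial>lborel)"
    by (rule nn_integral_suminf) measurable
  also have "(\<lambda>k. \<integral>\<^sup>+y. ?m k y \<partial>lborel) = (\<lambda>k. ennreal (unit_ball_vol 3 * (w k * R k ^ 3)))"
  proof
    fix k
    have "(\<integral>\<^sup>+y. ?m k y \<partial>lborel) = ennreal (w k) * emeasure lborel (cball (0::real^3) (R k))"
      by (simp add: nn_integral_cmult)
    also have "\<dots> = ennreal (unit_ball_vol 3 * (w k * R k ^ 3))"
      using nonneg by (simp add: emeasure_cball ennreal_mult'[symmetric] mult_ac)
    finally show "(\<integral>\<^sup>+y. ?m k y \<partial>lborel) = ennreal (unit_ball_vol 3 * (w k * R k ^ 3))" .
  qed
  also have "(\<Sum>k. ennreal (unit_ball_vol 3 * (w k * R k ^ 3))) = ennreal (\<Sum>k. unit_ball_vol 3 * (w k * R k ^ 3))"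
    using sum nonneg by (intro suminf_ennreal2 summable_mult) auto
  finally show "(\<integral>\<^sup>+y. ennreal (norm (h y)) \<partial>lborel) < \<infinity>" by (rule le_less_trans) simp
qed

lemma integrable_inverse_norm_sq:
  "integrable lborel (\<lambda>y::real^3. indicat_real (cball 0 T) y / norm y ^ 2)"
proof (cases "T > 0")
  case True
  show ?thesis
  \<comment> \<open>Where the norm is at most \<open>T * (1/2) ^ k\<close> and more than half of it,
    the function is at most \<open>4 * 4 ^ k / T\<^sup>2\<close>; against the volume the series is
    geometric with ratio 1/2.\<close>
  proof (rule integrable_dyadic_majorant[where R = "\<lambda>k. T * (1/2) ^ k" and w = "\<lambda>k. 4 * 4 ^ k / T\<^sup>2"])
    have "(\<lambda>k. 4 * 4 ^ k / T\<^sup>2 * (T * (1 / 2) ^ k) ^ 3) = (\<lambda>k. 4 * T * (1/2) ^ k)"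
    proof
      fix k
      have "(4::real) ^ k * ((1 / 2) ^ k) ^ 3 = (1/2) ^ k"
      proof -
        have "((1 / 2 :: real) ^ k) ^ 3 = ((1 / 2) ^ 3) ^ k" by (metis power_mult mult.commute)
        then have "(4::real) ^ k * ((1 / 2) ^ k) ^ 3 = (4 * (1 / 2) ^ 3) ^ k" by (simp only: power_mult_distrib)
        then show ?thesis by (simp add: power3_eq_cube)
      qed
      then show "4 * 4 ^ k / T\<^sup>2 * (T * (1 / 2) ^ k) ^ 3 = 4 * T * (1/2) ^ k"
        using True by (simp add: power_mult_distrib power2_eq_square power3_eq_cube)
    qed
    then show "summable (\<lambda>k. 4 * 4 ^ k / T\<^sup>2 * (T * (1 / 2) ^ k) ^ 3)"
      by (simp add: summable_mult summable_geometric)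
    show "\<exists>k. norm y \<le> T * (1/2) ^ k \<and> \<bar>indicat_real (cball 0 T) y / norm y ^ 2\<bar> \<le> 4 * 4 ^ k / T\<^sup>2"
      if y: "y \<noteq> 0" "indicat_real (cball 0 T) y / norm y ^ 2 \<noteq> 0" for y :: "real^3"
    proof -
      have T: "norm y \<le> T" using y by (auto simp: indicator_def dist_norm split: if_splits)
      obtain n where n: "(1/2) ^ n < norm y / T"
        using real_arch_pow_inv[of "norm y / T" "1/2"] y True by auto
      define P where "P k \<longleftrightarrow> T * (1/2) ^ k < norm y" for k
      have "P n" using n True by (simp add: P_def field_simps)
      define k where "k = (LEAST k. P k)"
      have "P k" unfolding k_def using \<open>P n\<close> by (rule LeastI)
      have "k \<noteq> 0" using \<open>P k\<close> T by (auto simp: P_def intro: ccontr)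
      then obtain j where j: "k = Suc j" by (cases k) auto
      have "\<not> P j" using not_less_Least[of j P] unfolding k_def[symmetric] j by simp
      then have 1: "norm y \<le> T * (1/2) ^ j" by (simp add: P_def)
      have "T * (1/2) ^ j / 2 < norm y" using \<open>P k\<close> by (simp add: P_def j)
      then have "(T * (1/2) ^ j / 2)\<^sup>2 \<le> (norm y)\<^sup>2" using True by (intro power_mono) auto
      then have "1 / (norm y)\<^sup>2 \<le> 1 / (T * (1/2) ^ j / 2)\<^sup>2" using True y by (intro divide_left_mono) auto
      also have "\<dots> = 4 * 4 ^ j / T\<^sup>2"
      proof -
        have "((1 / 2 :: real) ^ j)\<^sup>2 = ((1 / 2)\<^sup>2) ^ j" by (metis power_mult mult.commute)
        then have "((1 / 2 :: real) ^ j)\<^sup>2 = 1 / 4 ^ j" by (simp add: power_divide power2_eq_square)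
        then show ?thesis using True by (simp add: power_mult_distrib power_divide)
      qed
      finally have "\<bar>indicat_real (cball 0 T) y / norm y ^ 2\<bar> \<le> 4 * 4 ^ j / T\<^sup>2" by (auto simp: indicator_def)
      with 1 show ?thesis by blast
    qed
  qed (use True in auto)
next
  case False
  have "indicat_real (cball 0 T) y / norm y ^ 2 = 0" for y :: "real^3"
  proof (cases "y = 0")
    case nz: False
    then have "norm y > T" using False zero_less_norm_iff[of y] by linarith
    then show ?thesis by (simp add: dist_norm)
  qed simp
  then have "(\<lambda>y::real^3. indicat_real (cball 0 T) y / norm y ^ 2) = (\<lambda>_. 0)" by blast
  then show ?thesis by (simp only: integrable_zero)
qed

lemma integrable_inverse_norm:
  "integrable lborel (\<lambda>y::real^3. indicat_real (cball 0 T) y / norm y)"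
proof (rule Bochner_Integration.integrable_bound[OF integrable_mult_right[OF integrable_inverse_norm_sq, of T T]])
  show "AE y in lborel. norm (indicat_real (cball 0 T) y / norm y) \<le>
      norm (T * (indicat_real (cball 0 T) y / (norm (y::real^3))\<^sup>2))"
  proof (intro AE_I2)
    fix y :: "real^3"
    show "norm (indicat_real (cball 0 T) y / norm y) \<le> norm (T * (indicat_real (cball 0 T) y / (norm y)\<^sup>2))"
    proof (cases "y = 0 \<or> norm y > T")
      case False
      then have "1 / norm y \<le> \<bar>T\<bar> / (norm y)\<^sup>2"
        by (simp add: power2_eq_square divide_simps) (smt (verit) norm_ge_zero)
      then show ?thesis using False by (simp add: indicator_def dist_norm abs_mult)
    qed (auto simp: indicator_def dist_norm)
  qed
qed (simp add: borel_measurable_indicator borel_measurable_divide)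

section \<open>Bessel functions\<close>

text \<open>\<open>F0 z\<close> is \<open>J\<^sub>0 (sqrt z)\<close> and \<open>F1 z\<close> is \<open>2 J\<^sub>1 (sqrt z) / sqrt z\<close>, both as entire functions.\<close>

definition bessel_coeff :: "nat \<Rightarrow> real" where
  "bessel_coeff n = (- 1 / 4) ^ n / (fact n)\<^sup>2"

definition F0 :: "real \<Rightarrow> real" where
  "F0 z = (\<Sum>n. bessel_coeff n * z ^ n)"

definition F1 :: "real \<Rightarrow> real" where
  "F1 z = (\<Sum>n. bessel_coeff n / (real n + 1) * z ^ n)"

lemma summable_bessel_bounded:
  assumes "\<And>n. \<bar>c n\<bar> \<le> \<bar>bessel_coeff n\<bar>"
  shows "summable (\<lambda>n. c n * z ^ n :: real)"
proof (rule summable_comparison_test')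
  show "summable (\<lambda>n. (\<bar>z\<bar> / 4) ^ n / fact n)"
    unfolding divide_inverse_commute[of _ "fact _"] by (rule summable_exp)
  show "norm (c n * z ^ n) \<le> (\<bar>z\<bar> / 4) ^ n / fact n" for n
  proof -
    have "norm (c n * z ^ n) \<le> \<bar>bessel_coeff n\<bar> * \<bar>z\<bar> ^ n"
      using assms[of n] by (simp add: abs_mult power_abs mult_right_mono)
    also have "\<dots> = (\<bar>z\<bar> / 4) ^ n / (fact n)\<^sup>2"
      by (simp add: bessel_coeff_def abs_divide power_abs power_divide)
    also have "\<dots> \<le> (\<bar>z\<bar> / 4) ^ n / fact n"
      by (intro divide_left_mono) (auto simp: power2_eq_square fact_ge_1)
    finally show ?thesis .
  qed
qed

lemma bessel_coeff_Suc: "bessel_coeff (Suc n) * (real n + 1) = - (bessel_coeff n / (real n + 1)) / 4"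
proof -
  have "real n + 1 \<noteq> 0" by linarith
  then show ?thesis by (simp add: bessel_coeff_def power2_eq_square divide_simps add.commute)
qed

lemma F0_DERIV: "(F0 has_real_derivative - F1 z / 4) (at z)"
proof -
  have s1: "summable (\<lambda>n. bessel_coeff n / (real n + 1) * z ^ n)"
    by (rule summable_bessel_bounded) (auto simp: divide_simps mult_le_cancel_left1)
  have "((\<lambda>z. \<Sum>n. bessel_coeff n * z ^ n) has_real_derivative (\<Sum>n. diffs bessel_coeff n * z ^ n)) (at z)"
    by (rule termdiffs_strong_converges_everywhere) (rule summable_bessel_bounded, simp)
  also have "(\<lambda>n. diffs bessel_coeff n * z ^ n) = (\<lambda>n. (- 1 / 4) * (bessel_coeff n / (real n + 1) * z ^ n))"
    using bessel_coeff_Suc by (auto simp: diffs_def mult.commute add.commute)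
  also have "(\<Sum>n. (- 1 / 4) * (bessel_coeff n / (real n + 1) * z ^ n)) = - F1 z / 4"
    unfolding F1_def by (subst suminf_mult[OF s1]) simp
  finally show ?thesis by (simp add: F0_def[abs_def])
qed

lemma F1_differentiable: "\<exists>D. (F1 has_real_derivative D) (at z)"
  unfolding F1_def[abs_def]
  by (rule exI, rule termdiffs_strong_converges_everywhere)
     (rule summable_bessel_bounded, auto simp: divide_simps mult_le_cancel_left1)

text \<open>The relation (x J_1)' = x J_0 in the variable z = x^2. Together with
  \<open>F0_DERIV\<close> it encodes the Bessel equation.\<close>

lemma mult_F1_DERIV: "((\<lambda>z. z * F1 z) has_real_derivative F0 z) (at z)"
proof -
  define c where "c n = (case n of 0 \<Rightarrow> 0 | Suc k \<Rightarrow> bessel_coeff k / (real k + 1))" for n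
  have s1: "summable (\<lambda>n. bessel_coeff n / (real n + 1) * z ^ n)" for z
    by (rule summable_bessel_bounded) (auto simp: divide_simps mult_le_cancel_left1)
  have sz: "summable (\<lambda>n. c (Suc n) * z ^ Suc n)" for z
    using summable_mult[OF s1[of z], of z] by (simp add: c_def mult_ac)
  then have sc: "summable (\<lambda>n. c n * z ^ n)" for z
    by (subst (asm) summable_Suc_iff)
  have eq: "(\<Sum>n. c n * z ^ n) = z * F1 z" for z
    using suminf_split_head[OF sc[of z]] suminf_mult[OF s1[of z], of z]
    by (simp add: c_def F1_def mult_ac)
  have "((\<lambda>z. \<Sum>n. c n * z ^ n) has_real_derivative (\<Sum>n. diffs c n * z ^ n)) (at z)"
    by (rule termdiffs_strong_converges_everywhere[OF sc])
  also have "diffs c = bessel_coeff" 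
  proof
    fix n
    have "real n + 1 \<noteq> 0" by linarith
    then show "diffs c n = bessel_coeff n" by (simp add: diffs_def c_def add.commute)
  qed
  finally show ?thesis unfolding eq F0_def .
qed

text \<open>Stated without dividing by z, so that it holds at z = 0 as well.\<close>

lemma F1_DERIV: obtains D where "(F1 has_real_derivative D) (at z)" "z * D = F0 z - F1 z"
proof -
  obtain D where D: "(F1 has_real_derivative D) (at z)" using F1_differentiable by blast
  then have "((\<lambda>z. z * F1 z) has_real_derivative 1 * F1 z + D * z) (at z)"
    by (intro DERIV_mult DERIV_ident)
  from DERIV_unique[OF this mult_F1_DERIV] show ?thesis using that[OF D] by (simp add: algebra_simps)
qed

lemma continuous_on_F0: "continuous_on A F0"
  by (intro continuous_at_imp_continuous_on ballI DERIV_isCont[OF F0_DERIV])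

lemma continuous_on_F1: "continuous_on A F1"
proof (intro continuous_at_imp_continuous_on ballI)
  show "isCont F1 z" for z using F1_differentiable[of z] DERIV_isCont by blast
qed

text \<open>The energy \<open>F0\<^sup>2 + z F1\<^sup>2 / 4\<close> is nonincreasing on the positive axis.\<close>

lemma F0_abs_le_1:
  assumes "z \<ge> 0" shows "\<bar>F0 z\<bar> \<le> 1"
proof -
  let ?H = "\<lambda>z. (F0 z)\<^sup>2 + z * F1 z * F1 z / 4"
  have "\<exists>y. (?H has_real_derivative y) (at x) \<and> y \<le> 0" for x
  proof -
    obtain D where D: "(F1 has_real_derivative D) (at x)" "x * D = F0 x - F1 x" by (rule F1_DERIV)
    have "(?H has_real_derivative 2 * F0 x * (- F1 x / 4) + ((F1 x + x * D) * F1 x + x * D * F1 x) / 4) (at x)"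
      by (auto intro!: derivative_eq_intros F0_DERIV D(1) simp: algebra_simps)
    also have "2 * F0 x * (- F1 x / 4) + ((F1 x + x * D) * F1 x + x * D * F1 x) / 4 = - (F1 x)\<^sup>2 / 4"
      unfolding D(2) by (simp add: power2_eq_square field_simps)
    finally show ?thesis by (intro exI[of _ "- (F1 x)\<^sup>2 / 4"]) auto
  qed
  then have "?H z \<le> ?H 0" using DERIV_nonpos_imp_nonincreasing[OF assms, of ?H] by blast
  moreover have "F0 0 = 1" 
    using powser_zero[of bessel_coeff] by (simp add: F0_def bessel_coeff_def)
  moreover have "0 \<le> z * F1 z * F1 z / 4" using assms by (simp add: mult.assoc)
  ultimately have "(F0 z)\<^sup>2 \<le> 1" by simp
  then show ?thesis by (simp add: abs_square_le_1)
qed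

text \<open>On the negative axis \<open>F0\<close> is a modified Bessel function and grows, but
  masses above - \<Gamma> and values of s between 0 and S only reach arguments above - \<Gamma>
  S.\<close>

lemma F0_bounded_below: "\<exists>C\<ge>0. \<forall>z\<ge>-Z. \<bar>F0 z\<bar> \<le> C"
proof -
  have "compact (F0 ` {-Z..0})" by (intro compact_continuous_image continuous_on_F0) auto
  then obtain C where C: "\<And>z. z \<in> {-Z..0} \<Longrightarrow> \<bar>F0 z\<bar> \<le> C"
    using compact_imp_bounded[of "F0 ` {-Z..0}"] unfolding bounded_iff by (metis image_eqI real_norm_def)
  have "\<bar>F0 z\<bar> \<le> max 1 C" if "z \<ge> -Z" for z
    using C[of z] F0_abs_le_1[of z] that by (cases "z \<ge> 0") (auto simp: le_max_iff_disj)
  then show ?thesis by (intro exI[of _ "max 1 C"]) auto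
qed

text \<open>For positive arguments this is 2 sqrt (M / s) J_1 (sqrt (M s)), up to a constant the
  familiar massive kernel inside the light cone. As an entire function it covers masses of either
  sign.\<close>

definition Phi :: "real \<Rightarrow> real \<Rightarrow> real" where
  "Phi M s = M * F1 (M * s)"

lemma Phi_DERIV: "((\<lambda>M. Phi M s) has_real_derivative F0 (M * s)) (at M)"
proof -
  obtain D where D: "(F1 has_real_derivative D) (at (M * s))" "M * s * D = F0 (M * s) - F1 (M * s)"
    by (rule F1_DERIV)
  have "((\<lambda>M. F1 (M * s)) has_real_derivative D * s) (at M)"
    by (rule DERIV_chain2[where f = F1 and g = "\<lambda>M. M * s", OF D(1)]) (auto intro!: derivative_eq_intros)
  then have "((\<lambda>M. M * F1 (M * s)) has_real_derivative 1 * F1 (M * s) + D * s * M) (at M)"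
    by (intro DERIV_mult DERIV_ident)
  then show ?thesis using D(2) unfolding Phi_def by (simp add: mult_ac)
qed

text \<open>The mass derivative is \<open>F0 (M * s)\<close>, bounded by a constant, although this
  bounds \<open>Phi\<close> itself only by a multiple of the mass. Here lies the source of the
  estimate for two Green operators that is uniform in both masses.\<close>

lemma Phi_lipschitz:
  assumes "\<And>z. z \<ge> - (\<Gamma> * S) \<Longrightarrow> \<bar>F0 z\<bar> \<le> C" "0 \<le> s" "s \<le> S" "\<Gamma> \<ge> 0" "M \<ge> -\<Gamma>" "M' \<ge> -\<Gamma>"
  shows "\<bar>Phi M s - Phi M' s\<bar> \<le> C * \<bar>M - M'\<bar>"
proof -
  have "norm (Phi M s - Phi M' s) \<le> C * norm (M - M')"
  proof (rule field_differentiable_bound[of "{-\<Gamma>..}" _ "\<lambda>M. F0 (M * s)"])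
    fix z assume z: "z \<in> {-\<Gamma>..}"
    show "((\<lambda>M. Phi M s) has_real_derivative F0 (z * s)) (at z within {-\<Gamma>..})"
      by (rule has_field_derivative_at_within[OF Phi_DERIV])
    have "- (\<Gamma> * S) \<le> - (\<Gamma> * s)" using assms by (simp add: mult_left_mono)
    also have "\<dots> \<le> z * s" using z assms mult_right_mono[of "-\<Gamma>" z s] by simp
    finally show "norm (F0 (z * s)) \<le> C" using assms(1) by simp
  qed (use assms in auto)
  then show ?thesis by simp
qed

lemma Phi_0 [simp]: "Phi 0 s = 0"
  by (simp add: Phi_def)

lemma continuous_on_Phi:
  "continuous_on A f \<Longrightarrow> continuous_on A g \<Longrightarrow> continuous_on A (\<lambda>x. Phi (f x) (g x))"
  unfolding Phi_def by (intro continuous_intros continuous_on_compose2[OF continuous_on_F1[of UNIV]]) auto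

text \<open>With \<open>F0_mult_DERIV\<close> this says that u = s Phi solves 4 s u'' = - M u, the
  equation obeyed by the hyperboloid averages of a solution of box f = M f.\<close>

lemma mult_Phi_DERIV: "((\<lambda>s. s * Phi M s) has_real_derivative M * F0 (M * s)) (at s)"
proof -
  have "((\<lambda>s. (\<lambda>z. z * F1 z) (M * s)) has_real_derivative F0 (M * s) * M) (at s)"
    by (rule DERIV_chain2[OF mult_F1_DERIV]) (auto intro!: derivative_eq_intros)
  then show ?thesis by (simp add: Phi_def mult_ac)
qed

lemma F0_mult_DERIV: "((\<lambda>s. M * F0 (M * s)) has_real_derivative - M * Phi M s / 4) (at s)"
proof -
  have "((\<lambda>s. F0 (M * s)) has_real_derivative - F1 (M * s) / 4 * M) (at s)"
    by (rule DERIV_chain2[OF F0_DERIV]) (auto intro!: derivative_eq_intros)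
  from DERIV_cmult[OF this, of M] show ?thesis by (simp add: Phi_def mult_ac)
qed

section \<open>Integrals over mass hyperboloids\<close>

text \<open>In the index type \<open>3\<close> the numeral 3 is 0, so the last branch is the third
  spatial axis of \<open>pt\<close>.\<close>

definition kap :: "3 \<Rightarrow> 4" where
  "kap j = (if j = 1 then 1 else if j = 2 then 2 else 3)"

definition hyp :: "real \<Rightarrow> real^3 \<Rightarrow> real" where
  "hyp s y = sqrt ((norm y)\<^sup>2 + s)"

text \<open>The point of the future hyperboloid of squared mass \<open>s\<close> above the spatial vector \<open>y\<close>; \<open>mom 1\<close> is the
  integral over it against the Lorentz invariant measure.\<close>

definition shell :: "real \<Rightarrow> real^3 \<Rightarrow> pt" where
  "shell s y = hyp s y *\<^sub>R axis 0 1 + (\<Sum>j\<in>UNIV. y $ j *\<^sub>R axis (kap j) 1)"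

definition mom :: "nat \<Rightarrow> (pt \<Rightarrow> real) \<Rightarrow> pt \<Rightarrow> real \<Rightarrow> real" where
  "mom k f x s = (\<integral>y. f (x - shell s y) / hyp s y ^ k \<partial>lborel)"

lemma kap_simps [simp]: "kap 1 = 1" "kap 2 = 2" "kap 3 = 3"
  by (simp_all add: kap_def)

lemma hyp_ge_norm: "s \<ge> 0 \<Longrightarrow> norm y \<le> hyp s y"
  unfolding hyp_def by (rule real_le_rsqrt) simp

lemma hyp_ge_sqrt: "s \<ge> 0 \<Longrightarrow> sqrt s \<le> hyp s y"
  unfolding hyp_def by simp

lemma hyp_nonneg: "s \<ge> 0 \<Longrightarrow> 0 \<le> hyp s y"
  unfolding hyp_def by simp

lemma hyp_pos: "s > 0 \<Longrightarrow> 0 < hyp s y"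
  unfolding hyp_def by (simp add: add_nonneg_pos)

lemma hyp_pos': "s \<ge> 0 \<Longrightarrow> y \<noteq> 0 \<Longrightarrow> 0 < hyp s y"
  using hyp_ge_norm[of s y] zero_less_norm_iff[of y] by linarith

lemma hyp_squared: "s \<ge> 0 \<Longrightarrow> (hyp s y)\<^sup>2 = (norm y)\<^sup>2 + s"
  unfolding hyp_def by simp

lemma norm_vec3_squared: "(norm (y::real^3))\<^sup>2 = (\<Sum>j\<in>UNIV. (y $ j)\<^sup>2)"
  by (simp add: norm_vec_def L2_set_def sum_nonneg)

lemma shell_nth: "shell s y $ 0 = hyp s y" "shell s y $ 1 = y $ 1" "shell s y $ 2 = y $ 2" "shell s y $ 3 = y $ 3"
  by (simp_all add: shell_def sum_3 axis_def)

lemma shell_in_Vp: "s \<ge> 0 \<Longrightarrow> shell s y \<in> Vp"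
  unfolding Vp_iff by (simp add: shell_nth hyp_nonneg hyp_squared norm_vec3_squared sum_3)

lemma hyp_le_norm_shell: "hyp s y \<le> norm (shell s y)"
  using component_le_norm_cart[of "shell s y" 0] by (simp add: shell_nth)

lemma continuous_on_hyp:
  "continuous_on A f \<Longrightarrow> continuous_on A g \<Longrightarrow> continuous_on A (\<lambda>x. hyp (f x) (g x))"
  unfolding hyp_def by (intro continuous_intros)

lemma continuous_on_shell:
  "continuous_on A f \<Longrightarrow> continuous_on A g \<Longrightarrow> continuous_on A (\<lambda>x. shell (f x) (g x))"
  unfolding shell_def by (intro continuous_intros continuous_on_hyp)

lemma shell_scale: "c \<ge> 0 \<Longrightarrow> shell (c\<^sup>2 * s) (c *\<^sub>R y) = c *\<^sub>R shell s y"
proof -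
  assume c: "c \<ge> 0"
  have "hyp (c\<^sup>2 * s) (c *\<^sub>R y) = sqrt (c\<^sup>2 * ((norm y)\<^sup>2 + s))"
    unfolding hyp_def by (simp add: power_mult_distrib distrib_left)
  also have "\<dots> = c * hyp s y" using c unfolding hyp_def by (simp add: real_sqrt_mult)
  finally show ?thesis by (simp add: shell_def scaleR_add_right scaleR_sum_right)
qed

lemma hyp_scale: "c \<ge> 0 \<Longrightarrow> hyp (c\<^sup>2 * s) (c *\<^sub>R y) = c * hyp s y"
  using arg_cong[OF shell_scale[of c s y], of "\<lambda>v. v $ 0"] by (simp add: shell_nth)

lemma shell_support_radius:
  assumes "past_compact K"
  shows "\<exists>T>0. \<forall>x\<in>causal_past q. \<forall>s\<ge>0. \<forall>y. x - shell s y \<in> K \<longrightarrow> norm y \<le> T \<and> s \<le> T\<^sup>2"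
proof -
  obtain T where T: "T > 0" "\<And>x v. x \<in> causal_past q \<Longrightarrow> v \<in> Vp \<Longrightarrow> x - v \<in> K \<Longrightarrow> norm v \<le> T"
    using past_compact_support_radius[OF assms] by blast
  have "norm y \<le> T \<and> s \<le> T\<^sup>2" if "x \<in> causal_past q" "s \<ge> 0" "x - shell s y \<in> K" for x s y
  proof -
    have h: "hyp s y \<le> T" using T(2)[OF that(1) shell_in_Vp that(3)] that hyp_le_norm_shell[of s y] by simp
    then have "(sqrt s)\<^sup>2 \<le> T\<^sup>2" using that hyp_ge_sqrt[of s y] by (intro power_mono) auto
    then show ?thesis using h hyp_ge_norm[of s y] that by simp
  qed
  then show ?thesis using T(1) by blast
qed

lemma shell_in_causal_past: "x \<in> causal_past q \<Longrightarrow> s \<ge> 0 \<Longrightarrow> x - shell s y \<in> causal_past q"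
  by (rule causal_past_trans[OF _ shell_in_Vp])

text \<open>Both bounds are uniform over a causal past. The cut-off in \<open>s\<close> makes the
  integral in \<open>Gk\<close> one over a bounded interval.\<close>

lemma Cpc_shell_bound:
  assumes "f \<in> Cpc"
  obtains B T where "B \<ge> 0" "T > 0"
    "\<And>x s y. x \<in> causal_past q \<Longrightarrow> s \<ge> 0 \<Longrightarrow> \<bar>f (x - shell s y)\<bar> \<le> B * indicat_real (cball 0 T) y"
    "\<And>x s y. x \<in> causal_past q \<Longrightarrow> s > T\<^sup>2 \<Longrightarrow> f (x - shell s y) = 0"
proof -
  obtain T where T: "T > 0" "\<And>x s y. x \<in> causal_past q \<Longrightarrow> s \<ge> 0 \<Longrightarrow> x - shell s y \<in> tsupp f \<Longrightarrow> norm y \<le> T \<and> s \<le> T\<^sup>2"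
    using shell_support_radius[OF Cpc_past_compact[OF assms]] by blast
  obtain B where B: "B \<ge> 0" "\<And>y. y \<in> causal_past q \<Longrightarrow> \<bar>f y\<bar> \<le> B" using Cpc_bounded[OF assms] by blast
  show ?thesis
  proof (rule that[OF B(1) T(1)])
    fix x s y assume x: "x \<in> causal_past q" 
    show "\<bar>f (x - shell s y)\<bar> \<le> B * indicat_real (cball 0 T) y" if "s \<ge> 0"
    proof (cases "f (x - shell s y) = 0")
      case False
      then have "norm y \<le> T" using T(2)[OF x that in_tsupp] by blast
      then show ?thesis using B(2)[OF shell_in_causal_past[OF x that]] by simp
    qed (use B in simp)
    show "f (x - shell s y) = 0" if "s > T\<^sup>2"
    proof (rule ccontr)
      assume "f (x - shell s y) \<noteq> 0"
      moreover have "s \<ge> 0" using that zero_le_power2[of T] by linarith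
      ultimately show False using T(2)[OF x _ in_tsupp, of s y] that by auto
    qed
  qed
qed

lemma mom_integrand_measurable:
  assumes "smooth f"
  shows "(\<lambda>y. f (x - shell s y) / hyp s y ^ k) \<in> borel_measurable lborel"
proof -
  have "continuous_on UNIV (\<lambda>y. f (x - shell s y))"
    by (intro continuous_on_compose2[OF smooth_continuous[OF assms, of UNIV]] continuous_intros continuous_on_shell) auto
  moreover have "continuous_on UNIV (\<lambda>y. hyp s y ^ k)" by (intro continuous_intros continuous_on_hyp)
  ultimately have "(\<lambda>y. f (x - shell s y) / hyp s y ^ k) \<in> borel_measurable borel"
    by (intro borel_measurable_divide borel_measurable_continuous_onI)
  then show ?thesis by simp
qed

lemma mom_integrable_pos:
  assumes "f \<in> Cpc" "s > 0"
  shows "integrable lborel (\<lambda>y. f (x - shell s y) / hyp s y ^ k)"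
proof -
  obtain q where q: "x \<in> causal_past q" using in_some_causal_past by blast
  obtain B T where B: "B \<ge> 0" "\<And>x s y. x \<in> causal_past q \<Longrightarrow> s \<ge> 0 \<Longrightarrow> \<bar>f (x - shell s y)\<bar> \<le> B * indicat_real (cball 0 T) y"
    using Cpc_shell_bound[OF assms(1), of q] by metis
  show ?thesis
  proof (rule integrable_bounded_support[where T = T and C = "B / sqrt s ^ k"])
    show "(\<lambda>y. f (x - shell s y) / hyp s y ^ k) \<in> borel_measurable lborel"
      by (rule mom_integrand_measurable[OF Cpc_smooth[OF assms(1)]])
    fix y
    have "sqrt s ^ k \<le> hyp s y ^ k" using assms hyp_ge_sqrt[of s y] by (intro power_mono) auto
    then have "\<bar>f (x - shell s y)\<bar> / hyp s y ^ k \<le> (B * indicat_real (cball 0 T) y) / sqrt s ^ k"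
      using B q assms by (intro frac_le) auto
    then show "\<bar>f (x - shell s y) / hyp s y ^ k\<bar> \<le> B / sqrt s ^ k * indicat_real (cball 0 T) y"
      using hyp_nonneg[of s y] assms by (simp add: abs_divide power_abs)
  qed
qed

lemma mom1_integrand_bound:
  assumes "\<bar>f (x - shell s y)\<bar> \<le> B * indicat_real (cball 0 T) y" "s \<ge> 0" "y \<noteq> 0"
  shows "\<bar>f (x - shell s y) / hyp s y ^ 1\<bar> \<le> B * (indicat_real (cball 0 T) y / norm y)"
proof -
  have "\<bar>f (x - shell s y)\<bar> / hyp s y \<le> (B * indicat_real (cball 0 T) y) / norm y"
    using assms hyp_ge_norm[of s y] by (intro frac_le) (auto intro: order_trans[OF abs_ge_zero])
  then show ?thesis using hyp_nonneg[of s y] assms by (simp add: abs_divide)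
qed

lemma AE_nonzero: "AE y in lborel. y \<noteq> (0::real^3)"
  by (rule AE_lborel_singleton)

text \<open>On the light cone, s = 0, the weight becomes 1 / \<open>norm y\<close>, which is
  integrable in three dimensions. Higher powers occur only for s > 0 or multiplied by s.\<close>

lemma mom1_integrable:
  assumes "f \<in> Cpc" "s \<ge> 0"
  shows "integrable lborel (\<lambda>y. f (x - shell s y) / hyp s y ^ 1)"
proof -
  obtain q where q: "x \<in> causal_past q" using in_some_causal_past by blast
  obtain B T where B: "B \<ge> 0" "\<And>x s y. x \<in> causal_past q \<Longrightarrow> s \<ge> 0 \<Longrightarrow> \<bar>f (x - shell s y)\<bar> \<le> B * indicat_real (cball 0 T) y"
    using Cpc_shell_bound[OF assms(1), of q] by metis
  show ?thesis
  proof (rule Bochner_Integration.integrable_bound[OF integrable_mult_right[OF integrable_inverse_norm, of B T]])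
    show "(\<lambda>y. f (x - shell s y) / hyp s y ^ 1) \<in> borel_measurable lborel"
      by (rule mom_integrand_measurable[OF Cpc_smooth[OF assms(1)]])
    show "AE y in lborel. norm (f (x - shell s y) / hyp s y ^ 1) \<le> norm (B * (indicat_real (cball 0 T) y / norm y))"
      using AE_nonzero
    proof eventually_elim
      case (elim y)
      from mom1_integrand_bound[of f x s y, OF B(2)[OF q assms(2)] assms(2) elim]
      show ?case unfolding real_norm_def by linarith
    qed
  qed
qed

lemma mom1_abs_le:
  assumes f: "f \<in> Cpc" and s: "s \<ge> 0"
    and B: "\<And>y. \<bar>f (x - shell s y)\<bar> \<le> B * indicat_real (cball 0 T) y"
  shows "\<bar>mom 1 f x s\<bar> \<le> B * (\<integral>y. indicat_real (cball (0::real^3) T) y / norm y \<partial>lborel)"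
proof -
  have "\<bar>mom 1 f x s\<bar> \<le> (\<integral>y. \<bar>f (x - shell s y) / hyp s y ^ 1\<bar> \<partial>lborel)"
    unfolding mom_def by (rule integral_abs_bound)
  also have "\<dots> \<le> (\<integral>y. B * (indicat_real (cball (0::real^3) T) y / norm y) \<partial>lborel)"
  proof (rule Bochner_Integration.integral_mono_AE)
    show "AE y in lborel. \<bar>f (x - shell s y) / hyp s y ^ 1\<bar> \<le> B * (indicat_real (cball 0 T) y / norm y)"
      using AE_nonzero by eventually_elim (intro mom1_integrand_bound B s)
  qed (intro integrable_abs mom1_integrable[OF f s] integrable_mult_right integrable_inverse_norm)+
  finally show ?thesis by (simp only: integral_mult_right_zero)
qed

text \<open>The majorant, a multiple of 1 / \<open>norm y\<close>, does not depend on s, so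
  continuity reaches the light cone; the excluded point y = 0 is null.\<close>

lemma continuous_on_mom1:
  assumes f: "f \<in> Cpc"
  shows "continuous_on (UNIV \<times> {0..}) (\<lambda>(x, s). mom 1 f x s)"
proof -
  have "continuous_on (UNIV \<times> {0..}) (\<lambda>p. \<integral>y. f (fst p - shell (snd p) y) / hyp (snd p) y ^ 1 \<partial>lborel)"
  proof (rule continuous_on_integral_dominated)
    show "(\<lambda>y. f (fst p - shell (snd p) y) / hyp (snd p) y ^ 1) \<in> borel_measurable lborel" for p
      by (rule mom_integrand_measurable[OF Cpc_smooth[OF f]])
    show "AE y in lborel. continuous_on (UNIV \<times> {0..}) (\<lambda>p. f (fst p - shell (snd p) y) / hyp (snd p) y ^ 1)"
      using AE_nonzero
    proof eventually_elim
      case (elim y)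
      have "hyp (snd p) y \<noteq> 0" if "p \<in> UNIV \<times> {0..}" for p :: "pt \<times> real"
        using hyp_pos'[of "snd p" y] elim that by auto
      then show ?case
        by (intro continuous_intros continuous_on_shell continuous_on_hyp
           continuous_on_compose2[OF smooth_continuous[OF Cpc_smooth[OF f], of UNIV]]) auto
    qed
    fix p :: "pt \<times> real" assume "p \<in> UNIV \<times> {0..}"
    obtain q where q: "ball (fst p) 1 \<subseteq> causal_past q" using nhds_causal_past by blast
    obtain B T where B: "B \<ge> 0" "\<And>x s y. x \<in> causal_past q \<Longrightarrow> s \<ge> 0 \<Longrightarrow> \<bar>f (x - shell s y)\<bar> \<le> B * indicat_real (cball 0 T) y"
      using Cpc_shell_bound[OF f, of q] by metis
    have "AE y in lborel. \<bar>f (fst p' - shell (snd p') y) / hyp (snd p') y ^ 1\<bar> \<le> B * (indicat_real (cball 0 T) y / norm y)"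
      if p': "p' \<in> UNIV \<times> {0..}" "dist p' p < 1" for p'
      using AE_nonzero
    proof eventually_elim
      case (elim y)
      have "dist (fst p) (fst p') < 1" using p' dist_fst_le[of p' p] by (simp add: dist_commute)
      then have "fst p' \<in> causal_past q" using q by auto
      then show ?case using p' elim by (intro mom1_integrand_bound B) auto
    qed
    then show "\<exists>r>0. \<exists>B. integrable lborel B \<and> (\<forall>p'\<in>UNIV \<times> {0..}. dist p' p < r \<longrightarrow>
       (AE y in lborel. \<bar>f (fst p' - shell (snd p') y) / hyp (snd p') y ^ 1\<bar> \<le> B y))"
      using integrable_mult_right[OF integrable_inverse_norm, of B T]
      by (intro exI[of _ 1] conjI exI[of _ "\<lambda>y. B * (indicat_real (cball 0 T) y / norm y)"]) auto
  qed
  then show ?thesis by (simp add: mom_def split_def)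
qed

lemma continuous_on_mom1_compose:
  assumes "f \<in> Cpc" "continuous_on A g" "continuous_on A h" "\<And>a. a \<in> A \<Longrightarrow> h a \<ge> 0"
  shows "continuous_on A (\<lambda>a. mom 1 f (g a) (h a))"
  using continuous_on_compose2[OF continuous_on_mom1[OF assms(1)], of A "\<lambda>a. (g a, h a)"] assms
  by (auto intro!: continuous_on_Pair)

lemma mom1_DERIV:
  assumes f: "f \<in> Cpc" and s: "s \<ge> 0"
  shows "((\<lambda>u. mom 1 f (x + u *\<^sub>R axis i 1) s) has_real_derivative mom 1 (partial i f) (x + u *\<^sub>R axis i 1) s) (at u)"
proof -
  let ?x = "\<lambda>u. x + u *\<^sub>R axis i (1::real)"
  have f': "partial i f \<in> Cpc" using f by (rule Cpc_partial)
  obtain q where near: "\<And>v. \<bar>v - u\<bar> < 1 \<Longrightarrow> ?x v \<in> causal_past q"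
    using line_in_causal_past by blast
  obtain B T where B: "B \<ge> 0" "\<And>x s y. x \<in> causal_past q \<Longrightarrow> s \<ge> 0 \<Longrightarrow> \<bar>partial i f (x - shell s y)\<bar> \<le> B * indicat_real (cball 0 T) y"
    using Cpc_shell_bound[OF f', of q] by metis
  show ?thesis unfolding mom_def
  proof (rule has_real_derivative_integral[where r = 1 and B = "\<lambda>y. B * (indicat_real (cball 0 T) y / norm y)"])
    show "(\<lambda>y. partial i f (?x u - shell s y) / hyp s y ^ 1) \<in> borel_measurable lborel"
      by (rule mom_integrand_measurable[OF Cpc_smooth[OF f']])
    show "AE y in lborel. \<forall>v. \<bar>v - u\<bar> < 1 \<longrightarrow>
        \<bar>partial i f (?x v - shell s y) / hyp s y ^ 1\<bar> \<le> B * (indicat_real (cball 0 T) y / norm y)"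
      using AE_nonzero by eventually_elim (intro allI impI mom1_integrand_bound B near s)
    show "AE y in lborel. \<forall>v. \<bar>v - u\<bar> < 1 \<longrightarrow> ((\<lambda>v. f (?x v - shell s y) / hyp s y ^ 1) has_real_derivative
        partial i f (?x v - shell s y) / hyp s y ^ 1) (at v)"
    proof (intro AE_I2 allI impI DERIV_cdivide)
      fix y v
      show "((\<lambda>v. f (?x v - shell s y)) has_real_derivative partial i f (?x v - shell s y)) (at v)"
        using smooth_DERIV[OF Cpc_smooth[OF f], of "x - shell s y" i v] by (simp add: algebra_simps)
    qed
  qed (intro mom1_integrable[OF f s] integrable_mult_right integrable_inverse_norm zero_less_one)+
qed

section \<open>Derivatives of hyperboloid averages and the wave operator\<close>

lemma smooth_chain:
  assumes "smooth g" "(c has_vector_derivative c') (at u)"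
  shows "((\<lambda>u. g (c u)) has_real_derivative (\<Sum>i\<in>UNIV. c' $ i * partial i g (c u))) (at u)"
proof -
  have "((\<lambda>u. g (c u)) has_derivative (\<lambda>h. \<Sum>i\<in>UNIV. (h *\<^sub>R c') $ i * partial i g (c u))) (at u)"
    using has_derivative_compose[OF assms(2)[unfolded has_vector_derivative_def]
        smooth_has_derivative[OF assms(1)]] .
  moreover have "(\<lambda>h. \<Sum>i\<in>UNIV. (h *\<^sub>R c') $ i * partial i g (c u)) = (*) (\<Sum>i\<in>UNIV. c' $ i * partial i g (c u))"
    by (auto simp: sum_distrib_left sum_distrib_right mult_ac)
  ultimately show ?thesis by (simp add: has_field_derivative_def)
qed

lemma hyp_DERIV_mass:
  assumes "s > 0" shows "((\<lambda>s. hyp s y) has_real_derivative 1 / (2 * hyp s y)) (at s)"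
proof -
  have "0 < (norm y)\<^sup>2 + s" using assms by (simp add: add_nonneg_pos)
  then show ?thesis
    unfolding hyp_def by (auto intro!: derivative_eq_intros simp: divide_simps)
qed

lemma hyp_DERIV_space:
  assumes "s > 0"
  shows "((\<lambda>u. hyp s (y + u *\<^sub>R axis j 1)) has_real_derivative (y + u *\<^sub>R axis j 1) $ j / hyp s (y + u *\<^sub>R axis j 1)) (at u)"
proof -
  have pos: "0 < (y + u *\<^sub>R axis j 1) \<bullet> (y + u *\<^sub>R axis j 1) + s"
    using assms by (simp add: add_nonneg_pos)
  have "((\<lambda>u. (y + u *\<^sub>R axis j 1) \<bullet> (y + u *\<^sub>R axis j 1) + s) has_real_derivative 2 * (y + u *\<^sub>R axis j 1) $ j) (at u)"
  proof -
    have e: "(y + u *\<^sub>R axis j 1) \<bullet> (y + u *\<^sub>R axis j 1) = y \<bullet> y + 2 * u * y $ j + u * u" for u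
      by (simp add: inner_add_left inner_add_right inner_axis inner_axis' algebra_simps)
    show ?thesis unfolding e by (auto intro!: derivative_eq_intros simp: axis_def)
  qed
  from DERIV_chain2[where f = sqrt, OF DERIV_real_sqrt[OF pos] this]
  have "((\<lambda>u. hyp s (y + u *\<^sub>R axis j 1)) has_real_derivative
      inverse (hyp s (y + u *\<^sub>R axis j 1)) / 2 * (2 * (y + u *\<^sub>R axis j 1) $ j)) (at u)"
    unfolding hyp_def power2_norm_eq_inner .
  moreover have "inverse a / 2 * (2 * b) = b / a" for a b :: real by (simp add: field_simps)
  ultimately show ?thesis by (simp only:)
qed

lemma shell_DERIV_mass:
  assumes "s > 0" "smooth g"
  shows "((\<lambda>s. g (x - shell s y)) has_real_derivative - (partial 0 g (x - shell s y) / (2 * hyp s y))) (at s)"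
proof -
  have "((\<lambda>s. x - shell s y) has_vector_derivative - (1 / (2 * hyp s y)) *\<^sub>R axis 0 1) (at s)"
    unfolding shell_def using hyp_DERIV_mass[OF assms(1), of y]
    by (auto intro!: derivative_eq_intros)
  from smooth_chain[OF assms(2) this] show ?thesis by (simp add: sum_index4 axis_def)
qed

lemma shell_DERIV_space:
  assumes "s > 0" "smooth g"
  shows "((\<lambda>u. g (x - shell s (y + u *\<^sub>R axis j 1))) has_real_derivative
     - (partial (kap j) g (x - shell s (y + u *\<^sub>R axis j 1)) + (y + u *\<^sub>R axis j 1) $ j / hyp s (y + u *\<^sub>R axis j 1) *
         partial 0 g (x - shell s (y + u *\<^sub>R axis j 1)))) (at u)"
proof -
  let ?c = "- ((y + u *\<^sub>R axis j 1) $ j / hyp s (y + u *\<^sub>R axis j 1)) *\<^sub>R axis 0 1 - axis (kap j) (1::real) :: pt"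
  have *: "(\<Sum>i\<in>UNIV. (y + u *\<^sub>R axis j 1) $ i *\<^sub>R axis (kap i) (1::real)) =
     (\<Sum>i\<in>UNIV. y $ i *\<^sub>R axis (kap i) 1 :: pt) + u *\<^sub>R axis (kap j) 1" for u
  proof -
    have "(\<Sum>i\<in>UNIV. (u *\<^sub>R axis j (1::real)) $ i *\<^sub>R axis (kap i) (1::real) :: pt) = (\<Sum>i\<in>UNIV. if i = j then u *\<^sub>R axis (kap j) 1 else 0)"
      by (intro sum.cong) (auto simp: axis_def)
    then show ?thesis by (simp add: scaleR_add_left sum.distrib)
  qed
  have "((\<lambda>u. x - shell s (y + u *\<^sub>R axis j 1)) has_vector_derivative ?c) (at u)"
    unfolding shell_def * using hyp_DERIV_space[OF assms(1), of y j u]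
    by (auto intro!: derivative_eq_intros simp: algebra_simps)
  from smooth_chain[OF assms(2) this] show ?thesis
    using exhaust_3[of j] by (auto simp: sum_index4 axis_def algebra_simps)
qed

text \<open>The exponent k - 1 is truncated at k = 0, where the factor \<open>real k\<close>
  vanishes; hence the case distinction.\<close>

lemma quotient_power_identity:
  fixes r :: real
  assumes "r \<noteq> 0"
  shows "(a * r ^ k - f * (real k * r ^ (k - 1) * b)) / (r ^ k * r ^ k) = a / r ^ k - real k * f * b / r ^ (k + 1)"
proof (cases k)
  case (Suc n)
  define P where "P = r ^ n"
  have "P \<noteq> 0" using assms by (simp add: P_def)
  then show ?thesis unfolding Suc using assms by (simp add: P_def[symmetric] field_simps)
qed (use assms in simp)

text \<open>Argument and weight depend on s only through \<open>hyp\<close>, whose derivative is 1 /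
  (2 \<open>hyp\<close>). Differentiating the argument therefore raises the power of
  \<open>hyp\<close> by one, differentiating the weight raises it by two.\<close>

lemma mom_DERIV_mass:
  assumes f: "f \<in> Cpc" and s: "s > 0"
  shows "((\<lambda>s. mom k f x s) has_real_derivative
     - (mom (k + 1) (partial 0 f) x s / 2) - real k / 2 * mom (k + 2) f x s) (at s)"
proof -
  have f': "partial 0 f \<in> Cpc" using f by (rule Cpc_partial)
  obtain q where q: "x \<in> causal_past q" using in_some_causal_past by blast
  obtain B T where B: "B \<ge> 0" "\<And>x s y. x \<in> causal_past q \<Longrightarrow> s \<ge> 0 \<Longrightarrow> \<bar>f (x - shell s y)\<bar> \<le> B * indicat_real (cball 0 T) y"
    using Cpc_shell_bound[OF f, of q] by metis
  obtain B' T' where B': "B' \<ge> 0" "\<And>x s y. x \<in> causal_past q \<Longrightarrow> s \<ge> 0 \<Longrightarrow> \<bar>partial 0 f (x - shell s y)\<bar> \<le> B' * indicat_real (cball 0 T') y"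
    using Cpc_shell_bound[OF f', of q] by metis
  \<comment> \<open>A lower bound of \<open>hyp u y\<close> for all u within s / 2 of s, uniform in
    y.\<close>
  define d where "d = sqrt (s / 2)"
  have d: "d > 0" using s by (simp add: d_def)
  let ?g' = "\<lambda>s y. - (partial 0 f (x - shell s y) / hyp s y ^ (k + 1) / 2) - real k / 2 * (f (x - shell s y) / hyp s y ^ (k + 2))"
  have "((\<lambda>s. mom k f x s) has_real_derivative (\<integral>y. ?g' s y \<partial>lborel)) (at s)"
    unfolding mom_def
  proof (rule has_real_derivative_integral[where r = "s / 2" and
        B = "\<lambda>y. B' * indicat_real (cball 0 T') y / d ^ (k + 1) / 2 + real k / 2 * (B * indicat_real (cball 0 T) y / d ^ (k + 2))"])
    show "integrable lborel (\<lambda>y. f (x - shell u y) / hyp u y ^ k)" if "\<bar>u - s\<bar> < s / 2" for u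
    proof -
      have "u > 0" using that s by (simp add: abs_if split: if_splits)
      then show ?thesis by (rule mom_integrable_pos[OF f])
    qed
    show "?g' s \<in> borel_measurable lborel"
      by (intro borel_measurable_diff borel_measurable_uminus borel_measurable_divide[where g = "\<lambda>_. 2"] borel_measurable_times
           borel_measurable_const mom_integrand_measurable Cpc_smooth f f')
    have "integrable lborel (indicat_real (cball (0::real^3) R))" for R
      by (rule integrable_bounded_support[where C = 1 and T = R]) (auto simp: indicator_def)
    then show "integrable lborel (\<lambda>y::real^3. B' * indicat_real (cball 0 T') y / d ^ (k + 1) / 2 + real k / 2 * (B * indicat_real (cball 0 T) y / d ^ (k + 2)))"
      by (intro Bochner_Integration.integrable_add integrable_mult_right integrable_divide) simp_all
    show "AE y in lborel. \<forall>u. \<bar>u - s\<bar> < s / 2 \<longrightarrow> ((\<lambda>u. f (x - shell u y) / hyp u y ^ k) has_real_derivative ?g' u y) (at u)"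
    proof (intro AE_I2 allI impI)
      fix y u assume "\<bar>u - s\<bar> < s / 2"
      then have u: "u > 0" using s by linarith
      have h: "hyp u y > 0" using u by (rule hyp_pos)
      have "((\<lambda>u. hyp u y ^ k) has_real_derivative real k * hyp u y ^ (k - 1) * (1 / (2 * hyp u y))) (at u)"
        using DERIV_power[OF hyp_DERIV_mass[OF u, of y], of k] by (simp add: mult_ac)
      from DERIV_divide[OF shell_DERIV_mass[OF u Cpc_smooth[OF f], of x y] this] h
      have "((\<lambda>u. f (x - shell u y) / hyp u y ^ k) has_real_derivative
         (- (partial 0 f (x - shell u y) / (2 * hyp u y)) * hyp u y ^ k -
           f (x - shell u y) * (real k * hyp u y ^ (k - 1) * (1 / (2 * hyp u y)))) / (hyp u y ^ k * hyp u y ^ k)) (at u)" by simp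
      also have "(- (partial 0 f (x - shell u y) / (2 * hyp u y)) * hyp u y ^ k -
           f (x - shell u y) * (real k * hyp u y ^ (k - 1) * (1 / (2 * hyp u y)))) / (hyp u y ^ k * hyp u y ^ k) = ?g' u y"
        using quotient_power_identity[of "hyp u y" "- (partial 0 f (x - shell u y) / (2 * hyp u y))" k
            "f (x - shell u y)" "1 / (2 * hyp u y)"] h by (simp add: mult_ac)
      finally show "((\<lambda>u. f (x - shell u y) / hyp u y ^ k) has_real_derivative ?g' u y) (at u)" .
    qed
    show "AE y in lborel. \<forall>u. \<bar>u - s\<bar> < s / 2 \<longrightarrow> \<bar>?g' u y\<bar> \<le> B' * indicat_real (cball 0 T') y / d ^ (k + 1) / 2 + real k / 2 * (B * indicat_real (cball 0 T) y / d ^ (k + 2))"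
    proof (intro AE_I2 allI impI)
      fix y u assume "\<bar>u - s\<bar> < s / 2"
      then have u: "u > s / 2" using s by linarith
      have "sqrt (s / 2) \<le> sqrt u" using u by (intro real_sqrt_le_mono) simp
      then have h: "d \<le> hyp u y" using hyp_ge_sqrt[of u y] s u unfolding d_def by linarith
      have p: "0 < d ^ n" "d ^ n \<le> hyp u y ^ n" "0 < hyp u y ^ n" for n
        using d h order_less_le_trans[OF d h] by (auto intro!: power_mono)
      have h1: "\<bar>partial 0 f (x - shell u y)\<bar> / hyp u y ^ (k + 1) \<le> B' * indicat_real (cball 0 T') y / d ^ (k + 1)"
        by (rule frac_le[OF _ B'(2)[OF q] p(1,2)]) (use B'(1) u s in auto)
      have "\<bar>f (x - shell u y)\<bar> / hyp u y ^ (k + 2) \<le> B * indicat_real (cball 0 T) y / d ^ (k + 2)"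
        by (rule frac_le[OF _ B(2)[OF q] p(1,2)]) (use B(1) u s in auto)
      then have h2: "real k / 2 * (\<bar>f (x - shell u y)\<bar> / hyp u y ^ (k + 2)) \<le> real k / 2 * (B * indicat_real (cball 0 T) y / d ^ (k + 2))"
        by (intro mult_left_mono) auto
      have h3: "\<bar>?g' u y\<bar> \<le> \<bar>partial 0 f (x - shell u y)\<bar> / hyp u y ^ (k + 1) / 2 + real k / 2 * (\<bar>f (x - shell u y)\<bar> / hyp u y ^ (k + 2))"
      proof -
        have gen: "\<bar>- (a / p / 2) - c / 2 * (b / r)\<bar> \<le> \<bar>a\<bar> / p / 2 + c / 2 * (\<bar>b\<bar> / r)"
          if "p > 0" "r > 0" "c \<ge> 0" for a b c p r :: real
          by (rule order_trans[OF abs_triangle_ineq4]) (use that in \<open>simp add: abs_mult abs_divide\<close>)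
        show ?thesis by (rule gen[OF p(3) p(3)]) simp
      qed
      show "\<bar>?g' u y\<bar> \<le> B' * indicat_real (cball 0 T') y / d ^ (k + 1) / 2 + real k / 2 * (B * indicat_real (cball 0 T) y / d ^ (k + 2))"
        by (rule order_trans[OF h3 add_mono[OF divide_right_mono[OF h1] h2]]) simp
    qed
  qed (use s in auto)
  also have "(\<integral>y. ?g' s y \<partial>lborel) = - (mom (k + 1) (partial 0 f) x s / 2) - real k / 2 * mom (k + 2) f x s"
    unfolding mom_def
    by (subst Bochner_Integration.integral_diff;
        (intro Bochner_Integration.integrable_minus integrable_divide integrable_mult_right mom_integrable_pos[OF f s] mom_integrable_pos[OF f' s]
         | simp only: Bochner_Integration.integral_minus integral_divide_zero integral_mult_right_zero))
  finally show ?thesis .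
qed

lemma continuous_compact_support_bound:
  fixes h :: "real^3 \<Rightarrow> real"
  assumes "continuous_on UNIV h" "\<And>y. norm y > T \<Longrightarrow> h y = 0"
  obtains C where "\<And>y. \<bar>h y\<bar> \<le> C * indicat_real (cball 0 T) y"
proof -
  have "compact (h ` cball 0 T)"
    by (intro compact_continuous_image continuous_on_subset[OF assms(1)]) auto
  then obtain C where C: "\<And>y. y \<in> cball 0 T \<Longrightarrow> \<bar>h y\<bar> \<le> C"
    using compact_imp_bounded[of "h ` cball 0 T"] unfolding bounded_iff by (metis image_eqI real_norm_def)
  show ?thesis
  proof (rule that[of C])
    show "\<bar>h y\<bar> \<le> C * indicat_real (cball 0 T) y" for y
      using C[of y] assms(2)[of y] by (cases "norm y \<le> T") auto
  qed
qed

text \<open>\<open>V\<close> is the \<open>j\<close>-th part of the divergence of a vector field on the hyperboloid whose components are \<open>g\<close>.\<close>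

lemma divergence_integral_eq_0:
  fixes j :: 3 and x :: pt
  assumes f: "f \<in> Cpc" and s: "s > 0"
  defines "V \<equiv> \<lambda>y. partial (kap j) (partial (kap j) f) (x - shell s y) / hyp s y
      - partial 0 (partial 0 f) (x - shell s y) * (y $ j)\<^sup>2 / hyp s y ^ 3
      + partial 0 f (x - shell s y) * (1 / hyp s y ^ 2 - 3 * (y $ j)\<^sup>2 / hyp s y ^ 4)
      + f (x - shell s y) * (1 / hyp s y ^ 3 - 3 * (y $ j)\<^sup>2 / hyp s y ^ 5)"
  shows "integrable lborel V" "(\<integral>y. V y \<partial>lborel) = 0"
proof -
  let ?p = "\<lambda>y. x - shell s y" and ?k = "kap j"
  define \<iota> where "\<iota> = (\<lambda>y. 1 / hyp s y)"
  \<comment> \<open>The signs are such that the mixed derivative \<open>F0k\<close> and the first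
    derivative \<open>Fk\<close> both cancel in the divergence.\<close>
  define g where "g = (\<lambda>y. - partial ?k f (?p y) * \<iota> y + partial 0 f (?p y) * y $ j * \<iota> y ^ 2
      + f (?p y) * y $ j * \<iota> y ^ 3)"
  obtain q where q: "x \<in> causal_past q" using in_some_causal_past by blast
  obtain T where T: "T > 0" "\<And>x s y. x \<in> causal_past q \<Longrightarrow> s \<ge> 0 \<Longrightarrow> x - shell s y \<in> tsupp f \<Longrightarrow> norm y \<le> T \<and> s \<le> T\<^sup>2"
    using shell_support_radius[OF Cpc_past_compact[OF f], of q] by blast
  have out: "?p y \<notin> tsupp f" if "norm y > T" for y
    using T(2)[OF q, of s y] s that by auto
  have z: "f w = 0 \<and> partial i f w = 0 \<and> partial i (partial i' f) w = 0" if "w \<notin> tsupp f" for w i i'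
    using that in_tsupp[of f w] partial_eq_0_outside_tsupp[OF that, of i]
      partial_eq_0_outside_tsupp[of w "partial i' f" i] tsupp_partial[of i' f] by auto
  have sm: "smooth f" using f by (rule Cpc_smooth)
  have c: "continuous_on UNIV (\<lambda>y. h (?p y))" if "smooth h" for h
    by (intro continuous_on_compose2[OF smooth_continuous[OF that, of UNIV]] continuous_intros continuous_on_shell) auto
  have nz: "hyp s y \<noteq> 0" for y using hyp_pos[OF s, of y] by simp
  have cV: "continuous_on UNIV V" unfolding V_def
    by (intro continuous_intros c sm smooth_partial continuous_on_hyp) (use nz in auto)
  have cg: "continuous_on UNIV g" unfolding g_def \<iota>_def
    by (intro continuous_intros c sm smooth_partial continuous_on_hyp) (use nz in auto)
  obtain C where C: "\<And>y. \<bar>V y\<bar> \<le> C * indicat_real (cball 0 T) y"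
    by (rule continuous_compact_support_bound[OF cV]) (use z out in \<open>auto simp: V_def\<close>)
  obtain C' where C': "\<And>y. \<bar>g y\<bar> \<le> C' * indicat_real (cball 0 T) y"
    by (rule continuous_compact_support_bound[OF cg]) (use z out in \<open>auto simp: g_def\<close>)
  have mV: "V \<in> borel_measurable lborel" using borel_measurable_continuous_onI[OF cV] by simp
  show "integrable lborel V" by (rule integrable_bounded_support[OF mV C])
  have ig: "integrable lborel g"
    using borel_measurable_continuous_onI[OF cg] by (intro integrable_bounded_support[OF _ C']) simp
  show "(\<integral>y. V y \<partial>lborel) = 0"
  proof (rule integral_directional_derivative_eq_0[OF ig mV _ C, where b = "axis j 1"])
    fix y :: "real^3" and u
    define Y where "Y = y + u *\<^sub>R axis j 1"
    define i where "i = \<iota> Y"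
    have r: "hyp s Y > 0" using hyp_pos[OF s] .
    have d: "a / hyp s Y ^ k = a * i ^ k" "a / hyp s Y = a * i" for a k
      by (simp_all add: i_def \<iota>_def power_one_over)
    define F where "F = f (?p Y)"
    define F0 where "F0 = partial 0 f (?p Y)"
    define Fk where "Fk = partial ?k f (?p Y)"
    define F00 where "F00 = partial 0 (partial 0 f) (?p Y)"
    define Fkk where "Fkk = partial ?k (partial ?k f) (?p Y)"
    define F0k where "F0k = partial 0 (partial ?k f) (?p Y)"
    have comm: "partial ?k (partial 0 f) (?p Y) = F0k" unfolding F0k_def using partial_commute[OF sm] by metis
    define Z where "Z = Y $ j"
    have dr: "((\<lambda>u. hyp s (y + u *\<^sub>R axis j 1)) has_real_derivative Z * i) (at u)"
      using hyp_DERIV_space[OF s, of y j u] unfolding Y_def[symmetric] Z_def[symmetric] d .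
    have "((\<lambda>u. 1 / hyp s (y + u *\<^sub>R axis j 1)) has_real_derivative
        (0 * hyp s (y + u *\<^sub>R axis j 1) - 1 * (Z * i)) / (hyp s (y + u *\<^sub>R axis j 1) * hyp s (y + u *\<^sub>R axis j 1))) (at u)"
      by (rule DERIV_divide[OF DERIV_const dr]) (use r Y_def in auto)
    moreover have "(0 * hyp s Y - 1 * (Z * i)) / (hyp s Y * hyp s Y) = - (Z * i ^ 3)"
      unfolding i_def \<iota>_def by (simp add: power3_eq_cube)
    ultimately have di: "((\<lambda>u. \<iota> (y + u *\<^sub>R axis j 1)) has_real_derivative - (Z * i ^ 3)) (at u)"
      unfolding \<iota>_def Y_def[symmetric] by simp
    have dZ: "((\<lambda>u. (y + u *\<^sub>R axis j 1) $ j) has_real_derivative 1) (at u)"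
      by (auto intro!: derivative_eq_intros simp: axis_def)
    have df: "((\<lambda>u. f (?p (y + u *\<^sub>R axis j 1))) has_real_derivative - (Fk + Z * i * F0)) (at u)"
      using shell_DERIV_space[OF s sm, of x y j u] unfolding F0_def Fk_def Y_def[symmetric] Z_def[symmetric] d .
    have d0: "((\<lambda>u. partial 0 f (?p (y + u *\<^sub>R axis j 1))) has_real_derivative - (F0k + Z * i * F00)) (at u)"
      using shell_DERIV_space[OF s smooth_partial[OF sm, of 0], of x y j u]
      unfolding F00_def Y_def[symmetric] Z_def[symmetric] d comm .
    have dk: "((\<lambda>u. partial ?k f (?p (y + u *\<^sub>R axis j 1))) has_real_derivative - (Fkk + Z * i * F0k)) (at u)"
      using shell_DERIV_space[OF s smooth_partial[OF sm, of ?k], of x y j u]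
      unfolding Fkk_def F0k_def Y_def[symmetric] Z_def[symmetric] d .
    have fold: "f (?p (y + u *\<^sub>R axis j 1)) = F" "partial 0 f (?p (y + u *\<^sub>R axis j 1)) = F0"
      "partial ?k f (?p (y + u *\<^sub>R axis j 1)) = Fk" "(y + u *\<^sub>R axis j 1) $ j = Z" "\<iota> (y + u *\<^sub>R axis j 1) = i"
      unfolding F_def F0_def Fk_def Z_def i_def Y_def by simp_all
    note D = DERIV_add[OF DERIV_add[OF DERIV_mult[OF DERIV_minus[OF dk] di]
       DERIV_mult[OF DERIV_mult[OF d0 dZ] DERIV_power[OF di, of 2]]]
       DERIV_mult[OF DERIV_mult[OF df dZ] DERIV_power[OF di, of 3]], unfolded fold]
    have "((\<lambda>u. g (y + u *\<^sub>R axis j 1)) has_real_derivative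
        Fkk * i - F00 * Z\<^sup>2 * i ^ 3 + F0 * (1 * i ^ 2 - 3 * Z\<^sup>2 * i ^ 4) + F * (1 * i ^ 3 - 3 * Z\<^sup>2 * i ^ 5)) (at u)"
      unfolding g_def by (rule DERIV_cong[OF D]) (simp add: algebra_simps eval_nat_numeral)
    also have "Fkk * i - F00 * Z\<^sup>2 * i ^ 3 + F0 * (1 * i ^ 2 - 3 * Z\<^sup>2 * i ^ 4) + F * (1 * i ^ 3 - 3 * Z\<^sup>2 * i ^ 5) = V Y"
      unfolding V_def F_def F0_def Fkk_def F00_def Z_def d ..
    finally show "((\<lambda>u. g (y + u *\<^sub>R axis j 1)) has_real_derivative V (y + u *\<^sub>R axis j 1)) (at u)"
      unfolding Y_def .
  qed
qed

text \<open>Summing over the axes produces the squared norm, which is r^2 - s on the hyperboloid.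
  The parts with r^2 complete the wave operator or cancel, and what is left carries a factor
  s.\<close>

lemma divergence_identity:
  fixes r :: real
  assumes "r > 0" "s = r\<^sup>2 - (z1\<^sup>2 + z2\<^sup>2 + z3\<^sup>2)"
  shows "(A1 / r - A0 * z1\<^sup>2 / r ^ 3 + B * (1 / r ^ 2 - 3 * z1\<^sup>2 / r ^ 4) + C * (1 / r ^ 3 - 3 * z1\<^sup>2 / r ^ 5))
     + (A2 / r - A0 * z2\<^sup>2 / r ^ 3 + B * (1 / r ^ 2 - 3 * z2\<^sup>2 / r ^ 4) + C * (1 / r ^ 3 - 3 * z2\<^sup>2 / r ^ 5))
     + (A3 / r - A0 * z3\<^sup>2 / r ^ 3 + B * (1 / r ^ 2 - 3 * z3\<^sup>2 / r ^ 4) + C * (1 / r ^ 3 - 3 * z3\<^sup>2 / r ^ 5))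
     = (- A0 + A1 + A2 + A3) / r ^ 1 + s * (A0 / r ^ 3) + 3 * s * (B / r ^ 4) + 3 * s * (C / r ^ 5)"
proof -
  define i where "i = 1 / r"
  have d: "a / r ^ k = a * i ^ k" "a / r = a * i" for a k by (simp_all add: i_def power_one_over)
  have ri: "r * i = 1" using assms(1) by (simp add: i_def)
  have k: "r\<^sup>2 * i ^ 3 = i" "r\<^sup>2 * i ^ 4 = i ^ 2" "r\<^sup>2 * i ^ 5 = i ^ 3"
  proof -
    have "r\<^sup>2 * i ^ (n + 2) = (r * i)\<^sup>2 * i ^ n" for n by (simp add: power_add power_mult_distrib power2_eq_square mult_ac)
    then have "r\<^sup>2 * i ^ (n + 2) = i ^ n" for n by (simp only: ri power_one mult_1_left)
    from this[of 1] this[of 2] this[of 3]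
    show "r\<^sup>2 * i ^ 3 = i" "r\<^sup>2 * i ^ 4 = i ^ 2" "r\<^sup>2 * i ^ 5 = i ^ 3" by (simp_all add: eval_nat_numeral)
  qed
  have t: "s * (a * b) = a * (r\<^sup>2 * b) - a * b * z1\<^sup>2 - a * b * z2\<^sup>2 - a * b * z3\<^sup>2" for a b
    unfolding assms(2) by (simp add: algebra_simps)
  show ?thesis unfolding d mult.assoc[of 3 s] t k by (simp add: algebra_simps)
qed

text \<open>The right-hand side is - 4 s times the second s-derivative of \<open>mom 1 f x\<close>.
  It is kept in moments because they behave differently as s tends to 0.\<close>

lemma mom_dalembert:
  assumes f: "f \<in> Cpc" and s: "s > 0"
  shows "mom 1 (dalembert f) x s = - (s * mom 3 (partial 0 (partial 0 f)) x s)
     - 3 * (s * mom 4 (partial 0 f) x s) - 3 * (s * mom 5 f x s)"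
proof -
  let ?p = "\<lambda>y. x - shell s y"
  define V where "V = (\<lambda>j y. partial (kap j) (partial (kap j) f) (x - shell s y) / hyp s y
      - partial 0 (partial 0 f) (x - shell s y) * (y $ j)\<^sup>2 / hyp s y ^ 3
      + partial 0 f (x - shell s y) * (1 / hyp s y ^ 2 - 3 * (y $ j)\<^sup>2 / hyp s y ^ 4)
      + f (x - shell s y) * (1 / hyp s y ^ 3 - 3 * (y $ j)\<^sup>2 / hyp s y ^ 5))"
  have V: "integrable lborel (V j)" "(\<integral>y. V j y \<partial>lborel) = 0" for j
    unfolding V_def by (fact divergence_integral_eq_0[OF f s])+
  have eq: "V 1 y + V 2 y + V 3 y = dalembert f (?p y) / hyp s y ^ 1 + s * (partial 0 (partial 0 f) (?p y) / hyp s y ^ 3)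
     + 3 * s * (partial 0 f (?p y) / hyp s y ^ 4) + 3 * s * (f (?p y) / hyp s y ^ 5)" for y
  proof -
    define r where "r = hyp s y"
    have r: "r > 0" unfolding r_def using hyp_pos[OF s] .
    have ss: "s = r^2 - ((y $ 1)\<^sup>2 + (y $ 2)\<^sup>2 + (y $ 3)\<^sup>2)"
      unfolding r_def using hyp_squared[of s y] s by (simp add: norm_vec3_squared sum_3)
    have d: "dalembert f (?p y) = - partial 0 (partial 0 f) (?p y) + partial 1 (partial 1 f) (?p y)
        + partial 2 (partial 2 f) (?p y) + partial 3 (partial 3 f) (?p y)"
      unfolding dalembert_def by simp
    show ?thesis unfolding V_def r_def[symmetric] kap_simps d
      by (rule divergence_identity[OF r ss])
  qed
  have "0 = (\<integral>y. V 1 y + V 2 y + V 3 y \<partial>lborel)" using V by simp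
  also have "\<dots> = mom 1 (dalembert f) x s + s * mom 3 (partial 0 (partial 0 f)) x s
      + 3 * s * mom 4 (partial 0 f) x s + 3 * s * mom 5 f x s"
  proof -
    have i: "integrable lborel (\<lambda>y. h (?p y) / hyp s y ^ k)" if "h \<in> Cpc" for h k
      using that s by (rule mom_integrable_pos)
    note ii = i[OF Cpc_dalembert[OF f], of 1] i[OF Cpc_partial[OF Cpc_partial[OF f]], of 0 0 3]
       i[OF Cpc_partial[OF f], of 0 4] i[OF f, of 5]
    show ?thesis unfolding eq mom_def
      using ii by (simp only: Bochner_Integration.integral_add integral_mult_right_zero
          Bochner_Integration.integrable_add integrable_mult_right)
  qed
  finally show ?thesis by simp
qed

text \<open>The value is \<open>4 * pi\<close>, but only positivity is needed.\<close>

definition hypC :: real where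
  "hypC = (\<integral>z. 3 / hyp 1 z ^ 5 \<partial>lborel)"

section \<open>Limits at the light cone and the normalisation\<close>

lemma hyp_1_ge_1: "1 \<le> hyp 1 z"
  using hyp_ge_sqrt[of 1 z] by simp

lemma hyp_measurable [measurable]: "hyp s \<in> borel_measurable borel"
  by (intro borel_measurable_continuous_onI continuous_on_hyp continuous_intros)

text \<open>With \<open>k\<close> least such that the norm is at most 2^(k+1),
  \<open>hyp 1 z\<close> is at least 2^k; level times cubed radius then decays like 4^-k.\<close>

lemma integrable_hyp5: "integrable lborel (\<lambda>z. 3 / hyp 1 z ^ 5)"
proof (rule integrable_dyadic_majorant[where R = "\<lambda>k. 2 ^ Suc k" and w = "\<lambda>k. 3 / (2 ^ k) ^ 5"])
  have e: "3 / (2 ^ k) ^ 5 * (2 ^ Suc k) ^ 3 = 24 * (1 / 4 :: real) ^ k" for k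
  proof -
    define a :: real where "a = 2 ^ k"
    have "a \<noteq> 0" by (simp add: a_def)
    moreover have "a ^ 5 = a ^ 3 * a\<^sup>2" by (simp add: eval_nat_numeral)
    moreover have "a\<^sup>2 = 4 ^ k" unfolding a_def by (simp add: power2_eq_square power_mult_distrib[symmetric])
    ultimately show ?thesis
      unfolding power_Suc a_def[symmetric] by (simp add: power_mult_distrib power_one_over)
  qed
  show "summable (\<lambda>k. 3 / (2 ^ k) ^ 5 * (2 ^ Suc k) ^ 3 :: real)"
    unfolding e by (intro summable_mult summable_geometric) simp
  show "\<exists>k. norm z \<le> 2 ^ Suc k \<and> \<bar>3 / hyp 1 z ^ 5\<bar> \<le> 3 / (2 ^ k) ^ 5" for z
  proof -
    define P where "P k \<longleftrightarrow> norm z \<le> 2 ^ Suc k" for k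
    obtain n where "norm z < 2 ^ n" using real_arch_pow[of 2 "norm z"] by auto
    also have "(2::real) ^ n \<le> 2 ^ Suc n" by simp
    finally have "P n" by (simp add: P_def)
    define k where "k = (LEAST k. P k)"
    have "P k" unfolding k_def using \<open>P n\<close> by (rule LeastI)
    have "2 ^ k \<le> hyp 1 z"
    proof (cases k)
      case (Suc j)
      have "\<not> P j" using not_less_Least[of j P] unfolding k_def[symmetric] Suc by simp
      then show ?thesis unfolding Suc P_def using hyp_ge_norm[of 1 z] by linarith
    qed (use hyp_1_ge_1 in simp)
    then have "3 / hyp 1 z ^ 5 \<le> 3 / (2 ^ k) ^ 5"
      by (intro divide_left_mono power_mono mult_pos_pos zero_less_power hyp_pos) auto
    then show ?thesis using \<open>P k\<close> hyp_nonneg[of 1 z] unfolding P_def by (intro exI[of _ k]) auto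
  qed
qed auto

lemma hypC_pos: "hypC > 0"
proof -
  have "0 < 3 / sqrt 2 ^ 5 * measure lborel (cball (0::real^3) 1)" by (simp add: content_cball)
  also have "\<dots> = (\<integral>z. 3 / sqrt 2 ^ 5 * indicat_real (cball (0::real^3) 1) z \<partial>lborel)" by simp
  also have "\<dots> \<le> hypC" unfolding hypC_def
  proof (rule integral_mono[OF _ integrable_hyp5])
    show "integrable lborel (\<lambda>z::real^3. 3 / sqrt 2 ^ 5 * indicat_real (cball 0 1) z)"
      by (rule integrable_bounded_support[where C = "3 / sqrt 2 ^ 5" and T = 1]) (auto simp: indicator_def)
    fix z :: "real^3"
    show "3 / sqrt 2 ^ 5 * indicat_real (cball 0 1) z \<le> 3 / hyp 1 z ^ 5"
    proof (cases "norm z \<le> 1")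
      case True
      then have "(norm z)\<^sup>2 \<le> 1\<^sup>2" by (intro power_mono) auto
      then have "hyp 1 z \<le> sqrt 2" unfolding hyp_def by (intro real_sqrt_le_mono) simp
      then have "3 / sqrt 2 ^ 5 \<le> 3 / hyp 1 z ^ 5"
        by (intro divide_left_mono power_mono mult_pos_pos zero_less_power hyp_pos hyp_nonneg) auto
      then show ?thesis using True by simp
    qed (use hyp_nonneg[of 1 z] in simp)
  qed
  finally show ?thesis .
qed

text \<open>Since s is at most the square of \<open>hyp s y\<close>, the factor s removes two powers
  and leaves 1 / \<open>norm y\<close> ^ j, which is integrable near the origin for j up to 2. So s
  times a moment of order 2 to 4 vanishes in the limit; order 5 is different.\<close>

lemma continuous_on_mult_mom:
  assumes f: "f \<in> Cpc" and j: "j \<le> 2"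
  shows "continuous_on {0..} (\<lambda>s. s * mom (j + 2) f x s)"
proof -
  obtain q where q: "x \<in> causal_past q" using in_some_causal_past by blast
  obtain B T where B: "B \<ge> 0" "\<And>x s y. x \<in> causal_past q \<Longrightarrow> s \<ge> 0 \<Longrightarrow> \<bar>f (x - shell s y)\<bar> \<le> B * indicat_real (cball 0 T) y"
    using Cpc_shell_bound[OF f, of q] by metis
  have "continuous_on {0..} (\<lambda>s. \<integral>y. s * (f (x - shell s y) / hyp s y ^ (j + 2)) \<partial>lborel)"
  proof (rule continuous_on_integral_dominated)
    show "(\<lambda>y. s * (f (x - shell s y) / hyp s y ^ (j + 2))) \<in> borel_measurable lborel" for s
      by (intro borel_measurable_times borel_measurable_const mom_integrand_measurable Cpc_smooth f)
    show "AE y in lborel. continuous_on {0..} (\<lambda>s. s * (f (x - shell s y) / hyp s y ^ (j + 2)))"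
      using AE_nonzero
    proof eventually_elim
      case (elim y)
      have "hyp s y \<noteq> 0" if "s \<in> {0..}" for s using hyp_pos'[of s y] elim that by auto
      then show ?case
        by (intro continuous_intros continuous_on_shell continuous_on_hyp
           continuous_on_compose2[OF smooth_continuous[OF Cpc_smooth[OF f], of UNIV]]) auto
    qed
    have "integrable lborel (\<lambda>y. B * (indicat_real (cball (0::real^3) T) y / norm y ^ j))"
    proof (rule integrable_mult_right)
      consider "j = 0" | "j = 1" | "j = 2" using j by linarith
      then show "integrable lborel (\<lambda>y. indicat_real (cball (0::real^3) T) y / norm y ^ j)"
      proof cases
        case 1
        have "integrable lborel (indicat_real (cball (0::real^3) T))"
          by (rule integrable_bounded_support[where C = 1 and T = T]) (auto simp: indicator_def)
        then show ?thesis using 1 by simp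
      qed (use integrable_inverse_norm integrable_inverse_norm_sq in auto)
    qed
    moreover have "AE y in lborel. \<bar>s * (f (x - shell s y) / hyp s y ^ (j + 2))\<bar> \<le> B * (indicat_real (cball 0 T) y / norm y ^ j)"
      if s: "s \<in> {0..}" for s
      using AE_nonzero
    proof eventually_elim
      case (elim y)
      have h: "hyp s y > 0" using hyp_pos'[of s y] elim s by auto
      have "s \<le> (hyp s y)\<^sup>2" using hyp_squared[of s y] s by simp
      then have s1: "s / (hyp s y)\<^sup>2 \<le> 1" using h by (simp add: divide_le_eq)
      have "\<bar>s * (f (x - shell s y) / hyp s y ^ (j + 2))\<bar> = (\<bar>f (x - shell s y)\<bar> / hyp s y ^ j) * (s / (hyp s y)\<^sup>2)"
        using h s by (simp add: abs_mult power_add power2_eq_square mult_ac)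
      also have "\<dots> \<le> (\<bar>f (x - shell s y)\<bar> / hyp s y ^ j) * 1"
        using s1 h by (intro mult_left_mono) auto
      also have "\<dots> \<le> (B * indicat_real (cball 0 T) y) / norm y ^ j"
        using B q s elim hyp_ge_norm[of s y]
        by (simp only: mult_1_right) (intro frac_le power_mono B, auto)
      finally show ?case by simp
    qed
    ultimately show "\<exists>r>0. \<exists>B. integrable lborel B \<and> (\<forall>s'\<in>{0..}. dist s' s < r \<longrightarrow>
       (AE y in lborel. \<bar>s' * (f (x - shell s' y) / hyp s' y ^ (j + 2))\<bar> \<le> B y))" for s
      by (intro exI[of _ 1] conjI exI[of _ "\<lambda>y. B * (indicat_real (cball 0 T) y / norm y ^ j)"]) auto
  qed
  then show ?thesis unfolding mom_def by (simp only: integral_mult_right_zero)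
qed

text \<open>Order 5 is the scale-invariant case: y = sqrt s z produces the powers s, s^(3/2) and
  s^(-5/2), which cancel. The measure keeps the total mass \<open>hypC\<close> and shrinks to the
  tip of the cone, an approximate identity.\<close>

lemma mom5_tendsto:
  assumes f: "f \<in> Cpc"
  shows "((\<lambda>s. 3 * (s * mom 5 f x s)) \<longlongrightarrow> hypC * f x) (at_right 0)"
proof -
  obtain q where q: "x \<in> causal_past q" using in_some_causal_past by blast
  obtain B where B: "B \<ge> 0" "\<And>y. y \<in> causal_past q \<Longrightarrow> \<bar>f y\<bar> \<le> B" using Cpc_bounded[OF f] by blast
  let ?g = "\<lambda>s. \<integral>z. f (x - sqrt s *\<^sub>R shell 1 z) * (3 / hyp 1 z ^ 5) \<partial>lborel"
  have c: "continuous_on UNIV (\<lambda>z. f (x - r *\<^sub>R shell 1 z))" for r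
    by (intro continuous_intros continuous_on_shell
         continuous_on_compose2[OF smooth_continuous[OF Cpc_smooth[OF f], of UNIV]]) auto
  have "continuous_on {0..} ?g"
  proof (rule continuous_on_integral_dominated)
    show "(\<lambda>z. f (x - sqrt s *\<^sub>R shell 1 z) * (3 / hyp 1 z ^ 5)) \<in> borel_measurable lborel" for s
      using borel_measurable_continuous_onI[OF c, of "sqrt s"] by measurable
    show "AE z in lborel. continuous_on {0..} (\<lambda>s. f (x - sqrt s *\<^sub>R shell 1 z) * (3 / hyp 1 z ^ 5))"
      by (intro AE_I2 continuous_intros continuous_on_compose2[OF smooth_continuous[OF Cpc_smooth[OF f], of UNIV]]) auto
    have "\<bar>f (x - sqrt s *\<^sub>R shell 1 z) * (3 / hyp 1 z ^ 5)\<bar> \<le> B * (3 / hyp 1 z ^ 5)" if "s \<ge> 0" for s z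
    proof -
      have "sqrt s *\<^sub>R shell 1 z = shell (s * 1) (sqrt s *\<^sub>R z)"
        using shell_scale[of "sqrt s" 1 z] that by simp
      then have "x - sqrt s *\<^sub>R shell 1 z \<in> causal_past q" using shell_in_causal_past[OF q] that by simp
      then have "\<bar>f (x - sqrt s *\<^sub>R shell 1 z)\<bar> * (3 / hyp 1 z ^ 5) \<le> B * (3 / hyp 1 z ^ 5)"
        using B(2) hyp_nonneg[of 1 z] by (intro mult_right_mono) auto
      moreover have "\<bar>a * (3 / hyp 1 z ^ 5)\<bar> = \<bar>a\<bar> * (3 / hyp 1 z ^ 5)" for a
        using hyp_nonneg[of 1 z] by (simp add: abs_mult)
      ultimately show ?thesis by (simp only:)
    qed
    then show "\<exists>r>0. \<exists>B. integrable lborel B \<and> (\<forall>s'\<in>{0..}. dist s' s < r \<longrightarrow>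
       (AE z in lborel. \<bar>f (x - sqrt s' *\<^sub>R shell 1 z) * (3 / hyp 1 z ^ 5)\<bar> \<le> B z))" for s
      using integrable_mult_right[OF integrable_hyp5, of B]
      by (intro exI[of _ 1] conjI exI[of _ "\<lambda>z. B * (3 / hyp 1 z ^ 5)"] ballI impI AE_I2) auto
  qed
  then have "(?g \<longlongrightarrow> ?g 0) (at 0 within {0..})" unfolding continuous_on_def by (rule bspec) simp
  then have lim: "(?g \<longlongrightarrow> ?g 0) (at_right 0)" by (rule tendsto_within_subset) auto
  have "?g 0 = f x * hypC"
    unfolding hypC_def by (simp only: real_sqrt_zero scale_zero_left diff_zero integral_mult_right_zero)
  then have g0: "?g 0 = hypC * f x" by (simp only: mult.commute)
  have eq: "?g s = 3 * (s * mom 5 f x s)" if s: "s > 0" for s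
  proof -
    define r where "r = sqrt s"
    have r: "r > 0" "s = r\<^sup>2 * 1" using s by (auto simp: r_def)
    have "mom 5 f x s = r ^ 3 * (\<integral>z. f (x - shell s (r *\<^sub>R z)) / hyp s (r *\<^sub>R z) ^ 5 \<partial>lborel)"
      unfolding mom_def using mom_integrand_measurable[OF Cpc_smooth[OF f]]
      by (subst integral_lborel_scale[OF r(1)]) auto
    also have "(\<lambda>z. f (x - shell s (r *\<^sub>R z)) / hyp s (r *\<^sub>R z) ^ 5) = (\<lambda>z. (1 / (3 * r ^ 5)) * (f (x - r *\<^sub>R shell 1 z) * (3 / hyp 1 z ^ 5)))"
    proof -
      have "shell s (r *\<^sub>R z) = r *\<^sub>R shell 1 z" "hyp s (r *\<^sub>R z) = r * hyp 1 z" for z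
        using shell_scale[of r 1 z] hyp_scale[of r 1 z] r by simp_all
      then show ?thesis by (simp add: power_mult_distrib)
    qed
    also have "(\<integral>z. (1 / (3 * r ^ 5)) * (f (x - r *\<^sub>R shell 1 z) * (3 / hyp 1 z ^ 5)) \<partial>lborel) = (1 / (3 * r ^ 5)) * ?g s"
      unfolding r_def by (rule integral_mult_right_zero)
    finally have "3 * (s * mom 5 f x s) = 3 * (r\<^sup>2 * (r ^ 3 * ((1 / (3 * r ^ 5)) * ?g s)))" using r(2) by simp
    also have "\<dots> = ?g s" using r(1) by (simp add: power_add[symmetric])
    finally show ?thesis by simp
  qed
  have "eventually (\<lambda>s. ?g s = 3 * (s * mom 5 f x s)) (at_right 0)"
    using eq by (auto simp: eventually_at_filter)
  from Lim_transform_eventually[OF lim this] show ?thesis unfolding g0 .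
qed

lemma tendsto_mult_mom_0:
  assumes "f \<in> Cpc" "j \<le> 2"
  shows "((\<lambda>s. s * mom (j + 2) f x s) \<longlongrightarrow> 0) (at_right 0)"
proof -
  \<comment> \<open>Whatever the moment is at s = 0, continuity was proved for the product, which is
    0 there.\<close>
  have "((\<lambda>s. s * mom (j + 2) f x s) \<longlongrightarrow> 0 * mom (j + 2) f x 0) (at 0 within {0..})"
    using continuous_on_mult_mom[OF assms, of x] unfolding continuous_on_def by (metis atLeast_iff order_refl)
  then have "((\<lambda>s. s * mom (j + 2) f x s) \<longlongrightarrow> 0 * mom (j + 2) f x 0) (at_right 0)"
    by (rule tendsto_within_subset) auto
  then show ?thesis by simp
qed

text \<open>The massless case, the classical retarded potential: integration over the light cone
  inverts the wave operator up to a constant, because only the moment of order 5 survives the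
  limit.\<close>

lemma mom1_dalembert_at_0:
  assumes f: "f \<in> Cpc"
  shows "mom 1 (dalembert f) x 0 = - (hypC * f x)"
proof -
  have "continuous_on {0..} (\<lambda>s. mom 1 (dalembert f) x s)"
    by (rule continuous_on_mom1_compose[OF Cpc_dalembert[OF f]]) (auto intro: continuous_intros)
  then have "((\<lambda>s. mom 1 (dalembert f) x s) \<longlongrightarrow> mom 1 (dalembert f) x 0) (at 0 within {0..})"
    unfolding continuous_on_def by (rule bspec) simp
  then have 1: "((\<lambda>s. mom 1 (dalembert f) x s) \<longlongrightarrow> mom 1 (dalembert f) x 0) (at_right 0)"
    by (rule tendsto_within_subset) auto
  have e: "(1::nat) + 2 = 3" "(2::nat) + 2 = 4" by auto
  have "((\<lambda>s. - (s * mom 3 (partial 0 (partial 0 f)) x s)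
     - 3 * (s * mom 4 (partial 0 f) x s) - 3 * (s * mom 5 f x s)) \<longlongrightarrow> - 0 - 3 * 0 - hypC * f x) (at_right 0)"
    by (intro tendsto_intros tendsto_mult_mom_0[where j = 1, unfolded e] tendsto_mult_mom_0[where j = 2, unfolded e]
          mom5_tendsto Cpc_partial f) auto
  moreover have "eventually (\<lambda>s. - (s * mom 3 (partial 0 (partial 0 f)) x s)
     - 3 * (s * mom 4 (partial 0 f) x s) - 3 * (s * mom 5 f x s) = mom 1 (dalembert f) x s) (at_right 0)"
    using mom_dalembert[OF f, of _ x] by (auto simp: eventually_at_filter)
  ultimately have "((\<lambda>s. mom 1 (dalembert f) x s) \<longlongrightarrow> - 0 - 3 * 0 - hypC * f x) (at_right 0)"
    by (rule Lim_transform_eventually)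
  from tendsto_unique[OF _ 1 this] show ?thesis by simp
qed

section \<open>The retarded Green operator\<close>

text \<open>A light-cone term independent of M plus a Bessel tail inside the cone. The minus sign
  reflects the signature of \<open>dalembert\<close>; dividing by \<open>hypC\<close> makes the
  operator an inverse.\<close>

definition Gk :: "real \<Rightarrow> (pt \<Rightarrow> real) \<Rightarrow> pt \<Rightarrow> real" where
  "Gk M f x = (1 / hypC) * (- mom 1 f x 0 + (1 / 4) * (LINT s:{0..}|lborel. Phi M s * mom 1 f x s))"

lemma mom1_lincomb:
  assumes "f \<in> Cpc" "g \<in> Cpc" "s \<ge> 0"
  shows "mom 1 (\<lambda>x. a * f x + b * g x) x s = a * mom 1 f x s + b * mom 1 g x s"
proof -
  have "mom 1 (\<lambda>x. a * f x + b * g x) x s =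
     (\<integral>y. a * (f (x - shell s y) / hyp s y ^ 1) + b * (g (x - shell s y) / hyp s y ^ 1) \<partial>lborel)"
    unfolding mom_def by (simp add: add_divide_distrib)
  also have "\<dots> = a * mom 1 f x s + b * mom 1 g x s"
    unfolding mom_def
    by (subst Bochner_Integration.integral_add)
       (intro integrable_mult_right mom1_integrable assms | simp only: integral_mult_right_zero)+
  finally show ?thesis .
qed

lemma mom_eq_0: "(\<And>y. f (x - shell s y) = 0) \<Longrightarrow> mom k f x s = 0"
  unfolding mom_def by simp

lemma mom1_uniform_bound:
  assumes "f \<in> Cpc"
  shows "\<exists>B\<ge>0. \<exists>T>0. \<forall>x\<in>causal_past q. (\<forall>s\<ge>0. \<bar>mom 1 f x s\<bar> \<le> B) \<and> (\<forall>s>T\<^sup>2. mom 1 f x s = 0)"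
proof -
  obtain B T where B: "B \<ge> 0" "T > 0" "\<And>x s y. x \<in> causal_past q \<Longrightarrow> s \<ge> 0 \<Longrightarrow> \<bar>f (x - shell s y)\<bar> \<le> B * indicat_real (cball 0 T) y"
    "\<And>x s y. x \<in> causal_past q \<Longrightarrow> s > T\<^sup>2 \<Longrightarrow> f (x - shell s y) = 0"
    using Cpc_shell_bound[OF assms, of q] by metis
  let ?I = "\<integral>y. indicat_real (cball (0::real^3) T) y / norm y \<partial>lborel"
  have I: "?I \<ge> 0" by (intro integral_nonneg_AE AE_I2) auto
  have h1: "0 \<le> B * ?I" using B(1) I by (rule mult_nonneg_nonneg)
  have h2: "\<bar>mom 1 f x s\<bar> \<le> B * ?I" if "x \<in> causal_past q" "s \<ge> 0" for x s
    by (rule mom1_abs_le[OF assms that(2)]) (rule B(3)[OF that])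
  have h3: "mom 1 f x s = 0" if "x \<in> causal_past q" "s > T\<^sup>2" for x s
    by (rule mom_eq_0) (rule B(4)[OF that])
  show ?thesis using h1 B(2) h2 h3 by blast
qed

lemma Gk_integrand_integrable:
  assumes f: "f \<in> Cpc"
  shows "set_integrable lborel {0..} (\<lambda>s. Phi M s * mom 1 f x s)"
proof -
  obtain q where q: "x \<in> causal_past q" using in_some_causal_past by blast
  obtain B T where B: "B \<ge> 0" "T > 0"
    "\<And>x s. x \<in> causal_past q \<Longrightarrow> s \<ge> 0 \<Longrightarrow> \<bar>mom 1 f x s\<bar> \<le> B"
    "\<And>x s. x \<in> causal_past q \<Longrightarrow> s > T\<^sup>2 \<Longrightarrow> mom 1 f x s = 0" using mom1_uniform_bound[OF f, of q] by blast
  have "set_integrable lborel {0..T\<^sup>2} (\<lambda>s. Phi M s * mom 1 f x s)"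
    by (intro borel_integrable_atLeastAtMost' continuous_intros continuous_on_Phi
        continuous_on_mom1_compose[OF f]) auto
  also have "?this \<longleftrightarrow> ?thesis"
    unfolding set_integrable_def using B(4)[OF q]
    by (intro Bochner_Integration.integrable_cong) (auto simp: indicator_def)
  finally show ?thesis .
qed

lemma Gk_lincomb:
  assumes "f \<in> Cpc" "g \<in> Cpc"
  shows "Gk M (\<lambda>x. a * f x + b * g x) x = a * Gk M f x + b * Gk M g x"
proof -
  have "(LINT s:{0..}|lborel. Phi M s * mom 1 (\<lambda>x. a * f x + b * g x) x s) =
     (LINT s:{0..}|lborel. a * (Phi M s * mom 1 f x s) + b * (Phi M s * mom 1 g x s))"
    by (intro set_lebesgue_integral_cong) (auto simp: mom1_lincomb[OF assms] algebra_simps simp del: One_nat_def)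
  also have "\<dots> = a * (LINT s:{0..}|lborel. Phi M s * mom 1 f x s) + b * (LINT s:{0..}|lborel. Phi M s * mom 1 g x s)"
    using Gk_integrand_integrable[OF assms(1)] Gk_integrand_integrable[OF assms(2)]
    by (subst set_integral_add) auto
  finally show ?thesis unfolding Gk_def mom1_lincomb[OF assms order_refl] by (simp add: algebra_simps)
qed

text \<open>Continuity in M gives measurability in superpositions and the passage to equal masses in
  products; continuity in x feeds \<open>Cpc_operatorI\<close>.\<close>

lemma Gk_continuous:
  assumes f: "f \<in> Cpc"
  shows "continuous_on UNIV (\<lambda>(M, x). Gk M f x)"
proof -
  have "continuous_on UNIV (\<lambda>p. \<integral>s. indicat_real {0..} s *\<^sub>R (Phi (fst p) s * mom 1 f (snd p) s) \<partial>lborel)"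
  proof (rule continuous_on_integral_dominated)
    fix p :: "real \<times> pt"
    show "(\<lambda>s. indicat_real {0..} s *\<^sub>R (Phi (fst p) s * mom 1 f (snd p) s)) \<in> borel_measurable lborel"
      using Gk_integrand_integrable[OF f] unfolding set_integrable_def by blast
    obtain q where q: "ball (snd p) 1 \<subseteq> causal_past q" using nhds_causal_past by blast
    obtain B T where B: "B \<ge> 0" "T > 0"
      "\<And>x s. x \<in> causal_past q \<Longrightarrow> s \<ge> 0 \<Longrightarrow> \<bar>mom 1 f x s\<bar> \<le> B"
      "\<And>x s. x \<in> causal_past q \<Longrightarrow> s > T\<^sup>2 \<Longrightarrow> mom 1 f x s = 0" using mom1_uniform_bound[OF f, of q] by blast
    have "compact ((\<lambda>(M, s). Phi M s) ` (cball (fst p) 1 \<times> {0..T\<^sup>2}))"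
      unfolding split_def by (intro compact_continuous_image continuous_on_Phi continuous_intros compact_Times) auto
    then obtain C where C: "\<And>M s. M \<in> cball (fst p) 1 \<Longrightarrow> s \<in> {0..T\<^sup>2} \<Longrightarrow> \<bar>Phi M s\<bar> \<le> C"
    proof -
      assume c: "compact ((\<lambda>(M, s). Phi M s) ` (cball (fst p) 1 \<times> {0..T\<^sup>2}))"
      obtain C where C: "\<forall>z \<in> (\<lambda>(M, s). Phi M s) ` (cball (fst p) 1 \<times> {0..T\<^sup>2}). norm z \<le> C"
        using compact_imp_bounded[OF c] unfolding bounded_iff by blast
      show ?thesis by (rule that[of C]) (use C in force)
    qed
    have "AE s in lborel. \<bar>indicat_real {0..} s *\<^sub>R (Phi (fst p') s * mom 1 f (snd p') s)\<bar> \<le> (C * B) * indicat_real (cball 0 (T\<^sup>2)) s"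
      if p': "dist p' p < 1" for p'
    proof (intro AE_I2)
      fix s :: real
      have x: "snd p' \<in> causal_past q" using q p' dist_snd_le[of p' p] by (auto simp: dist_commute)
      have M: "fst p' \<in> cball (fst p) 1" using p' dist_fst_le[of p' p] by (auto simp: dist_commute)
      consider "s < 0" | "s > T\<^sup>2" | "0 \<le> s" "s \<le> T\<^sup>2" by linarith
      then show "\<bar>indicat_real {0..} s *\<^sub>R (Phi (fst p') s * mom 1 f (snd p') s)\<bar> \<le> (C * B) * indicat_real (cball 0 (T\<^sup>2)) s"
      proof cases
        case 3
        have "\<bar>Phi (fst p') s\<bar> * \<bar>mom 1 f (snd p') s\<bar> \<le> C * B"
          using C[OF M, of s] B(3)[OF x 3(1)] 3 order_trans[OF abs_ge_zero C[OF M, of s]] by (intro mult_mono) auto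
        then show ?thesis using 3 by (simp add: abs_mult)
      next
        case 1
        have "C \<ge> 0" using C[OF M, of 0] by (auto intro: order_trans[OF abs_ge_zero])
        then show ?thesis using 1 B(1) by simp
      next
        case 2
        have "C \<ge> 0" using C[OF M, of 0] by (auto intro: order_trans[OF abs_ge_zero])
        then show ?thesis using B(4)[OF x 2] B(1) by simp
      qed
    qed
    moreover have "integrable lborel (\<lambda>s. (C * B) * indicat_real (cball (0::real) (T\<^sup>2)) s)"
      by (rule integrable_bounded_support[where C = "\<bar>C * B\<bar>" and T = "T\<^sup>2"]) (auto simp: indicator_def)
    ultimately show "\<exists>r>0. \<exists>B. integrable lborel B \<and> (\<forall>p'\<in>UNIV. dist p' p < r \<longrightarrow>
        (AE s in lborel. \<bar>indicat_real {0..} s *\<^sub>R (Phi (fst p') s * mom 1 f (snd p') s)\<bar> \<le> B s))"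
      by (intro exI[of _ 1] conjI exI[of _ "\<lambda>s. (C * B) * indicat_real (cball 0 (T\<^sup>2)) s"]) auto
  next
    have "continuous_on UNIV (\<lambda>p. indicat_real {0..} s *\<^sub>R (Phi (fst p) s * mom 1 f (snd p) s))" for s
      by (cases "s \<ge> 0") (auto intro!: continuous_intros continuous_on_Phi continuous_on_mom1_compose[OF f] simp del: One_nat_def)
    then show "AE s in lborel. continuous_on UNIV (\<lambda>p. indicat_real {0..} s *\<^sub>R (Phi (fst p) s * mom 1 f (snd p) s))" by simp
  qed
  moreover have "continuous_on UNIV (\<lambda>p::real \<times> pt. mom 1 f (snd p) 0)"
    by (intro continuous_on_mom1_compose[OF f] continuous_intros) auto
  ultimately show ?thesis unfolding Gk_def split_def set_lebesgue_integral_def by (intro continuous_intros)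
qed

lemma Gk_continuous_mass:
  assumes "f \<in> Cpc" shows "continuous_on A (\<lambda>M. Gk M f x)"
proof -
  have c: "continuous_on A (\<lambda>M. (M, x))" by (intro continuous_on_Pair continuous_on_const continuous_on_id)
  from continuous_on_compose2[OF Gk_continuous[OF assms] c subset_UNIV] show ?thesis by simp
qed

lemma Gk_continuous_space:
  assumes "f \<in> Cpc" shows "continuous_on A (Gk M f)"
proof -
  have c: "continuous_on A (\<lambda>x::pt. (M, x))" by (intro continuous_on_Pair continuous_on_const continuous_on_id)
  from continuous_on_compose2[OF Gk_continuous[OF assms] c subset_UNIV] show ?thesis by simp
qed

lemma Gk_DERIV:
  assumes f: "f \<in> Cpc"
  shows "((\<lambda>u. Gk M f (x + u *\<^sub>R axis i 1)) has_real_derivative Gk M (partial i f) (x + u *\<^sub>R axis i 1)) (at u)"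
proof -
  let ?x = "\<lambda>u. x + u *\<^sub>R axis i (1::real)"
  have f': "partial i f \<in> Cpc" using f by (rule Cpc_partial)
  obtain q where near: "\<And>v. \<bar>v - u\<bar> < 1 \<Longrightarrow> ?x v \<in> causal_past q"
    using line_in_causal_past by blast
  obtain B T where B: "B \<ge> 0" "T > 0"
    "\<And>x s. x \<in> causal_past q \<Longrightarrow> s \<ge> 0 \<Longrightarrow> \<bar>mom 1 (partial i f) x s\<bar> \<le> B"
    "\<And>x s. x \<in> causal_past q \<Longrightarrow> s > T\<^sup>2 \<Longrightarrow> mom 1 (partial i f) x s = 0" using mom1_uniform_bound[OF f', of q] by blast
  have "((\<lambda>u. \<integral>s. indicat_real {0..} s *\<^sub>R (Phi M s * mom 1 f (?x u) s) \<partial>lborel) has_real_derivative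
     (\<integral>s. indicat_real {0..} s *\<^sub>R (Phi M s * mom 1 (partial i f) (?x u) s) \<partial>lborel)) (at u)"
  proof (rule has_real_derivative_integral[where r = 1 and B = "\<lambda>s. B * (indicat_real {0..T\<^sup>2} s *\<^sub>R \<bar>Phi M s\<bar>)"])
    show "integrable lborel (\<lambda>s. indicat_real {0..} s *\<^sub>R (Phi M s * mom 1 f (?x v) s))" for v
      using Gk_integrand_integrable[OF f] unfolding set_integrable_def by blast
    show "(\<lambda>s. indicat_real {0..} s *\<^sub>R (Phi M s * mom 1 (partial i f) (?x u) s)) \<in> borel_measurable lborel"
      using Gk_integrand_integrable[OF f'] unfolding set_integrable_def by blast
    have "set_integrable lborel {0..T\<^sup>2} (\<lambda>s. \<bar>Phi M s\<bar>)"
      by (intro borel_integrable_atLeastAtMost' continuous_intros continuous_on_Phi)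
    then show "integrable lborel (\<lambda>s. B * (indicat_real {0..T\<^sup>2} s *\<^sub>R \<bar>Phi M s\<bar>))"
      unfolding set_integrable_def by (rule integrable_mult_right)
    show "AE s in lborel. \<forall>v. \<bar>v - u\<bar> < 1 \<longrightarrow>
        ((\<lambda>v. indicat_real {0..} s *\<^sub>R (Phi M s * mom 1 f (?x v) s)) has_real_derivative
          indicat_real {0..} s *\<^sub>R (Phi M s * mom 1 (partial i f) (?x v) s)) (at v)"
    proof (intro AE_I2 allI impI)
      fix s v :: real
      show "((\<lambda>v. indicat_real {0..} s *\<^sub>R (Phi M s * mom 1 f (?x v) s)) has_real_derivative
          indicat_real {0..} s *\<^sub>R (Phi M s * mom 1 (partial i f) (?x v) s)) (at v)"
        using DERIV_cmult[OF mom1_DERIV[OF f, of s x i v], of "Phi M s"] by (cases "s \<ge> 0") auto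
    qed
    show "AE s in lborel. \<forall>v. \<bar>v - u\<bar> < 1 \<longrightarrow>
        \<bar>indicat_real {0..} s *\<^sub>R (Phi M s * mom 1 (partial i f) (?x v) s)\<bar> \<le> B * (indicat_real {0..T\<^sup>2} s *\<^sub>R \<bar>Phi M s\<bar>)"
    proof (intro AE_I2 allI impI)
      fix s v :: real assume v: "\<bar>v - u\<bar> < 1"
      show "\<bar>indicat_real {0..} s *\<^sub>R (Phi M s * mom 1 (partial i f) (?x v) s)\<bar> \<le> B * (indicat_real {0..T\<^sup>2} s *\<^sub>R \<bar>Phi M s\<bar>)"
      proof (cases "s \<ge> 0 \<and> s \<le> T\<^sup>2")
        case True
        then have "\<bar>Phi M s\<bar> * \<bar>mom 1 (partial i f) (?x v) s\<bar> \<le> \<bar>Phi M s\<bar> * B"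
          using B(3)[OF near[OF v]] by (intro mult_left_mono) auto
        then show ?thesis using True by (simp add: abs_mult mult.commute)
      qed (use B(4)[OF near[OF v], of s] in auto)
    qed
  qed auto
  from DERIV_cmult[OF DERIV_add[OF DERIV_minus[OF mom1_DERIV[OF f order_refl]] DERIV_cmult[OF this, of "1/4"]], of "1 / hypC"]
  show ?thesis unfolding Gk_def set_lebesgue_integral_def by simp
qed

lemma Gk_support:
  assumes "Gk M f x \<noteq> 0" shows "x \<in> Jp (tsupp f)"
proof (rule ccontr)
  assume x: "x \<notin> Jp (tsupp f)"
  have "f (x - shell s y) = 0" if "s \<ge> 0" for s y
  proof (rule ccontr)
    assume "f (x - shell s y) \<noteq> 0"
    then have "x - shell s y \<in> tsupp f" by (rule in_tsupp)
    then have "(x - shell s y) + shell s y \<in> Jp (tsupp f)"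
      unfolding Jp_def using shell_in_Vp[OF that] by blast
    then show False using x by simp
  qed
  then have m: "mom 1 f x s = 0" if "s \<ge> 0" for s using that by (intro mom_eq_0)
  have "(LINT s:{0..}|lborel. Phi M s * mom 1 f x s) = (LINT s:{0::real..}|lborel. (0::real))"
    by (intro set_lebesgue_integral_cong) (auto simp: m simp del: One_nat_def)
  then show False using assms m[OF order_refl] unfolding Gk_def by simp
qed

lemma Gk_Cpc: "f \<in> Cpc \<Longrightarrow> Gk M f \<in> Cpc"
  and partial_Gk: "f \<in> Cpc \<Longrightarrow> partial i (Gk M f) = Gk M (partial i f)"
  by (rule Cpc_operatorI[OF _ Gk_continuous_space Gk_DERIV Gk_support]; assumption)+

lemma Gk_dalembert:
  assumes f: "f \<in> Cpc" shows "dalembert (Gk M f) = Gk M (dalembert f)"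
proof
  fix x
  note c = Cpc_partial[OF Cpc_partial[OF f]]
  show "dalembert (Gk M f) x = Gk M (dalembert f) x"
    unfolding dalembert_altdef[of "Gk M f"] dalembert_altdef[of f]
    by (simp only: partial_Gk f Cpc_partial Gk_lincomb Cpc_lincomb)
qed

text \<open>The function \<open>?E\<close> is the Wronskian-type primitive of \<open>Phi M s * A\<^sub>s ((\<box> - M) f) / 4\<close>.\<close>

lemma Gk_left_inverse:
  assumes f: "f \<in> Cpc"
  shows "Gk M (\<lambda>x. dalembert f x - M * f x) x = f x"
proof -
  let ?h = "\<lambda>x. dalembert f x - M * f x"
  have h: "?h \<in> Cpc" using Cpc_lincomb[OF Cpc_dalembert[OF f] f, of 1 "- M"] by simp
  have mh: "mom 1 ?h x s = mom 1 (dalembert f) x s - M * mom 1 f x s" if "s \<ge> 0" for s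
    using mom1_lincomb[OF Cpc_dalembert[OF f] f that, of 1 "- M"] by simp
  obtain q where q: "x \<in> causal_past q" using in_some_causal_past by blast
  obtain T where T: "\<And>x s y. x \<in> causal_past q \<Longrightarrow> s > T\<^sup>2 \<Longrightarrow> f (x - shell s y) = 0"
    using Cpc_shell_bound[OF f, of q] by metis
  obtain T' where T': "\<And>x s y. x \<in> causal_past q \<Longrightarrow> s > T'\<^sup>2 \<Longrightarrow> partial 0 f (x - shell s y) = 0"
    using Cpc_shell_bound[OF Cpc_partial[OF f], of q 0] by metis
  obtain T'' where T'': "\<And>x s y. x \<in> causal_past q \<Longrightarrow> s > T''\<^sup>2 \<Longrightarrow> ?h (x - shell s y) = 0"
    using Cpc_shell_bound[OF h, of q] by metis
  \<comment> \<open>Beyond all three support radii, so that the boundary term at S vanishes and the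
    integral may be cut off at S.\<close>
  define S where "S = T\<^sup>2 + T'\<^sup>2 + T''\<^sup>2 + 1"
  have S: "S > T\<^sup>2" "S > T'\<^sup>2" "S > T''\<^sup>2" "S > 0"
    unfolding S_def using zero_le_power2[of T] zero_le_power2[of T'] zero_le_power2[of T''] by linarith+
  let ?a = "\<lambda>s. mom 1 f x s"
  let ?b = "\<lambda>s. - (s * mom 2 (partial 0 f) x s / 2) - s * mom 3 f x s / 2"
  let ?E = "\<lambda>s. M * F0 (M * s) * ?a s - Phi M s * ?b s"
  let ?I = "\<lambda>s. Phi M s * mom 1 ?h x s"
  have e: "(0::nat) + 2 = 2" "(1::nat) + 2 = 3" by auto
  have cb: "continuous_on {0..} ?b"
    by (intro continuous_intros continuous_on_mult_mom[where j = 0, unfolded e] continuous_on_mult_mom[where j = 1, unfolded e] Cpc_partial f) auto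
  have cF: "continuous_on {0..S} (\<lambda>s. F0 (M * s))"
    by (intro continuous_on_compose2[OF continuous_on_F0[of UNIV]] continuous_intros) auto
  have cE: "continuous_on {0..S} ?E"
    by (intro continuous_intros cF continuous_on_Phi continuous_on_mom1_compose[OF f] continuous_on_subset[OF cb]) auto
  have dE: "(?E has_vector_derivative ?I s / 4) (at s)" if s: "s \<in> {0<..<S}" for s
  proof -
    have s0: "s > 0" using s by auto
    let ?a1 = "\<lambda>s. - (mom 2 (partial 0 f) x s / 2) - 1 / 2 * mom 3 f x s"
    \<comment> \<open>The second s-derivative of \<open>?a\<close>; multiplied by - 4 s it is the
      moment of \<open>dalembert f\<close>.\<close>
    let ?a2 = "(mom 3 (partial 0 (partial 0 f)) x s + 3 * mom 4 (partial 0 f) x s + 3 * mom 5 f x s) / 4"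
    have n: "(1::nat) + 1 = 2" "(1::nat) + 2 = 3" "(2::nat) + 1 = 3" "(2::nat) + 2 = 4" "(3::nat) + 1 = 4" "(3::nat) + 2 = 5" by auto
    have d1: "(?a has_real_derivative ?a1 s) (at s)"
      using mom_DERIV_mass[OF f s0, of 1 x] unfolding n by simp
    have d2: "(?a1 has_real_derivative ?a2) (at s)"
      using DERIV_diff[OF DERIV_minus[OF DERIV_cdivide[OF mom_DERIV_mass[OF Cpc_partial[OF f, of 0] s0, of 2 x], of 2]]
           DERIV_cmult[OF mom_DERIV_mass[OF f s0, of 3 x], of "1/2"]]
      unfolding n by (rule DERIV_cong) (simp add: field_simps)
    have "((\<lambda>s. M * F0 (M * s) * ?a s - (s * Phi M s) * ?a1 s) has_real_derivative
       (- M * Phi M s / 4) * ?a s + ?a1 s * (M * F0 (M * s)) - ((M * F0 (M * s)) * ?a1 s + ?a2 * (s * Phi M s))) (at s)"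
      by (intro DERIV_diff DERIV_mult F0_mult_DERIV mult_Phi_DERIV d1 d2)
    also have "(- M * Phi M s / 4) * ?a s + ?a1 s * (M * F0 (M * s)) - ((M * F0 (M * s)) * ?a1 s + ?a2 * (s * Phi M s)) = ?I s / 4"
    proof -
      have "mom 1 (dalembert f) x s = - (4 * s * ?a2)"
        unfolding mom_dalembert[OF f s0] by (simp add: algebra_simps)
      then show ?thesis unfolding mh[OF less_imp_le[OF s0]] by (simp add: algebra_simps)
    qed
    also have "(\<lambda>s. M * F0 (M * s) * ?a s - (s * Phi M s) * ?a1 s) = ?E"
      by (auto simp: algebra_simps)
    finally show ?thesis by (simp add: has_real_derivative_iff_has_vector_derivative)
  qed
  have hi: "((\<lambda>s. ?I s / 4) has_integral (?E S - ?E 0)) {0..S}"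
    by (rule fundamental_theorem_of_calculus_interior[OF _ cE dE]) (use S in auto)
  have z: "mom k f x S = 0" "mom k (partial 0 f) x S = 0" for k
    using T[OF q S(1)] T'[OF q S(2)] by (auto intro: mom_eq_0)
  have ES: "?E S = 0" unfolding z by simp
  have "F0 0 = 1" 
    using powser_zero[of bessel_coeff] by (simp add: F0_def bessel_coeff_def)
  then have E0: "?E 0 = M * ?a 0" by simp
  have "(LINT s:{0..}|lborel. ?I s) = (LINT s:{0..S}|lborel. ?I s)"
    unfolding set_lebesgue_integral_def
  proof (rule Bochner_Integration.integral_cong[OF refl])
    fix s :: real
    have "mom 1 ?h x s = 0" if "s > S" using T''[OF q] S(3) that by (intro mom_eq_0) auto
    then show "indicat_real {0..} s *\<^sub>R ?I s = indicat_real {0..S} s *\<^sub>R ?I s"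
      by (cases "s > S") (auto simp: indicator_def)
  qed
  also have "\<dots> = integral {0..S} ?I"
    by (intro set_borel_integral_eq_integral borel_integrable_atLeastAtMost' continuous_intros continuous_on_Phi
        continuous_on_mom1_compose[OF h]) auto
  also have "\<dots> = 4 * (0 - M * ?a 0)"
    using integral_unique[OF has_integral_mult_right[OF hi, of 4]] unfolding ES E0 by simp
  finally have "(1 / 4) * (LINT s:{0..}|lborel. ?I s) = - M * ?a 0" by simp
  then have "Gk M ?h x = (1 / hypC) * (- mom 1 ?h x 0 + - M * ?a 0)" unfolding Gk_def by simp
  also have "\<dots> = f x" unfolding mh[OF order_refl] mom1_dalembert_at_0[OF f] using hypC_pos by simp
  finally show ?thesis .
qed

text \<open>Inherited from the left inverse, because \<open>Gk\<close> commutes with the wave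
  operator.\<close>

lemma Gk_right_inverse:
  assumes f: "f \<in> Cpc" shows "dalembert (Gk M f) x - M * Gk M f x = f x"
  using Gk_left_inverse[OF f, of M x] Gk_lincomb[OF Cpc_dalembert[OF f] f, of M 1 "- M" x]
  by (simp add: Gk_dalembert[OF f])

text \<open>The right inverse gives existence and the left inverse uniqueness in \<open>Cpc\<close>,
  so the description denotes and no energy estimate enters.\<close>

lemma Gret_eq_Gk:
  assumes f: "f \<in> Cpc" shows "Gret M f = Gk M f"
  unfolding Gret_def
proof (rule the_equality)
  show "Gk M f \<in> Cpc \<and> (\<forall>x. dalembert (Gk M f) x - M * Gk M f x = f x)"
    using Gk_Cpc[OF f] Gk_right_inverse[OF f] by blast
  fix u assume u: "u \<in> Cpc \<and> (\<forall>x. dalembert u x - M * u x = f x)"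
  then have "(\<lambda>x. dalembert u x - M * u x) = f" by blast
  then show "u = Gk M f" using Gk_left_inverse[of u M] u by auto
qed

section \<open>Dependence on the mass\<close>

lemma Gk_of_dalembert:
  assumes f: "f \<in> Cpc" shows "Gk M (dalembert f) x = f x + M * Gk M f x"
  using Gk_left_inverse[OF f, of M x] Gk_lincomb[OF Cpc_dalembert[OF f] f, of M 1 "- M" x] by simp

text \<open>Apply the left inverse of box - M to \<open>Gk N f\<close>, writing box - M = (box - N)
  + (N - M).\<close>

lemma Gk_resolvent:
  assumes f: "f \<in> Cpc" shows "(M - N) * Gk M (Gk N f) x = Gk M f x - Gk N f x"
proof -
  have g: "Gk N f \<in> Cpc" using f by (rule Gk_Cpc)
  have "Gk N f x = Gk M (\<lambda>x. dalembert (Gk N f) x - M * Gk N f x) x"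
    using Gk_left_inverse[OF g] by simp
  also have "(\<lambda>x. dalembert (Gk N f) x - M * Gk N f x) = (\<lambda>x. 1 * f x + (N - M) * Gk N f x)"
    using Gk_right_inverse[OF f, of N] by (auto simp: algebra_simps)
  also have "Gk M \<dots> x = 1 * Gk M f x + (N - M) * Gk M (Gk N f) x"
    by (rule Gk_lincomb[OF f g])
  finally show ?thesis by (simp add: algebra_simps)
qed

text \<open>The light-cone terms cancel and the Bessel tails are Lipschitz in the mass. Only
  averages of \<open>f\<close> enter, none of its derivatives.\<close>

lemma Gk_diff_bound:
  assumes f: "f \<in> Cpc" and m: "\<And>s. s \<ge> 0 \<Longrightarrow> \<bar>mom 1 f x s\<bar> \<le> m" "\<And>s. s > S \<Longrightarrow> mom 1 f x s = 0"
    and S: "S \<ge> 0" and C: "\<And>z. z \<ge> - (\<Gamma> * S) \<Longrightarrow> \<bar>F0 z\<bar> \<le> C" and G: "\<Gamma> \<ge> 0" "M \<ge> - \<Gamma>" "N \<ge> - \<Gamma>"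
  shows "\<bar>Gk M f x - Gk N f x\<bar> \<le> C * S * m / (4 * hypC) * \<bar>M - N\<bar>"
proof -
  let ?i = "\<lambda>M s. indicat_real {0..} s *\<^sub>R (Phi M s * mom 1 f x s)"
  have i: "integrable lborel (?i M)" for M
    using Gk_integrand_integrable[OF f] unfolding set_integrable_def by blast
  have "\<bar>(\<integral>s. ?i M s \<partial>lborel) - (\<integral>s. ?i N s \<partial>lborel)\<bar> = \<bar>\<integral>s. ?i M s - ?i N s \<partial>lborel\<bar>"
    using i by (simp only: Bochner_Integration.integral_diff)
  also have "\<dots> \<le> (\<integral>s. \<bar>?i M s - ?i N s\<bar> \<partial>lborel)" by (rule integral_abs_bound)
  also have "\<dots> \<le> (\<integral>s. indicat_real {0..S} s * (C * \<bar>M - N\<bar> * m) \<partial>lborel)"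
  proof (rule integral_mono)
    show "integrable lborel (\<lambda>s. \<bar>?i M s - ?i N s\<bar>)"
      using i by (intro integrable_abs Bochner_Integration.integrable_diff)
    show "integrable lborel (\<lambda>s. indicat_real {0..S} s * (C * \<bar>M - N\<bar> * m))"
      using S by (intro integrable_mult_left integrable_real_indicator) auto
    fix s :: real
    show "\<bar>?i M s - ?i N s\<bar> \<le> indicat_real {0..S} s * (C * \<bar>M - N\<bar> * m)"
    proof (cases "0 \<le> s \<and> s \<le> S")
      case True
      have "\<bar>?i M s - ?i N s\<bar> = \<bar>Phi M s - Phi N s\<bar> * \<bar>mom 1 f x s\<bar>"
        using True by (simp add: abs_mult[symmetric] left_diff_distrib)
      also have "\<dots> \<le> (C * \<bar>M - N\<bar>) * m"
        using Phi_lipschitz[OF C, of \<Gamma> S s M N] True G m(1)[of s]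
        by (intro mult_mono) (auto intro: order_trans[OF abs_ge_zero])
      finally show ?thesis using True by simp
    qed (use m(2)[of s] in \<open>auto simp: indicator_def\<close>)
  qed
  also have "\<dots> = S * (C * \<bar>M - N\<bar> * m)" using S by simp
  finally have *: "\<bar>(\<integral>s. ?i M s \<partial>lborel) - (\<integral>s. ?i N s \<partial>lborel)\<bar> \<le> S * (C * \<bar>M - N\<bar> * m)" .
  have "Gk M f x - Gk N f x = (1 / (4 * hypC)) * ((\<integral>s. ?i M s \<partial>lborel) - (\<integral>s. ?i N s \<partial>lborel))"
    unfolding Gk_def set_lebesgue_integral_def using hypC_pos by (simp add: field_simps)
  then have "\<bar>Gk M f x - Gk N f x\<bar> = (1 / (4 * hypC)) * \<bar>(\<integral>s. ?i M s \<partial>lborel) - (\<integral>s. ?i N s \<partial>lborel)\<bar>"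
    using hypC_pos by (simp only: abs_mult) simp
  also have "\<dots> \<le> (1 / (4 * hypC)) * (S * (C * \<bar>M - N\<bar> * m))"
    using * hypC_pos by (intro mult_left_mono) auto
  finally show ?thesis by (simp add: mult_ac)
qed

text \<open>By the resolvent identity the distance of the masses divides out of the difference
  bound. Equal masses are reached by continuity along \<open>N + 1 / real (Suc n)\<close>, from
  above so that the lower bound - \<Gamma> persists.\<close>

lemma Gk_Gk_bound:
  assumes f: "f \<in> Cpc" and m: "\<And>s. s \<ge> 0 \<Longrightarrow> \<bar>mom 1 f x s\<bar> \<le> m" "\<And>s. s > S \<Longrightarrow> mom 1 f x s = 0"
    and S: "S \<ge> 0" and C: "\<And>z. z \<ge> - (\<Gamma> * S) \<Longrightarrow> \<bar>F0 z\<bar> \<le> C" and G: "\<Gamma> \<ge> 0" "M \<ge> - \<Gamma>" "N \<ge> - \<Gamma>"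
  shows "\<bar>Gk M (Gk N f) x\<bar> \<le> C * S * m / (4 * hypC)"
proof -
  have neq: "\<bar>Gk M (Gk N f) x\<bar> \<le> C * S * m / (4 * hypC)" if "M \<ge> - \<Gamma>" "M \<noteq> N" for M
  proof -
    have "\<bar>M - N\<bar> * \<bar>Gk M (Gk N f) x\<bar> = \<bar>Gk M f x - Gk N f x\<bar>"
      unfolding Gk_resolvent[OF f, symmetric] by (simp add: abs_mult)
    also have "\<dots> \<le> C * S * m / (4 * hypC) * \<bar>M - N\<bar>"
      by (rule Gk_diff_bound[OF f m S C G(1) that(1) G(3)])
    finally have "\<bar>Gk M (Gk N f) x\<bar> * \<bar>M - N\<bar> \<le> C * S * m / (4 * hypC) * \<bar>M - N\<bar>"
      by (simp only: mult.commute[of "\<bar>Gk M (Gk N f) x\<bar>"])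
    then show ?thesis by (rule mult_right_le_imp_le) (use that(2) in simp)
  qed
  show ?thesis
  proof (cases "M = N")
    case True
    have "(\<lambda>n. Gk (N + 1 / real (Suc n)) (Gk N f) x) \<longlonglongrightarrow> Gk (N + 0) (Gk N f) x"
    proof (rule continuous_on_tendsto_compose[OF Gk_continuous_mass[OF Gk_Cpc[OF f], of UNIV]])
      show "(\<lambda>n. N + 1 / real (Suc n)) \<longlonglongrightarrow> N + 0"
        using LIMSEQ_inverse_real_of_nat by (intro tendsto_add tendsto_const) (simp add: inverse_eq_divide)
    qed auto
    then have "(\<lambda>n. \<bar>Gk (N + 1 / real (Suc n)) (Gk N f) x\<bar>) \<longlonglongrightarrow> \<bar>Gk M (Gk N f) x\<bar>"
      unfolding True by (intro tendsto_rabs) simp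
    moreover have "\<bar>Gk (N + 1 / real (Suc n)) (Gk N f) x\<bar> \<le> C * S * m / (4 * hypC)" for n
      using G(3) by (intro neq) (auto intro: add_increasing2)
    ultimately show ?thesis by (intro LIMSEQ_le_const2) auto
  qed (use neq G in auto)
qed

text \<open>Compare with mass 0, where \<open>Phi\<close> vanishes and only the light-cone term
  remains.\<close>

lemma Gk_linear_bound:
  assumes f: "f \<in> Cpc" and G: "\<Gamma> \<ge> 0"
  shows "\<exists>E\<ge>0. \<forall>x\<in>causal_past q. \<forall>M\<ge>-\<Gamma>. \<bar>Gk M f x\<bar> \<le> E * (1 + \<bar>M\<bar>)"
proof -
  obtain m T where m: "m \<ge> 0" "T > 0" "\<And>x s. x \<in> causal_past q \<Longrightarrow> s \<ge> 0 \<Longrightarrow> \<bar>mom 1 f x s\<bar> \<le> m"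
    "\<And>x s. x \<in> causal_past q \<Longrightarrow> s > T\<^sup>2 \<Longrightarrow> mom 1 f x s = 0" using mom1_uniform_bound[OF f, of q] by blast
  obtain C where C: "C \<ge> 0" "\<And>z. z \<ge> - (\<Gamma> * T\<^sup>2) \<Longrightarrow> \<bar>F0 z\<bar> \<le> C" using F0_bounded_below by blast
  define E where "E = m / hypC + C * T\<^sup>2 * m / (4 * hypC)"
  have E: "m / hypC \<le> E" "C * T\<^sup>2 * m / (4 * hypC) \<le> E" "E \<ge> 0" unfolding E_def using m C hypC_pos by auto
  have "\<bar>Gk M f x\<bar> \<le> E * (1 + \<bar>M\<bar>)" if x: "x \<in> causal_past q" and M: "M \<ge> -\<Gamma>" for x M
  proof -
    have "\<bar>Gk M f x - Gk 0 f x\<bar> \<le> C * T\<^sup>2 * m / (4 * hypC) * \<bar>M - 0\<bar>"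
      by (rule Gk_diff_bound[OF f m(3)[OF x] m(4)[OF x] _ C(2) G M]) (use G in auto)
    also have "\<dots> \<le> E * \<bar>M - 0\<bar>" by (rule mult_right_mono[OF E(2) abs_ge_zero])
    finally have "\<bar>Gk M f x - Gk 0 f x\<bar> \<le> E * \<bar>M\<bar>" by (simp only: diff_zero)
    moreover have "\<bar>Gk 0 f x\<bar> \<le> E"
    proof -
      have "Gk 0 f x = - (mom 1 f x 0 / hypC)" unfolding Gk_def by (simp add: set_lebesgue_integral_def)
      then have "\<bar>Gk 0 f x\<bar> = \<bar>mom 1 f x 0\<bar> / hypC" using hypC_pos by simp
      also have "\<dots> \<le> m / hypC" using m(3)[OF x order_refl] hypC_pos by (intro divide_right_mono) auto
      finally show ?thesis using E by linarith
    qed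
    ultimately show ?thesis by (simp add: distrib_left)
  qed
  then show ?thesis using E(3) by blast
qed

text \<open>Two steps of \<open>M G\<^sup>M f = G\<^sup>M (\<box> f) - f\<close> trade derivatives of \<open>f\<close> for decay in \<open>M\<close>.\<close>

lemma Gk_decay:
  assumes f: "f \<in> Cpc" and G: "\<Gamma> \<ge> 0"
  shows "\<exists>D\<ge>0. \<forall>x\<in>causal_past q. \<forall>M\<ge>-\<Gamma>. \<bar>Gk M f x\<bar> \<le> D / (1 + \<bar>M\<bar>)"
proof -
  have f1: "dalembert f \<in> Cpc" and f2: "dalembert (dalembert f) \<in> Cpc" using f by (auto intro: Cpc_dalembert)
  obtain E where E: "E \<ge> 0" "\<And>x M. x \<in> causal_past q \<Longrightarrow> M \<ge> -\<Gamma> \<Longrightarrow> \<bar>Gk M f x\<bar> \<le> E * (1 + \<bar>M\<bar>)"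
    using Gk_linear_bound[OF f G] by blast
  obtain E' where E': "E' \<ge> 0" "\<And>x M. x \<in> causal_past q \<Longrightarrow> M \<ge> -\<Gamma> \<Longrightarrow> \<bar>Gk M (dalembert (dalembert f)) x\<bar> \<le> E' * (1 + \<bar>M\<bar>)"
    using Gk_linear_bound[OF f2 G] by blast
  obtain b0 where b0: "b0 \<ge> 0" "\<And>x. x \<in> causal_past q \<Longrightarrow> \<bar>f x\<bar> \<le> b0" using Cpc_bounded[OF f] by blast
  obtain b1 where b1: "b1 \<ge> 0" "\<And>x. x \<in> causal_past q \<Longrightarrow> \<bar>dalembert f x\<bar> \<le> b1" using Cpc_bounded[OF f1] by blast
  define D where "D = E * (2 + \<Gamma>)\<^sup>2 + 2 * (b0 + b1 + 2 * E')"
  have "\<bar>Gk M f x\<bar> \<le> D / (1 + \<bar>M\<bar>)" if x: "x \<in> causal_past q" and M: "M \<ge> -\<Gamma>" for x M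
  proof (cases "M \<ge> 1")
    case True
    have "M * Gk M f x = Gk M (dalembert f) x - f x" using Gk_of_dalembert[OF f, of M x] by simp
    then have 1: "M * \<bar>Gk M f x\<bar> \<le> \<bar>Gk M (dalembert f) x\<bar> + b0"
      using b0(2)[OF x] True abs_mult[of M "Gk M f x"] by linarith
    have "M * Gk M (dalembert f) x = Gk M (dalembert (dalembert f)) x - dalembert f x"
      using Gk_of_dalembert[OF f1, of M x] by simp
    then have "M * \<bar>Gk M (dalembert f) x\<bar> \<le> \<bar>Gk M (dalembert (dalembert f)) x\<bar> + b1"
      using b1(2)[OF x] True abs_mult[of M "Gk M (dalembert f) x"] by linarith
    also have "\<dots> \<le> E' * (1 + M) + b1" using E'(2)[OF x M] True by simp
    also have "\<dots> \<le> E' * (2 * M) + b1 * M"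
      using E'(1) b1(1) True by (intro add_mono mult_left_mono) (auto simp: mult_le_cancel_left1)
    also have "\<dots> = M * (2 * E' + b1)" by (simp add: algebra_simps)
    finally have 2: "\<bar>Gk M (dalembert f) x\<bar> \<le> 2 * E' + b1" using True by simp
    have "(1 + \<bar>M\<bar>) * \<bar>Gk M f x\<bar> \<le> (2 * M) * \<bar>Gk M f x\<bar>" using True by (intro mult_right_mono) auto
    also have "\<dots> = 2 * (M * \<bar>Gk M f x\<bar>)" by simp
    also have "\<dots> \<le> 2 * ((2 * E' + b1) + b0)"
      by (intro mult_left_mono order_trans[OF 1 add_right_mono[OF 2]]) simp
    also have "\<dots> = 2 * (b0 + b1 + 2 * E')" by simp
    also have "\<dots> \<le> D" unfolding D_def using E(1) by simp
    finally show ?thesis using True by (simp add: pos_le_divide_eq mult.commute)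
  next
    case False
    then have a: "1 + \<bar>M\<bar> \<le> 2 + \<Gamma>" using M G by linarith
    have "\<bar>Gk M f x\<bar> * (1 + \<bar>M\<bar>) \<le> (E * (1 + \<bar>M\<bar>)) * (1 + \<bar>M\<bar>)"
      using E(2)[OF x M] by (intro mult_right_mono) auto
    also have "\<dots> = E * (1 + \<bar>M\<bar>)\<^sup>2" by (simp add: power2_eq_square)
    also have "\<dots> \<le> E * (2 + \<Gamma>)\<^sup>2" using a E(1) by (intro mult_left_mono power_mono) auto
    also have "\<dots> \<le> D" unfolding D_def using b0 b1 E' by simp
    finally show ?thesis by (simp add: pos_le_divide_eq add_pos_nonneg)
  qed
  moreover have "D \<ge> 0" unfolding D_def using E(1) E'(1) b0(1) b1(1) by simp
  ultimately show ?thesis by blast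
qed

section \<open>Superpositions of Green operators\<close>

text \<open>The superposition is parametrised by the real line through a mass function
  \<open>\<theta>\<close>, so that discrete masses can be included as intervals. Integrability
  against 1 / (1 + |mass|) matches \<open>Gk_decay\<close>; the lower bound - \<Gamma> keeps the
  Bessel factors under control.\<close>

locale mass_mixture =
  fixes w \<theta> :: "real \<Rightarrow> real" and \<Gamma> :: real
  assumes w_measurable [measurable]: "w \<in> borel_measurable borel"
    and \<theta>_measurable [measurable]: "\<theta> \<in> borel_measurable borel"
    and \<Gamma>_nonneg: "\<Gamma> \<ge> 0"
    and \<theta>_ge: "\<theta> \<tau> \<ge> - \<Gamma>"
    and integrable_weight: "integrable lborel (\<lambda>\<tau>. w \<tau> / (1 + \<bar>\<theta> \<tau>\<bar>))"
begin

definition mix :: "(pt \<Rightarrow> real) \<Rightarrow> pt \<Rightarrow> real" where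
  "mix f x = (\<integral>\<tau>. w \<tau> * Gk (\<theta> \<tau>) f x \<partial>lborel)"

lemma Gk_mass_measurable: "f \<in> Cpc \<Longrightarrow> (\<lambda>\<tau>. w \<tau> * Gk (\<theta> \<tau>) f x) \<in> borel_measurable lborel"
proof -
  assume f: "f \<in> Cpc"
  have [measurable]: "(\<lambda>M. Gk M f x) \<in> borel_measurable borel"
    by (rule borel_measurable_continuous_onI[OF Gk_continuous_mass[OF f]])
  show ?thesis by measurable
qed

lemma mix_dominated:
  assumes "f \<in> Cpc"
  obtains B where "integrable lborel B" "\<And>x \<tau>. x \<in> causal_past q \<Longrightarrow> \<bar>w \<tau> * Gk (\<theta> \<tau>) f x\<bar> \<le> B \<tau>"
proof -
  obtain D where D: "D \<ge> 0" "\<And>x M. x \<in> causal_past q \<Longrightarrow> M \<ge> -\<Gamma> \<Longrightarrow> \<bar>Gk M f x\<bar> \<le> D / (1 + \<bar>M\<bar>)"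
    using Gk_decay[OF assms \<Gamma>_nonneg] by blast
  show ?thesis
  proof (rule that[of "\<lambda>\<tau>. D * \<bar>w \<tau> / (1 + \<bar>\<theta> \<tau>\<bar>)\<bar>"])
    show "integrable lborel (\<lambda>\<tau>. D * \<bar>w \<tau> / (1 + \<bar>\<theta> \<tau>\<bar>)\<bar>)"
      by (intro integrable_mult_right integrable_abs integrable_weight)
    fix x \<tau> assume "x \<in> causal_past q"
    from D(2)[OF this \<theta>_ge] have "\<bar>w \<tau>\<bar> * \<bar>Gk (\<theta> \<tau>) f x\<bar> \<le> \<bar>w \<tau>\<bar> * (D / (1 + \<bar>\<theta> \<tau>\<bar>))"
      by (intro mult_left_mono) auto
    then show "\<bar>w \<tau> * Gk (\<theta> \<tau>) f x\<bar> \<le> D * \<bar>w \<tau> / (1 + \<bar>\<theta> \<tau>\<bar>)\<bar>"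
      by (simp add: abs_mult abs_divide mult.commute)
  qed
qed

lemma mix_integrable:
  assumes "f \<in> Cpc" shows "integrable lborel (\<lambda>\<tau>. w \<tau> * Gk (\<theta> \<tau>) f x)"
proof -
  obtain q where q: "x \<in> causal_past q" using in_some_causal_past by blast
  obtain B where B: "integrable lborel B" "\<And>x \<tau>. x \<in> causal_past q \<Longrightarrow> \<bar>w \<tau> * Gk (\<theta> \<tau>) f x\<bar> \<le> B \<tau>"
    by (rule mix_dominated[OF assms, of q]) blast
  show ?thesis
    by (rule Bochner_Integration.integrable_bound[OF B(1) Gk_mass_measurable[OF assms]])
       (use B(2)[OF q] in \<open>auto intro: order_trans[OF _ abs_ge_self]\<close>)
qed

lemma mix_lincomb:
  assumes "f \<in> Cpc" "g \<in> Cpc"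
  shows "mix (\<lambda>x. a * f x + b * g x) x = a * mix f x + b * mix g x"
proof -
  have "(\<lambda>\<tau>. w \<tau> * Gk (\<theta> \<tau>) (\<lambda>x. a * f x + b * g x) x) =
     (\<lambda>\<tau>. a * (w \<tau> * Gk (\<theta> \<tau>) f x) + b * (w \<tau> * Gk (\<theta> \<tau>) g x))"
    unfolding Gk_lincomb[OF assms] by (simp add: algebra_simps)
  then show ?thesis unfolding mix_def
    using mix_integrable[OF assms(1), of x] mix_integrable[OF assms(2), of x]
    by (simp only: Bochner_Integration.integral_add integrable_mult_right integral_mult_right_zero)
qed

lemma mix_continuous:
  assumes f: "f \<in> Cpc" shows "continuous_on UNIV (mix f)"
  unfolding mix_def[abs_def]
proof (rule continuous_on_integral_dominated)
  show "AE \<tau> in lborel. continuous_on UNIV (\<lambda>x. w \<tau> * Gk (\<theta> \<tau>) f x)"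
    by (intro AE_I2 continuous_intros Gk_continuous_space f)
  fix x
  obtain q where q: "ball x 1 \<subseteq> causal_past q" using nhds_causal_past by blast
  obtain B where B: "integrable lborel B" "\<And>x \<tau>. x \<in> causal_past q \<Longrightarrow> \<bar>w \<tau> * Gk (\<theta> \<tau>) f x\<bar> \<le> B \<tau>"
    by (rule mix_dominated[OF f, of q]) blast
  have "AE \<tau> in lborel. \<bar>w \<tau> * Gk (\<theta> \<tau>) f x'\<bar> \<le> B \<tau>" if "dist x' x < 1" for x'
  proof (intro AE_I2 B(2))
    have "x' \<in> ball x 1" using that by (simp add: dist_commute)
    then show "x' \<in> causal_past q" using q by blast
  qed
  then show "\<exists>r>0. \<exists>B. integrable lborel B \<and> (\<forall>x'\<in>UNIV. dist x' x < r \<longrightarrow> (AE \<tau> in lborel. \<bar>w \<tau> * Gk (\<theta> \<tau>) f x'\<bar> \<le> B \<tau>))"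
    using B(1) by (intro exI[of _ 1] conjI exI[of _ B]) auto
qed (rule Gk_mass_measurable[OF f])

lemma mix_DERIV:
  assumes f: "f \<in> Cpc"
  shows "((\<lambda>u. mix f (x + u *\<^sub>R axis i 1)) has_real_derivative mix (partial i f) (x + u *\<^sub>R axis i 1)) (at u)"
proof -
  let ?x = "\<lambda>u. x + u *\<^sub>R axis i (1::real)"
  have f': "partial i f \<in> Cpc" using f by (rule Cpc_partial)
  obtain q where near: "\<And>v. \<bar>v - u\<bar> < 1 \<Longrightarrow> ?x v \<in> causal_past q"
    using line_in_causal_past by blast
  obtain B where B: "integrable lborel B" "\<And>x \<tau>. x \<in> causal_past q \<Longrightarrow> \<bar>w \<tau> * Gk (\<theta> \<tau>) (partial i f) x\<bar> \<le> B \<tau>"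
    by (rule mix_dominated[OF f', of q]) blast
  show ?thesis unfolding mix_def
  proof (rule has_real_derivative_integral[where r = 1 and B = B])
    show "AE \<tau> in lborel. \<forall>v. \<bar>v - u\<bar> < 1 \<longrightarrow> ((\<lambda>v. w \<tau> * Gk (\<theta> \<tau>) f (?x v)) has_real_derivative
        w \<tau> * Gk (\<theta> \<tau>) (partial i f) (?x v)) (at v)"
      by (intro AE_I2 allI impI DERIV_cmult Gk_DERIV f)
    show "AE \<tau> in lborel. \<forall>v. \<bar>v - u\<bar> < 1 \<longrightarrow> \<bar>w \<tau> * Gk (\<theta> \<tau>) (partial i f) (?x v)\<bar> \<le> B \<tau>"
      using B(2) near by (intro AE_I2) blast
  qed (rule zero_less_one mix_integrable[OF f] Gk_mass_measurable[OF f'] B(1))+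
qed

lemma mix_support:
  assumes "mix f x \<noteq> 0" shows "x \<in> Jp (tsupp f)"
proof (rule ccontr)
  assume "x \<notin> Jp (tsupp f)"
  then have "Gk (\<theta> \<tau>) f x = 0" for \<tau> using Gk_support by blast
  then show False using assms unfolding mix_def by simp
qed

lemma mix_Cpc: "f \<in> Cpc \<Longrightarrow> mix f \<in> Cpc"
  and partial_mix: "f \<in> Cpc \<Longrightarrow> partial i (mix f) = mix (partial i f)"
  and tsupp_mix: "f \<in> Cpc \<Longrightarrow> tsupp (mix f) \<subseteq> Jp (tsupp f)"
  by (rule Cpc_operatorI[OF _ mix_continuous mix_DERIV mix_support]; assumption)+

lemma dalembert_mix:
  assumes f: "f \<in> Cpc" shows "dalembert (mix f) = mix (dalembert f)"
proof
  fix x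
  show "dalembert (mix f) x = mix (dalembert f) x"
    unfolding dalembert_altdef[of "mix f"] dalembert_altdef[of f]
    by (simp only: partial_mix f Cpc_partial mix_lincomb Cpc_lincomb)
qed

text \<open>Read off from uniqueness of the inverse rather than from interchanging integrals:
  \<open>mix (Gk M f)\<close> solves the equation that characterises
  \<open>Gk M (mix f)\<close>.\<close>

lemma Gk_mix:
  assumes f: "f \<in> Cpc" shows "Gk M (mix f) = mix (Gk M f)"
proof
  fix x
  let ?u = "mix (Gk M f)"
  have g: "Gk M f \<in> Cpc" using f by (rule Gk_Cpc)
  have "dalembert ?u x - M * ?u x = mix f x" for x
  proof -
    have "dalembert ?u x - M * ?u x = mix (\<lambda>x. 1 * dalembert (Gk M f) x + (- M) * Gk M f x) x"
      unfolding dalembert_mix[OF g] mix_lincomb[OF Cpc_dalembert[OF g] g] by simp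
    also have "(\<lambda>x. 1 * dalembert (Gk M f) x + (- M) * Gk M f x) = f"
      using Gk_right_inverse[OF f, of M] by auto
    finally show ?thesis .
  qed
  then have "(\<lambda>x. dalembert ?u x - M * ?u x) = mix f" by blast
  then show "Gk M (mix f) x = ?u x" using Gk_left_inverse[OF mix_Cpc[OF g], of M x] by simp
qed

end

section \<open>Exponential weights and the contraction\<close>

lemma exp_weighted_kernel_le:
  "\<bar>exp (- real n * norm y) * (indicat_real A y / norm y)\<bar> \<le> indicat_real A y / norm y"
proof -
  have nn: "0 \<le> indicat_real A y / norm y" by simp
  have "exp (- real n * norm y) \<le> 1" by simp
  from mult_left_le_one_le[OF nn exp_ge_zero this] show ?thesis
    by (simp only: abs_mult abs_exp_cancel abs_of_nonneg[OF nn])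
qed

text \<open>A large exponent makes the damped light-cone kernel small; dominated convergence
  suffices because no rate is asked for.\<close>

lemma exp_weighted_kernel_tendsto_0:
  "(\<lambda>n. \<integral>y. exp (- real n * norm y) * (indicat_real (cball (0::real^3) T) y / norm y) \<partial>lborel) \<longlonglongrightarrow> 0"
proof -
  have "(\<lambda>n. \<integral>y. exp (- real n * norm y) * (indicat_real (cball (0::real^3) T) y / norm y) \<partial>lborel)
     \<longlonglongrightarrow> (\<integral>y. (0::real) \<partial>(lborel :: (real^3) measure))"
  proof (rule integral_dominated_convergence[OF _ _ integrable_inverse_norm[of T]])
    show "(\<lambda>y. exp (- real n * norm y) * (indicat_real (cball (0::real^3) T) y / norm y)) \<in> borel_measurable lborel" for n
      by measurable
    show "AE y in lborel. norm (exp (- real n * norm y) * (indicat_real (cball (0::real^3) T) y / norm y)) \<le> indicat_real (cball 0 T) y / norm y" for n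
      unfolding real_norm_def by (intro AE_I2 exp_weighted_kernel_le)
    show "AE y in lborel. (\<lambda>n. exp (- real n * norm y) * (indicat_real (cball (0::real^3) T) y / norm y)) \<longlonglongrightarrow> 0"
      using AE_nonzero
    proof eventually_elim
      case (elim y)
      have "(\<lambda>n. exp (- norm y) ^ n) \<longlonglongrightarrow> 0" using elim by (intro LIMSEQ_realpow_zero) auto
      then have "(\<lambda>n. exp (- real n * norm y)) \<longlonglongrightarrow> 0" by (simp add: exp_of_nat_mult[symmetric])
      from tendsto_mult_right[OF this, of "indicat_real (cball 0 T) y / norm y"] show ?case by simp
    qed
  qed simp
  then show ?thesis by simp
qed

text \<open>The bound for two Green operators has no decay in the masses, so the bare weight must be
  integrable before \<open>mix\<close> applied twice can be estimated.\<close>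

locale finite_mass_mixture = mass_mixture +
  assumes w_integrable: "integrable lborel w"
begin

lemma mix_abs_le:
  assumes "f \<in> Cpc" "\<And>\<tau>. \<bar>Gk (\<theta> \<tau>) f x\<bar> \<le> c"
  shows "\<bar>mix f x\<bar> \<le> (\<integral>\<tau>. \<bar>w \<tau>\<bar> \<partial>lborel) * c"
proof -
  have "\<bar>mix f x\<bar> \<le> (\<integral>\<tau>. \<bar>w \<tau> * Gk (\<theta> \<tau>) f x\<bar> \<partial>lborel)"
    unfolding mix_def by (rule integral_abs_bound)
  also have "\<dots> \<le> (\<integral>\<tau>. \<bar>w \<tau>\<bar> * c \<partial>lborel)"
    by (intro integral_mono integrable_abs mix_integrable assms integrable_mult_left w_integrable)
       (auto simp: abs_mult intro!: mult_left_mono assms)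
  finally show ?thesis by (simp only: integral_mult_left_zero)
qed

text \<open>The time of \<open>x - shell s y\<close> lies at least \<open>norm y\<close> below that
  of \<open>x\<close>, so the exponential weight damps each hyperboloid average. The bound for two
  Green operators then yields a factor \<open>c * \<delta> n\<close>, made smaller than 1/2 by the
  choice of n; the exponent depends on \<open>K\<close> and \<open>q\<close>, not on
  \<open>f\<close>.\<close>

lemma mix_mix_contraction:
  assumes K: "past_compact K"
  shows "\<exists>\<alpha>\<ge>0. \<forall>f\<in>Cpc. tsupp f \<subseteq> K \<longrightarrow> (\<forall>N\<ge>0. (\<forall>y\<in>causal_past q. \<bar>f y\<bar> \<le> N * exp (\<alpha> * y $ 0)) \<longrightarrow>
      (\<forall>x\<in>causal_past q. \<bar>mix (mix f) x\<bar> \<le> N / 2 * exp (\<alpha> * x $ 0)))"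
proof -
  obtain T where T: "T > 0" "\<And>x s y. x \<in> causal_past q \<Longrightarrow> s \<ge> 0 \<Longrightarrow> x - shell s y \<in> K \<Longrightarrow> norm y \<le> T \<and> s \<le> T\<^sup>2"
    using shell_support_radius[OF K, of q] by blast
  obtain C where C: "C \<ge> 0" "\<And>z. z \<ge> - (\<Gamma> * T\<^sup>2) \<Longrightarrow> \<bar>F0 z\<bar> \<le> C" using F0_bounded_below by blast
  define W where "W = (\<integral>\<tau>. \<bar>w \<tau>\<bar> \<partial>lborel)"
  have W: "W \<ge> 0" unfolding W_def by (intro integral_nonneg_AE AE_I2) auto
  define \<delta> where "\<delta> n = (\<integral>y. exp (- real n * norm y) * (indicat_real (cball (0::real^3) T) y / norm y) \<partial>lborel)" for n
  define c where "c = W * (W * (C * T\<^sup>2 / (4 * hypC)))"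
  have "(\<lambda>n. c * \<delta> n) \<longlonglongrightarrow> c * 0"
    unfolding \<delta>_def by (intro tendsto_mult_left exp_weighted_kernel_tendsto_0)
  then have "eventually (\<lambda>n. c * \<delta> n < 1 / 2) sequentially" by (rule order_tendstoD) simp
  then obtain n where n: "c * \<delta> n < 1 / 2" by (meson eventually_sequentially order_refl)
  have "\<bar>mix (mix f) x\<bar> \<le> N / 2 * exp (real n * x $ 0)"
    if f: "f \<in> Cpc" "tsupp f \<subseteq> K" and N: "N \<ge> 0" "\<forall>y\<in>causal_past q. \<bar>f y\<bar> \<le> N * exp (real n * y $ 0)"
      and x: "x \<in> causal_past q" for f N x
  proof -
    define m where "m = N * exp (real n * x $ 0) * \<delta> n"
    have b: "\<bar>f (x - shell s y) / hyp s y ^ 1\<bar> \<le> N * exp (real n * x $ 0) * (exp (- real n * norm y) * (indicat_real (cball 0 T) y / norm y))"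
      if s: "s \<ge> 0" and y: "y \<noteq> 0" for s y
    proof (cases "f (x - shell s y) = 0")
      case False
      have yT: "norm y \<le> T" using T(2)[OF x s] in_tsupp[of f, OF False] f(2) by blast
      have "\<bar>f (x - shell s y)\<bar> \<le> N * exp (real n * (x - shell s y) $ 0)"
        using N(2) shell_in_causal_past[OF x s] by blast
      also have "(x - shell s y) $ 0 = x $ 0 - hyp s y" by (simp add: shell_nth)
      also have "N * exp (real n * (x $ 0 - hyp s y)) \<le> N * exp (real n * (x $ 0 - norm y))"
        using N(1) hyp_ge_norm[OF s, of y] by (intro mult_left_mono) (auto intro: mult_left_mono)
      also have "\<dots> = N * exp (real n * x $ 0) * exp (- real n * norm y)"
        by (simp add: exp_add[symmetric] right_diff_distrib mult.assoc)
      finally have "\<bar>f (x - shell s y)\<bar> / hyp s y \<le> (N * exp (real n * x $ 0) * exp (- real n * norm y)) / norm y"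
        using y hyp_ge_norm[OF s, of y] N(1) by (intro frac_le) auto
      then show ?thesis using yT hyp_nonneg[OF s, of y] by (simp add: abs_divide mult_ac)
    qed (use N in simp)
    have m1: "\<bar>mom 1 f x s\<bar> \<le> m" if s: "s \<ge> 0" for s
    proof -
      have "\<bar>mom 1 f x s\<bar> \<le> (\<integral>y. \<bar>f (x - shell s y) / hyp s y ^ 1\<bar> \<partial>lborel)"
        unfolding mom_def by (rule integral_abs_bound)
      also have "\<dots> \<le> (\<integral>y. N * exp (real n * x $ 0) * (exp (- real n * norm y) * (indicat_real (cball (0::real^3) T) y / norm y)) \<partial>lborel)"
      proof (rule Bochner_Integration.integral_mono_AE)
        show "AE y in lborel. \<bar>f (x - shell s y) / hyp s y ^ 1\<bar> \<le> N * exp (real n * x $ 0) * (exp (- real n * norm y) * (indicat_real (cball (0::real^3) T) y / norm y))"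
          using AE_nonzero by eventually_elim (rule b[OF s])
        have "integrable lborel (\<lambda>y. exp (- real n * norm y) * (indicat_real (cball (0::real^3) T) y / norm y))"
          by (rule Bochner_Integration.integrable_bound[OF integrable_inverse_norm[of T]])
             (measurable, use exp_weighted_kernel_le in \<open>auto simp only: real_norm_def intro!: AE_I2 intro: order_trans[OF _ abs_ge_self]\<close>)
        then show "integrable lborel (\<lambda>y. N * exp (real n * x $ 0) * (exp (- real n * norm y) * (indicat_real (cball (0::real^3) T) y / norm y)))"
          by (rule integrable_mult_right)
      qed (intro integrable_abs mom1_integrable[OF f(1) s])
      finally show ?thesis unfolding m_def \<delta>_def by (simp only: integral_mult_right_zero)
    qed
    have m2: "mom 1 f x s = 0" if "s > T\<^sup>2" for s
    proof (rule mom_eq_0, rule ccontr)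
      fix y assume "f (x - shell s y) \<noteq> 0"
      then have "x - shell s y \<in> K" using in_tsupp f(2) by blast
      moreover have "s \<ge> 0" using that zero_le_power2[of T] by linarith
      ultimately show False using T(2)[OF x, of s y] that by auto
    qed
    have "\<bar>Gk (\<theta> \<tau>') (Gk (\<theta> \<tau>) f) x\<bar> \<le> C * T\<^sup>2 * m / (4 * hypC)" for \<tau> \<tau>'
      by (rule Gk_Gk_bound[OF f(1) m1 m2 _ C(2) \<Gamma>_nonneg \<theta>_ge \<theta>_ge]) auto
    \<comment> \<open>One mass is integrated at a time. For the second, \<open>Gk_mix\<close>
      exchanges \<open>Gk\<close> of \<open>mix f\<close> for \<open>mix\<close> of
      \<open>Gk\<close>.\<close>
    then have "\<bar>mix (Gk (\<theta> \<tau>) f) x\<bar> \<le> W * (C * T\<^sup>2 * m / (4 * hypC))" for \<tau>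
      unfolding W_def by (intro mix_abs_le Gk_Cpc f)
    then have "\<bar>mix (mix f) x\<bar> \<le> W * (W * (C * T\<^sup>2 * m / (4 * hypC)))"
      unfolding W_def by (intro mix_abs_le mix_Cpc f) (simp add: Gk_mix f)
    also have "\<dots> = (c * \<delta> n) * (N * exp (real n * x $ 0))" unfolding c_def m_def by (simp add: mult_ac)
    also have "\<dots> \<le> (1 / 2) * (N * exp (real n * x $ 0))" using n N by (intro mult_right_mono) auto
    finally show ?thesis by simp
  qed
  then show ?thesis by (intro exI[of _ "real n"]) auto
qed

lemma mix_pow_Cpc: "f \<in> Cpc \<Longrightarrow> (mix ^^ n) f \<in> Cpc"
  by (induction n) (auto intro: mix_Cpc)

lemma tsupp_mix_pow:
  assumes f: "f \<in> Cpc" and K: "Jp K = K" "tsupp f \<subseteq> K"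
  shows "tsupp ((mix ^^ n) f) \<subseteq> K"
proof (induction n)
  case (Suc n)
  have "tsupp ((mix ^^ Suc n) f) \<subseteq> Jp (tsupp ((mix ^^ n) f))"
    using tsupp_mix[OF mix_pow_Cpc[OF f]] by simp
  also have "\<dots> \<subseteq> Jp K" by (rule Jp_mono[OF Suc])
  finally show ?case using K by simp
qed (use K in simp)

lemma partial_mix_pow: "f \<in> Cpc \<Longrightarrow> partial i ((mix ^^ n) f) = (mix ^^ n) (partial i f)"
  by (induction n) (auto simp: partial_mix mix_pow_Cpc)

lemma iter_partial_mix_pow: "f \<in> Cpc \<Longrightarrow> iter_partial ks ((mix ^^ n) f) = (mix ^^ n) (iter_partial ks f)"
  by (induction ks) (auto simp: partial_mix_pow Cpc_iter_partial)

text \<open>Two applications halve the weighted norm, so one application counts as a factor sqrt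
  (1/2).\<close>

definition ratio :: real where "ratio = sqrt (1 / 2)"

lemma ratio: "0 < ratio" "ratio < 1" "ratio * ratio = 1 / 2"
  unfolding ratio_def using real_sqrt_less_mono[of "1 / 2" 1] real_sqrt_mult_self[of "1 / 2"] by simp_all

text \<open>Only two consecutive factors of \<open>mix\<close> are bounded in the sup norm; a single one loses derivatives.\<close>

lemma mix_pow_geometric:
  assumes contr: "\<And>f N. f \<in> Cpc \<Longrightarrow> tsupp f \<subseteq> K \<Longrightarrow> N \<ge> 0 \<Longrightarrow> (\<And>y. y \<in> causal_past q \<Longrightarrow> \<bar>f y\<bar> \<le> N * exp (\<alpha> * y $ 0)) \<Longrightarrow>
      (\<And>x. x \<in> causal_past q \<Longrightarrow> \<bar>mix (mix f) x\<bar> \<le> N / 2 * exp (\<alpha> * x $ 0))"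
    and K: "past_compact K" "Jp K = K" and f: "f \<in> Cpc" "tsupp f \<subseteq> K"
  shows "\<exists>C\<ge>0. \<forall>n. \<forall>x\<in>causal_past q. \<bar>(mix ^^ n) f x\<bar> \<le> C * ratio ^ n * exp (\<alpha> * x $ 0)"
proof -
  have w: "\<exists>N\<ge>0. \<forall>y\<in>causal_past q. \<bar>g y\<bar> \<le> N * exp (\<alpha> * y $ 0)" if g: "g \<in> Cpc" for g
  proof -
    let ?L = "tsupp g \<inter> causal_past q"
    have "compact ?L" using Cpc_past_compact[OF g] by (simp add: past_compact_def)
    then have "compact ((\<lambda>y. g y * exp (- (\<alpha> * y $ 0))) ` ?L)"
      by (intro compact_continuous_image continuous_intros smooth_continuous Cpc_smooth g)
    then obtain N where N: "\<And>y. y \<in> ?L \<Longrightarrow> \<bar>g y * exp (- (\<alpha> * y $ 0))\<bar> \<le> N"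
      using compact_imp_bounded[of "(\<lambda>y. g y * exp (- (\<alpha> * y $ 0))) ` ?L"]
      unfolding bounded_iff by (metis (no_types, lifting) image_eqI real_norm_def)
    have "\<bar>g y\<bar> \<le> max 0 N * exp (\<alpha> * y $ 0)" if y: "y \<in> causal_past q" for y
    proof (cases "g y = 0")
      case False
      then have "\<bar>g y * exp (- (\<alpha> * y $ 0))\<bar> \<le> N" using N y in_tsupp by blast
      then have "\<bar>g y\<bar> \<le> N * exp (\<alpha> * y $ 0)" by (simp add: abs_mult exp_minus divide_simps)
      also have "\<dots> \<le> max 0 N * exp (\<alpha> * y $ 0)" by (intro mult_right_mono) auto
      finally show ?thesis .
    qed simp
    then show ?thesis by (intro exI[of _ "max 0 N"]) auto
  qed
  obtain A where A: "A \<ge> 0" "\<And>y. y \<in> causal_past q \<Longrightarrow> \<bar>f y\<bar> \<le> A * exp (\<alpha> * y $ 0)" using w[OF f(1)] by blast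
  obtain B where B: "B \<ge> 0" "\<And>y. y \<in> causal_past q \<Longrightarrow> \<bar>mix f y\<bar> \<le> B * exp (\<alpha> * y $ 0)" using w[OF mix_Cpc[OF f(1)]] by blast
  \<comment> \<open>Large enough for both starting values of the two-step induction, n = 0 and n =
    1.\<close>
  define C where "C = A + B / ratio"
  have C: "A \<le> C" "B \<le> C * ratio" "C \<ge> 0" unfolding C_def using A(1) B(1) ratio(1) by (simp_all add: distrib_right)
  have "\<forall>x\<in>causal_past q. \<bar>(mix ^^ n) f x\<bar> \<le> C * ratio ^ n * exp (\<alpha> * x $ 0)" for n
  proof (induction n rule: induct_nat_012)
    case 0
    show ?case
    proof
      fix x assume "x \<in> causal_past q"
      then have "\<bar>f x\<bar> \<le> A * exp (\<alpha> * x $ 0)" by (rule A)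
      also have "\<dots> \<le> C * exp (\<alpha> * x $ 0)" by (intro mult_right_mono C) simp
      finally show "\<bar>(mix ^^ 0) f x\<bar> \<le> C * ratio ^ 0 * exp (\<alpha> * x $ 0)" by simp
    qed
  next
    case 1
    show ?case
    proof
      fix x assume "x \<in> causal_past q"
      then have "\<bar>mix f x\<bar> \<le> B * exp (\<alpha> * x $ 0)" by (rule B)
      also have "\<dots> \<le> C * ratio * exp (\<alpha> * x $ 0)" by (intro mult_right_mono C) simp
      finally show "\<bar>(mix ^^ Suc 0) f x\<bar> \<le> C * ratio ^ Suc 0 * exp (\<alpha> * x $ 0)" by simp
    qed
  next
    case (ge2 n)
    have h: "\<bar>mix (mix ((mix ^^ n) f)) x\<bar> \<le> (C * ratio ^ n) / 2 * exp (\<alpha> * x $ 0)" if "x \<in> causal_past q" for x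
      by (rule contr[OF mix_pow_Cpc[OF f(1)] tsupp_mix_pow[OF f(1) K(2) f(2)] _ _ that])
         (use ge2 C ratio in auto)
    have eq: "C * ratio ^ Suc (Suc n) = (C * ratio ^ n) / 2"
    proof -
      have "C * ratio ^ Suc (Suc n) = (C * ratio ^ n) * (ratio * ratio)" by simp
      then show ?thesis unfolding ratio by simp
    qed
    show ?case unfolding eq using h by simp
  qed
  then show ?thesis using C(3) by blast
qed

end

section \<open>The Neumann series\<close>

context finite_mass_mixture
begin

lemma contraction_weight:
  assumes "past_compact K"
  obtains \<alpha> where "\<alpha> \<ge> 0" "\<And>f N x. f \<in> Cpc \<Longrightarrow> tsupp f \<subseteq> K \<Longrightarrow> N \<ge> 0 \<Longrightarrow>
      (\<And>y. y \<in> causal_past q \<Longrightarrow> \<bar>f y\<bar> \<le> N * exp (\<alpha> * y $ 0)) \<Longrightarrow> x \<in> causal_past q \<Longrightarrow>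
      \<bar>mix (mix f) x\<bar> \<le> N / 2 * exp (\<alpha> * x $ 0)"
  using mix_mix_contraction[OF assms, of q] by blast

lemma Jp_tsupp:
  assumes "f \<in> Cpc"
  shows "past_compact (Jp (tsupp f))" "Jp (Jp (tsupp f)) = Jp (tsupp f)" "tsupp f \<subseteq> Jp (tsupp f)"
  using past_compact_Jp[OF Cpc_past_compact[OF assms]] Jp_Jp Jp_superset by auto

text \<open>On a causal past the time is at most that of \<open>q\<close>, so with a nonnegative
  exponent the weight is absorbed into the constant.\<close>

lemma mix_pow_bound:
  assumes f: "f \<in> Cpc"
  shows "\<exists>C\<ge>0. \<forall>n. \<forall>x\<in>causal_past q. \<bar>(mix ^^ n) f x\<bar> \<le> C * ratio ^ n"
proof -
  note K = Jp_tsupp[OF f]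
  obtain \<alpha> where \<alpha>: "\<alpha> \<ge> 0" and
   c: "\<And>g N x. g \<in> Cpc \<Longrightarrow> tsupp g \<subseteq> Jp (tsupp f) \<Longrightarrow> N \<ge> 0 \<Longrightarrow>
      (\<And>y. y \<in> causal_past q \<Longrightarrow> \<bar>g y\<bar> \<le> N * exp (\<alpha> * y $ 0)) \<Longrightarrow> x \<in> causal_past q \<Longrightarrow>
      \<bar>mix (mix g) x\<bar> \<le> N / 2 * exp (\<alpha> * x $ 0)"
    by (rule contraction_weight[OF K(1), of q]) blast
  obtain C where C: "C \<ge> 0" "\<And>n x. x \<in> causal_past q \<Longrightarrow> \<bar>(mix ^^ n) f x\<bar> \<le> C * ratio ^ n * exp (\<alpha> * x $ 0)"
    using mix_pow_geometric[OF c K(1,2) f K(3)] by blast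
  have "\<bar>(mix ^^ n) f x\<bar> \<le> (C * exp (\<alpha> * q $ 0)) * ratio ^ n" if x: "x \<in> causal_past q" for n x
  proof -
    have "x $ 0 \<le> q $ 0" using Vp_time_nonneg[of "q - x"] x by (simp add: causal_past_iff)
    then have "exp (\<alpha> * x $ 0) \<le> exp (\<alpha> * q $ 0)" using \<alpha> by (simp add: mult_left_mono)
    then have "C * ratio ^ n * exp (\<alpha> * x $ 0) \<le> C * ratio ^ n * exp (\<alpha> * q $ 0)"
      using C(1) ratio by (intro mult_left_mono) auto
    from order_trans[OF C(2)[OF x] this] show ?thesis by (simp add: mult_ac)
  qed
  then show ?thesis using C(1) by (intro exI[of _ "C * exp (\<alpha> * q $ 0)"]) auto
qed

definition neumann :: "(pt \<Rightarrow> real) \<Rightarrow> pt \<Rightarrow> real" where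
  "neumann f x = (\<Sum>n. (-1) ^ n * (mix ^^ n) f x)"

lemma abs_neumann_term: "\<bar>(-1) ^ n * (a::real)\<bar> = \<bar>a\<bar>"
  by (simp add: abs_mult power_abs)

lemma summable_ratio: "summable (\<lambda>n. C * ratio ^ n)"
  using ratio by (intro summable_mult summable_geometric) simp

lemma neumann_summable:
  assumes "f \<in> Cpc" shows "summable (\<lambda>n. \<bar>(-1) ^ n * (mix ^^ n) f x\<bar>)"
proof -
  obtain q where q: "x \<in> causal_past q" using in_some_causal_past by blast
  obtain C where C: "C \<ge> 0" "\<And>n x. x \<in> causal_past q \<Longrightarrow> \<bar>(mix ^^ n) f x\<bar> \<le> C * ratio ^ n"
    using mix_pow_bound[OF assms] by blast
  show ?thesis
    by (rule summable_comparison_test'[OF summable_ratio[of C]]) (use C(2)[OF q] in \<open>simp add: abs_neumann_term\<close>)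
qed

text \<open>As an integral over the counting measure the series falls under the theorems on
  parameter integrals, which give continuity and termwise derivatives.\<close>

lemma neumann_integral:
  assumes "f \<in> Cpc"
  shows "integrable (count_space UNIV) (\<lambda>n. (-1) ^ n * (mix ^^ n) f x)"
    "neumann f x = (\<integral>n. (-1) ^ n * (mix ^^ n) f x \<partial>count_space UNIV)"
proof -
  show i: "integrable (count_space UNIV) (\<lambda>n. (-1) ^ n * (mix ^^ n) f x)"
    unfolding integrable_count_space_nat_iff real_norm_def by (rule neumann_summable[OF assms])
  show "neumann f x = (\<integral>n. (-1) ^ n * (mix ^^ n) f x \<partial>count_space UNIV)"
    unfolding neumann_def by (rule integral_count_space_nat[OF i, symmetric])
qed

lemma neumann_dominated:
  assumes "f \<in> Cpc"
  obtains B where "integrable (count_space UNIV) B" "\<And>n x. x \<in> causal_past q \<Longrightarrow> \<bar>(-1) ^ n * (mix ^^ n) f x\<bar> \<le> B n"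
proof -
  obtain C where C: "C \<ge> 0" "\<And>n x. x \<in> causal_past q \<Longrightarrow> \<bar>(mix ^^ n) f x\<bar> \<le> C * ratio ^ n"
    using mix_pow_bound[OF assms] by blast
  show ?thesis
  proof (rule that[of "\<lambda>n. C * ratio ^ n"])
    show "integrable (count_space UNIV) (\<lambda>n. C * ratio ^ n)"
      unfolding integrable_count_space_nat_iff using summable_ratio[of C] C(1) ratio by (simp add: abs_mult)
  qed (use C(2) in \<open>simp add: abs_neumann_term\<close>)
qed

lemma neumann_continuous:
  assumes f: "f \<in> Cpc" shows "continuous_on UNIV (neumann f)"
proof -
  have "continuous_on UNIV (\<lambda>x. \<integral>n. (-1) ^ n * (mix ^^ n) f x \<partial>count_space UNIV)"
  proof (rule continuous_on_integral_dominated)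
    show "AE n in count_space UNIV. continuous_on UNIV (\<lambda>x. (-1) ^ n * (mix ^^ n) f x)"
      by (intro AE_I2 continuous_intros smooth_continuous Cpc_smooth mix_pow_Cpc f)
    fix x
    obtain q where q: "ball x 1 \<subseteq> causal_past q" using nhds_causal_past by blast
    obtain B where B: "integrable (count_space UNIV) B" "\<And>n x. x \<in> causal_past q \<Longrightarrow> \<bar>(-1) ^ n * (mix ^^ n) f x\<bar> \<le> B n"
      by (rule neumann_dominated[OF f, of q]) blast
    have "AE n in count_space UNIV. \<bar>(-1) ^ n * (mix ^^ n) f x'\<bar> \<le> B n" if "dist x' x < 1" for x'
    proof (intro AE_I2 B(2))
      have "x' \<in> ball x 1" using that by (simp add: dist_commute)
      then show "x' \<in> causal_past q" using q by blast
    qed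
    then show "\<exists>r>0. \<exists>B. integrable (count_space UNIV) B \<and> (\<forall>x'\<in>UNIV. dist x' x < r \<longrightarrow>
        (AE n in count_space UNIV. \<bar>(-1) ^ n * (mix ^^ n) f x'\<bar> \<le> B n))"
      using B(1) by (intro exI[of _ 1] conjI exI[of _ B]) auto
  qed simp
  then show ?thesis by (simp only: neumann_integral(2)[OF f, symmetric])
qed

lemma neumann_DERIV:
  assumes f: "f \<in> Cpc"
  shows "((\<lambda>u. neumann f (x + u *\<^sub>R axis i 1)) has_real_derivative neumann (partial i f) (x + u *\<^sub>R axis i 1)) (at u)"
proof -
  let ?x = "\<lambda>u. x + u *\<^sub>R axis i (1::real)"
  have f': "partial i f \<in> Cpc" using f by (rule Cpc_partial)
  obtain q where near: "\<And>v. \<bar>v - u\<bar> < 1 \<Longrightarrow> ?x v \<in> causal_past q"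
    using line_in_causal_past by blast
  obtain B where B: "integrable (count_space UNIV) B" "\<And>n x. x \<in> causal_past q \<Longrightarrow> \<bar>(-1) ^ n * (mix ^^ n) (partial i f) x\<bar> \<le> B n"
    by (rule neumann_dominated[OF f', of q]) blast
  show ?thesis unfolding neumann_integral(2)[OF f] neumann_integral(2)[OF f']
  proof (rule has_real_derivative_integral[where r = 1 and B = B])
    show "AE n in count_space UNIV. \<forall>v. \<bar>v - u\<bar> < 1 \<longrightarrow> ((\<lambda>v. (-1) ^ n * (mix ^^ n) f (?x v)) has_real_derivative
        (-1) ^ n * (mix ^^ n) (partial i f) (?x v)) (at v)"
      unfolding partial_mix_pow[OF f, symmetric]
      by (intro AE_I2 allI impI DERIV_cmult smooth_DERIV Cpc_smooth mix_pow_Cpc f)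
    show "AE n in count_space UNIV. \<forall>v. \<bar>v - u\<bar> < 1 \<longrightarrow> \<bar>(-1) ^ n * (mix ^^ n) (partial i f) (?x v)\<bar> \<le> B n"
      using B(2) near by (intro AE_I2) blast
  qed (rule zero_less_one neumann_integral(1)[OF f] B(1) borel_measurable_count_space)+
qed

lemma neumann_support:
  assumes "f \<in> Cpc" "neumann f x \<noteq> 0" shows "x \<in> Jp (tsupp f)"
proof (rule ccontr)
  assume "x \<notin> Jp (tsupp f)"
  then have "(mix ^^ n) f x = 0" for n
    using tsupp_mix_pow[OF assms(1) Jp_tsupp(2,3)[OF assms(1)], of n] in_tsupp[of "(mix ^^ n) f" x] by blast
  then show False using assms unfolding neumann_def by simp
qed

lemma neumann_Cpc: "f \<in> Cpc \<Longrightarrow> neumann f \<in> Cpc"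
  and tsupp_neumann: "f \<in> Cpc \<Longrightarrow> tsupp (neumann f) \<subseteq> Jp (tsupp f)"
  by (rule Cpc_operatorI[OF _ neumann_continuous neumann_DERIV neumann_support]; assumption)+

text \<open>Two terms are split off at once, since only \<open>mix\<close> applied twice is
  estimated. The factors 1 match the shape of \<open>mix_lincomb\<close>.\<close>

lemma neumann_split:
  assumes f: "f \<in> Cpc"
  shows "neumann f = (\<lambda>x. 1 * (1 * f x + (-1) * mix f x) + 1 * neumann (mix (mix f)) x)"
proof
  fix x
  have s: "summable (\<lambda>n. (-1) ^ n * (mix ^^ n) f x)"
    by (rule summable_rabs_cancel[OF neumann_summable[OF f]])
  have "(mix ^^ (n + 2)) f = (mix ^^ n) (mix (mix f))" for n
    by (simp add: funpow_add numeral_2_eq_2 funpow_swap1)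
  then have "(\<Sum>n. (-1) ^ (n + 2) * (mix ^^ (n + 2)) f x) = neumann (mix (mix f)) x"
    unfolding neumann_def by (simp add: power_add)
  moreover have "(\<Sum>i<2. (-1) ^ i * (mix ^^ i) f x) = f x - mix f x" by (simp add: numeral_2_eq_2)
  ultimately show "neumann f x = 1 * (1 * f x + (-1) * mix f x) + 1 * neumann (mix (mix f)) x"
    unfolding neumann_def[of f] using suminf_split_initial_segment[OF s, of 2] by simp
qed

lemma neumann_abs_le:
  assumes f: "f \<in> Cpc" and C: "\<And>n. \<bar>(mix ^^ n) f x\<bar> \<le> C * ratio ^ n * e"
  shows "\<bar>neumann f x\<bar> \<le> C / (1 - ratio) * e"
proof -
  have s: "summable (\<lambda>n. \<bar>(-1) ^ n * (mix ^^ n) f x\<bar>)" by (rule neumann_summable[OF f])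
  have "\<bar>neumann f x\<bar> \<le> (\<Sum>n. \<bar>(-1) ^ n * (mix ^^ n) f x\<bar>)"
    unfolding neumann_def by (rule summable_rabs[OF s])
  also have "\<dots> \<le> (\<Sum>n. (C * e) * ratio ^ n)"
    by (rule suminf_le[OF _ s summable_ratio]) (use C in \<open>simp add: abs_neumann_term mult_ac\<close>)
  also have "\<dots> = (C * e) * (1 / (1 - ratio))"
    using ratio by (subst suminf_mult) (auto simp: suminf_geometric summable_geometric)
  finally show ?thesis by simp
qed

lemma mix_mix_lincomb:
  assumes "f \<in> Cpc" "g \<in> Cpc"
  shows "mix (mix (\<lambda>x. a * f x + b * g x)) x = a * mix (mix f) x + b * mix (mix g) x"
proof -
  have "mix (\<lambda>x. a * f x + b * g x) = (\<lambda>x. a * mix f x + b * mix g x)" using mix_lincomb[OF assms] by blast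
  then show ?thesis using mix_lincomb[OF mix_Cpc[OF assms(1)] mix_Cpc[OF assms(2)]] by simp
qed

lemma geometric_imp_0:
  assumes "\<And>k. \<bar>a :: real\<bar> \<le> B * (1 / 2) ^ k" shows "a = 0"
proof -
  have "(\<lambda>k. B * (1 / 2 :: real) ^ k) \<longlonglongrightarrow> B * 0"
    by (intro tendsto_mult_left LIMSEQ_realpow_zero) auto
  then have "\<bar>a\<bar> \<le> B * 0" using assms by (intro LIMSEQ_le_const) auto
  then show ?thesis by simp
qed

lemma ratio_even_power: "ratio ^ (2 * k) = (1 / 2) ^ k"
  unfolding power_mult power2_eq_square ratio ..

lemma mix_pow_even_add: "(mix ^^ (2 * k + n)) f = (mix ^^ n) ((mix ^^ (2 * k)) f)"
  by (simp add: add.commute[of _ n] funpow_add)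

text \<open>The defect \<open>mix (mix (neumann f)) - neumann (mix (mix f))\<close> does not change when \<open>f\<close> is
  replaced by \<open>mix (mix f)\<close>, and it tends to zero along the iterates.\<close>

lemma mix_mix_neumann:
  assumes f: "f \<in> Cpc"
  shows "mix (mix (neumann f)) x = neumann (mix (mix f)) x"
proof -
  define d where "d g = mix (mix (neumann g)) x - neumann (mix (mix g)) x" for g
  have step: "d g = d (mix (mix g))" if g: "g \<in> Cpc" for g
  proof -
    let ?g1 = "mix (mix g)"
    have c: "mix g \<in> Cpc" "?g1 \<in> Cpc" "neumann ?g1 \<in> Cpc" using g by (auto intro: mix_Cpc neumann_Cpc)
    have "mix (mix (neumann g)) x = 1 * mix (mix (\<lambda>x. 1 * g x + (-1) * mix g x)) x + 1 * mix (mix (neumann ?g1)) x"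
      by (subst neumann_split[OF g]) (rule mix_mix_lincomb[OF Cpc_lincomb[OF g c(1)] c(3)])
    also have "mix (mix (\<lambda>x. 1 * g x + (-1) * mix g x)) x = 1 * ?g1 x + (-1) * mix ?g1 x"
      by (rule mix_mix_lincomb[OF g c(1)])
    finally have "mix (mix (neumann g)) x = ?g1 x - mix ?g1 x + mix (mix (neumann ?g1)) x" by simp
    moreover have "neumann ?g1 x = ?g1 x - mix ?g1 x + neumann (mix (mix ?g1)) x"
      by (subst neumann_split[OF c(2)]) simp
    ultimately show ?thesis unfolding d_def by simp
  qed
  have dk: "d f = d ((mix ^^ (2 * k)) f)" for k
  proof (induction k)
    case (Suc k)
    have "(mix ^^ (2 * Suc k)) f = mix (mix ((mix ^^ (2 * k)) f))" by simp
    then show ?case using Suc step[OF mix_pow_Cpc[OF f, of "2 * k"]] by simp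
  qed simp
  obtain q where q: "x \<in> causal_past q" using in_some_causal_past by blast
  note K = Jp_tsupp[OF f]
  obtain \<alpha> where \<alpha>: "\<alpha> \<ge> 0" and
   c: "\<And>g N x. g \<in> Cpc \<Longrightarrow> tsupp g \<subseteq> Jp (tsupp f) \<Longrightarrow> N \<ge> 0 \<Longrightarrow>
      (\<And>y. y \<in> causal_past q \<Longrightarrow> \<bar>g y\<bar> \<le> N * exp (\<alpha> * y $ 0)) \<Longrightarrow> x \<in> causal_past q \<Longrightarrow>
      \<bar>mix (mix g) x\<bar> \<le> N / 2 * exp (\<alpha> * x $ 0)"
    by (rule contraction_weight[OF K(1), of q]) blast
  obtain C where C: "C \<ge> 0" "\<And>n x. x \<in> causal_past q \<Longrightarrow> \<bar>(mix ^^ n) f x\<bar> \<le> C * ratio ^ n * exp (\<alpha> * x $ 0)"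
    using mix_pow_geometric[OF c K(1,2) f K(3)] by blast
  have nb: "\<bar>neumann ((mix ^^ (2 * k)) f) y\<bar> \<le> C * (1 / 2) ^ k / (1 - ratio) * exp (\<alpha> * y $ 0)"
    if y: "y \<in> causal_past q" for k y
  proof (rule neumann_abs_le[OF mix_pow_Cpc[OF f]])
    fix n
    have "\<bar>(mix ^^ (2 * k + n)) f y\<bar> \<le> C * ratio ^ (2 * k + n) * exp (\<alpha> * y $ 0)" by (rule C(2)[OF y])
    then show "\<bar>(mix ^^ n) ((mix ^^ (2 * k)) f) y\<bar> \<le> C * (1 / 2) ^ k * ratio ^ n * exp (\<alpha> * y $ 0)"
      unfolding mix_pow_even_add power_add ratio_even_power by (simp add: mult.assoc)
  qed
  have "\<bar>d f\<bar> \<le> (2 * C / (1 - ratio) * exp (\<alpha> * x $ 0)) * (1 / 2) ^ k" for k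
  proof -
    let ?g = "(mix ^^ (2 * k)) f"
    define A where "A = C * (1 / 2) ^ k / (1 - ratio)"
    have A: "A \<ge> 0" unfolding A_def using C(1) ratio by simp
    have sub: "tsupp (neumann ?g) \<subseteq> Jp (tsupp f)"
    proof -
      have "tsupp (neumann ?g) \<subseteq> Jp (tsupp ?g)" by (rule tsupp_neumann[OF mix_pow_Cpc[OF f]])
      also have "\<dots> \<subseteq> Jp (Jp (tsupp f))" by (intro Jp_mono tsupp_mix_pow[OF f K(2,3)])
      finally show ?thesis using K(2) by simp
    qed
    have 1: "\<bar>mix (mix (neumann ?g)) x\<bar> \<le> A / 2 * exp (\<alpha> * x $ 0)"
      by (rule c[OF neumann_Cpc[OF mix_pow_Cpc[OF f]] sub A _ q]) (use nb in \<open>simp add: A_def\<close>)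
    have "mix (mix ?g) = (mix ^^ (2 * Suc k)) f" by simp
    then have "\<bar>neumann (mix (mix ?g)) x\<bar> \<le> C * (1 / 2) ^ Suc k / (1 - ratio) * exp (\<alpha> * x $ 0)"
      using nb[OF q, of "Suc k"] by (simp only:)
    then have 2: "\<bar>neumann (mix (mix ?g)) x\<bar> \<le> A / 2 * exp (\<alpha> * x $ 0)" unfolding A_def by (simp add: algebra_simps)
    have "\<bar>d f\<bar> \<le> \<bar>mix (mix (neumann ?g)) x\<bar> + \<bar>neumann (mix (mix ?g)) x\<bar>"
      unfolding dk[of k] unfolding d_def by (rule abs_triangle_ineq4)
    also have "\<dots> \<le> A * exp (\<alpha> * x $ 0)" using 1 2 by simp
    also have "\<dots> \<le> (2 * A) * exp (\<alpha> * x $ 0)" using A by (intro mult_right_mono) auto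
    finally show ?thesis unfolding A_def by (simp add: mult_ac)
  qed
  then have "d f = 0" by (rule geometric_imp_0)
  then show ?thesis unfolding d_def by simp
qed

text \<open>A fixed point equals all its even iterates, which decay geometrically.\<close>

lemma mix_mix_fixed_point_eq_0:
  assumes d: "d \<in> Cpc" "mix (mix d) = d" shows "d x = 0"
proof -
  obtain q where q: "x \<in> causal_past q" using in_some_causal_past by blast
  obtain C where C: "C \<ge> 0" "\<And>n x. x \<in> causal_past q \<Longrightarrow> \<bar>(mix ^^ n) d x\<bar> \<le> C * ratio ^ n"
    using mix_pow_bound[OF d(1)] by blast
  have "(mix ^^ (2 * k)) d = d" for k by (induction k) (auto simp: d(2))
  then have "\<bar>d x\<bar> \<le> C * (1 / 2) ^ k" for k using C(2)[OF q, of "2 * k"] by (simp add: ratio_even_power)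
  then show ?thesis by (rule geometric_imp_0)
qed

text \<open>Commuting the square of \<open>mix\<close> with the series and splitting off two terms
  shows that the defect e satisfies \<open>mix e = e\<close>. It is thus a fixed point of the square
  and vanishes; \<open>mix\<close> is never applied to the series term by term.\<close>

lemma neumann_solves:
  assumes S: "S \<in> Cpc" shows "neumann S x + mix (neumann S) x = S x"
proof -
  define e where "e = (\<lambda>x. 1 * (1 * neumann S x + 1 * mix (neumann S) x) + (-1) * S x)"
  have c1: "neumann S \<in> Cpc" using S by (rule neumann_Cpc)
  have c2: "mix (neumann S) \<in> Cpc" using c1 by (rule mix_Cpc)
  note c = c1 c2 Cpc_lincomb[OF c1 c2, of 1 1]
  have e: "e \<in> Cpc" unfolding e_def by (rule Cpc_lincomb[OF c(3) S])
  have "mix e x = e x" for x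
  proof -
    have "mix e x = 1 * (1 * mix (neumann S) x + 1 * mix (mix (neumann S)) x) + (-1) * mix S x"
      unfolding e_def mix_lincomb[OF c(3) S] mix_lincomb[OF c(1,2)] ..
    also have "\<dots> = e x"
      unfolding e_def mix_mix_neumann[OF S] using fun_cong[OF neumann_split[OF S], of x] by simp
    finally show ?thesis .
  qed
  then have "mix e = e" by (rule ext)
  then have "mix (mix e) = e" by simp
  from mix_mix_fixed_point_eq_0[OF e this, of x] show ?thesis unfolding e_def by simp
qed

text \<open>The difference d of two solutions satisfies \<open>mix d = - d\<close>, hence is fixed
  by the square of \<open>mix\<close>.\<close>

lemma neumann_unique:
  assumes S: "S \<in> Cpc" and \<psi>: "\<psi> \<in> Cpc" "\<And>x. \<psi> x + mix \<psi> x = S x"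
  shows "\<psi> = neumann S"
proof
  fix x
  define d where "d = (\<lambda>x. 1 * \<psi> x + (-1) * neumann S x)"
  have d: "d \<in> Cpc" unfolding d_def by (rule Cpc_lincomb[OF \<psi>(1) neumann_Cpc[OF S]])
  have m: "mix d = (\<lambda>x. (-1) * d x + 0 * d x)"
  proof
    fix x
    have "mix d x = 1 * mix \<psi> x + (-1) * mix (neumann S) x"
      unfolding d_def by (rule mix_lincomb[OF \<psi>(1) neumann_Cpc[OF S]])
    then show "mix d x = (-1) * d x + 0 * d x"
      unfolding d_def using \<psi>(2)[of x] neumann_solves[OF S, of x] by simp
  qed
  have "mix (mix d) = d"
  proof
    fix x
    have "mix (mix d) x = (-1) * mix d x + 0 * mix d x" by (subst m) (rule mix_lincomb[OF d d])
    then show "mix (mix d) x = d x" using fun_cong[OF m, of x] by simp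
  qed
  from mix_mix_fixed_point_eq_0[OF d this, of x] show "\<psi> x = neumann S x" unfolding d_def by simp
qed

text \<open>Derivatives commute with \<open>mix\<close>, so each seminorm of the terms is a sup
  bound on the iterates of a derivative of \<open>S\<close>, with the same ratio.\<close>

lemma neumann_abs_conv:
  assumes S: "S \<in> Cpc" shows "abs_conv_Cpc (\<lambda>n x. (-1) ^ n * (mix ^^ n) S x)"
  unfolding abs_conv_Cpc_def
proof (intro exI[of _ "Jp (tsupp S)"] conjI allI impI)
  note K = Jp_tsupp[OF S]
  show "past_compact (Jp (tsupp S))" by (rule K)
  show "(\<lambda>x. (-1) ^ n * (mix ^^ n) S x) \<in> Cpc" for n by (intro Cpc_cmult mix_pow_Cpc S)
  show "tsupp (\<lambda>x. (-1) ^ n * (mix ^^ n) S x) \<subseteq> Jp (tsupp S)" for n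
    using tsupp_mix_pow[OF S K(2,3), of n] in_tsupp[of "(mix ^^ n) S"]
    by (intro tsupp_subsetI past_compact_closed K) auto
  fix ks :: "4 list" and R :: real assume R: "R > 0"
  have S': "iter_partial ks S \<in> Cpc" using S by (rule Cpc_iter_partial)
  obtain q where q: "cball 0 R \<subseteq> causal_past q" using cball_subset_causal_past by blast
  obtain C where C: "C \<ge> 0" "\<And>n x. x \<in> causal_past q \<Longrightarrow> \<bar>(mix ^^ n) (iter_partial ks S) x\<bar> \<le> C * ratio ^ n"
    using mix_pow_bound[OF S'] by blast
  have b: "\<bar>iter_partial ks (\<lambda>x. (-1) ^ n * (mix ^^ n) S x) x\<bar> \<le> C * ratio ^ n" if "x \<in> cball 0 R" for n x
    unfolding iter_partial_cmult[OF Cpc_smooth[OF mix_pow_Cpc[OF S]]] iter_partial_mix_pow[OF S] abs_neumann_term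
    using C(2) q that by blast
  show "summable (\<lambda>n. SUP x\<in>cball 0 R. \<bar>iter_partial ks (\<lambda>x. (-1) ^ n * (mix ^^ n) S x) x\<bar>)"
  proof (rule summable_comparison_test'[OF summable_ratio[of C]])
    fix n
    let ?f = "\<lambda>x. \<bar>iter_partial ks (\<lambda>x. (-1) ^ n * (mix ^^ n) S x) x\<bar>"
    have z: "(0::pt) \<in> cball 0 R" using R by simp
    have "bdd_above (?f ` cball 0 R)" using b by (intro bdd_aboveI2)
    then have "0 \<le> (SUP x\<in>cball 0 R. ?f x)" by (intro cSUP_upper2[OF _ z]) auto
    moreover have "(SUP x\<in>cball 0 R. ?f x) \<le> C * ratio ^ n" using b z by (intro cSUP_least) auto
    ultimately show "norm (SUP x\<in>cball 0 R. ?f x) \<le> C * ratio ^ n" by simp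
  qed
qed

end

section \<open>The spectral weight\<close>

lemma set_integral_FTC_atLeast:
  fixes f :: "real \<Rightarrow> real"
  assumes f: "f \<in> borel_measurable borel" and F: "\<And>x. b \<le> x \<Longrightarrow> (F has_real_derivative f x) (at x)"
    and nonneg: "\<And>x. b \<le> x \<Longrightarrow> 0 \<le> f x" and lim: "(F \<longlongrightarrow> T) at_top"
  shows "set_integrable lborel {b..} f" "(LINT x:{b..}|lborel. f x) = T - F b"
proof -
  have mono: "F b \<le> F x" if "b \<le> x" for x
    by (rule DERIV_nonneg_imp_nondecreasing[OF that]) (use F nonneg in blast)
  have "F b \<le> T"
    by (rule tendsto_lowerbound[OF lim]) (auto intro!: eventually_at_top_linorderI[of b] mono)
  moreover have "(\<integral>\<^sup>+x. ennreal (indicat_real {b..} x *\<^sub>R f x) \<partial>lborel) = (\<integral>\<^sup>+x. ennreal (f x) * indicator {b..} x \<partial>lborel)"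
    by (intro nn_integral_cong) (auto simp: indicator_def)
  moreover have "(\<integral>\<^sup>+x. ennreal (f x) * indicator {b..} x \<partial>lborel) = T - F b"
    by (rule nn_integral_FTC_atLeast[OF f F nonneg lim])
  ultimately have "has_bochner_integral lborel (\<lambda>x. indicat_real {b..} x *\<^sub>R f x) (T - F b)"
    using f nonneg by (intro has_bochner_integral_nn_integral) (auto simp: indicator_def)
  then show "set_integrable lborel {b..} f" "(LINT x:{b..}|lborel. f x) = T - F b"
    unfolding set_integrable_def set_lebesgue_integral_def by (auto simp: has_bochner_integral_iff)
qed

lemma set_integral_cmult:
  fixes f :: "'a \<Rightarrow> real"
  shows "(LINT x:A|N. a * f x) = a * (LINT x:A|N. f x)"
  unfolding set_lebesgue_integral_def
  by (subst integral_mult_right_zero[symmetric]) (simp add: mult_ac)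

lemma integrable_has_integral_nonneg:
  fixes f :: "real \<Rightarrow> real"
  assumes "f \<in> borel_measurable borel" "\<And>x. 0 \<le> f x" "(f has_integral I) UNIV"
  shows "integrable lborel f"
  using nn_integral_has_integral_lborel[OF assms] assms by (intro integrableI_nonneg) auto

text \<open>With r the value at \<open>a\<close>, M - p = (M - a) + r (a - q), so the quotient lies
  between r and its limit 1.\<close>

lemma shifted_quotient_bounds:
  fixes p q a :: real
  assumes "p < a" "q < a"
  shows "\<exists>k>0. \<exists>K>0. \<forall>M\<ge>a. k \<le> (M - p) / (M - q) \<and> (M - p) / (M - q) \<le> K"
proof -
  define r where "r = (a - p) / (a - q)"
  have r: "r > 0" "r * (a - q) = a - p" using assms by (auto simp: r_def)
  have "min 1 r \<le> (M - p) / (M - q) \<and> (M - p) / (M - q) \<le> max 1 r" if M: "M \<ge> a" for M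
  proof -
    have pos: "M - q > 0" using M assms by linarith
    have "min 1 r * (M - q) = min 1 r * (M - a) + min 1 r * (a - q)" by (simp add: algebra_simps)
    also have "\<dots> \<le> 1 * (M - a) + r * (a - q)" using M assms by (intro add_mono mult_right_mono) auto
    finally have 1: "min 1 r * (M - q) \<le> M - p" using r(2) by simp
    have "M - p = 1 * (M - a) + r * (a - q)" using r(2) by simp
    also have "\<dots> \<le> max 1 r * (M - a) + max 1 r * (a - q)" using M assms by (intro add_mono mult_right_mono) auto
    finally have 2: "M - p \<le> max 1 r * (M - q)" by (simp add: algebra_simps)
    show ?thesis using 1 2 pos by (simp add: pos_le_divide_eq pos_divide_le_eq)
  qed
  then show ?thesis using r(1) by (intro exI[of _ "min 1 r"] conjI exI[of _ "max 1 r"]) auto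
qed

text \<open>A scale-invariant Lipschitz condition on windows proportional to M. It is closed under
  products, so the spectral density is treated factor by factor without computing its
  derivative.\<close>

definition slowly_varying :: "(real \<Rightarrow> real) \<Rightarrow> bool" where
  "slowly_varying f \<longleftrightarrow> (\<exists>C\<ge>0. \<exists>M0. \<forall>M\<ge>M0. \<forall>s\<in>{M / 2..3 * M / 2}. \<bar>f s\<bar> \<le> C \<and> \<bar>f s - f M\<bar> \<le> C * \<bar>s - M\<bar> / M)"

lemma slowly_varyingI:
  assumes "\<And>M s. M \<ge> Mmin \<Longrightarrow> s \<in> {M / 2..3 * M / 2} \<Longrightarrow> \<bar>f s\<bar> \<le> C"
    "\<And>M s. M \<ge> Mmin \<Longrightarrow> s \<in> {M / 2..3 * M / 2} \<Longrightarrow> \<bar>f s - f M\<bar> \<le> C * \<bar>s - M\<bar> / M"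
  shows "slowly_varying f"
proof -
  have "\<bar>f s\<bar> \<le> max 0 C \<and> \<bar>f s - f M\<bar> \<le> max 0 C * \<bar>s - M\<bar> / M" if "M \<ge> max 1 Mmin" "s \<in> {M / 2..3 * M / 2}" for M s
  proof -
    have "C * \<bar>s - M\<bar> / M \<le> max 0 C * \<bar>s - M\<bar> / M"
      using that by (intro divide_right_mono mult_right_mono) auto
    then show ?thesis using assms[of M s] that by auto
  qed
  then show ?thesis unfolding slowly_varying_def by (intro exI[of _ "max 0 C"] conjI exI[of _ "max 1 Mmin"]) auto
qed

lemma slowly_varying_mult:
  assumes "slowly_varying f" "slowly_varying g" shows "slowly_varying (\<lambda>x. f x * g x)"
proof -
  obtain C M0 where C: "C \<ge> 0" "\<And>M s. M \<ge> M0 \<Longrightarrow> s \<in> {M / 2..3 * M / 2} \<Longrightarrow> \<bar>f s\<bar> \<le> C \<and> \<bar>f s - f M\<bar> \<le> C * \<bar>s - M\<bar> / M"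
    using assms(1) unfolding slowly_varying_def by blast
  obtain D M1 where D: "D \<ge> 0" "\<And>M s. M \<ge> M1 \<Longrightarrow> s \<in> {M / 2..3 * M / 2} \<Longrightarrow> \<bar>g s\<bar> \<le> D \<and> \<bar>g s - g M\<bar> \<le> D * \<bar>s - M\<bar> / M"
    using assms(2) unfolding slowly_varying_def by blast
  show ?thesis
  proof (rule slowly_varyingI[where Mmin = "max 1 (max M0 M1)" and C = "2 * (C * D)"])
    fix M s assume M: "M \<ge> max 1 (max M0 M1)" and s: "s \<in> {M / 2..3 * M / 2}"
    have f: "\<bar>f s\<bar> \<le> C" "\<bar>f s - f M\<bar> \<le> C * \<bar>s - M\<bar> / M" using C(2)[of M s] M s by auto
    have g: "\<bar>g s\<bar> \<le> D" "\<bar>g s - g M\<bar> \<le> D * \<bar>s - M\<bar> / M" using D(2)[of M s] M s by auto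
    have gM: "\<bar>g M\<bar> \<le> D" using D(2)[of M M] M by auto
    have "\<bar>f s * g s\<bar> \<le> C * D" unfolding abs_mult using f g C(1) by (intro mult_mono) auto
    also have "\<dots> \<le> 2 * (C * D)" using C(1) D(1) by simp
    finally show "\<bar>f s * g s\<bar> \<le> 2 * (C * D)" .
    have "\<bar>f s * g s - f M * g M\<bar> = \<bar>f s * (g s - g M) + g M * (f s - f M)\<bar>" by (simp add: algebra_simps)
    also have "\<dots> \<le> \<bar>f s\<bar> * \<bar>g s - g M\<bar> + \<bar>g M\<bar> * \<bar>f s - f M\<bar>"
      by (rule order_trans[OF abs_triangle_ineq]) (simp add: abs_mult)
    also have "\<dots> \<le> C * (D * \<bar>s - M\<bar> / M) + D * (C * \<bar>s - M\<bar> / M)"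
      using f g gM C(1) D(1) by (intro add_mono mult_mono) auto
    finally show "\<bar>f s * g s - f M * g M\<bar> \<le> 2 * (C * D) * \<bar>s - M\<bar> / M" by (simp add: mult_ac)
  qed
qed

lemma slowly_varying_const: "slowly_varying (\<lambda>_. c)"
  by (rule slowly_varyingI[where Mmin = 1 and C = "\<bar>c\<bar>"]) auto

lemma slowly_varying_quotient: "slowly_varying (\<lambda>x. (x - p) / (x - q))"
proof (rule slowly_varyingI[where Mmin = "4 * \<bar>q\<bar> + 4" and C = "1 + 8 * \<bar>q - p\<bar>"])
  fix M s assume M: "M \<ge> 4 * \<bar>q\<bar> + 4" and s: "s \<in> {M / 2..3 * M / 2}"
  have 1: "s - q \<ge> M / 4" "s - q \<ge> 1" "M - q \<ge> M / 2" "M \<ge> 4" using M s by auto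
  have e: "(x - p) / (x - q) = 1 + (q - p) / (x - q)" if "x - q \<ge> 1" for x
    using that by (simp add: field_simps)
  have "\<bar>(q - p) / (s - q)\<bar> \<le> \<bar>q - p\<bar>" using 1 by (simp add: abs_divide divide_le_eq mult_le_cancel_left1)
  moreover have "\<bar>1 + t\<bar> \<le> 1 + 8 * d" if "\<bar>t\<bar> \<le> d" for t d :: real using that by linarith
  ultimately show "\<bar>(s - p) / (s - q)\<bar> \<le> 1 + 8 * \<bar>q - p\<bar>" unfolding e[OF 1(2)] by blast
  have "(s - p) / (s - q) - (M - p) / (M - q) = (q - p) * (M - s) / ((s - q) * (M - q))"
    using 1 by (simp add: field_simps)
  then have "\<bar>(s - p) / (s - q) - (M - p) / (M - q)\<bar> = \<bar>q - p\<bar> * \<bar>s - M\<bar> / ((s - q) * (M - q))"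
    using 1 by (simp add: abs_mult abs_divide abs_minus_commute)
  also have "\<dots> \<le> \<bar>q - p\<bar> * \<bar>s - M\<bar> / (1 * (M / 2))"
    using 1 by (intro divide_left_mono mult_mono mult_pos_pos) auto
  also have "\<dots> = (2 * \<bar>q - p\<bar>) * \<bar>s - M\<bar> / M" by simp
  also have "\<dots> \<le> (1 + 8 * \<bar>q - p\<bar>) * \<bar>s - M\<bar> / M"
    using 1 by (intro divide_right_mono mult_right_mono) auto
  finally show "\<bar>(s - p) / (s - q) - (M - p) / (M - q)\<bar> \<le> (1 + 8 * \<bar>q - p\<bar>) * \<bar>s - M\<bar> / M" .
qed

lemma slowly_varying_sqrt: "slowly_varying (\<lambda>x. sqrt (1 - a / x))"
proof (rule slowly_varyingI[where Mmin = "4 * \<bar>a\<bar> + 4" and C = "2 + 2 * \<bar>a\<bar>"])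
  fix M s assume M: "M \<ge> 4 * \<bar>a\<bar> + 4" and s: "s \<in> {M / 2..3 * M / 2}"
  have 1: "s \<ge> 2 * \<bar>a\<bar> + 2" "M \<ge> 2 * \<bar>a\<bar> + 2" using M s by auto
  have q: "\<bar>a / x\<bar> \<le> 1 / 2" if "x \<ge> 2 * \<bar>a\<bar> + 2" for x
  proof -
    have "x > 0" using that abs_ge_zero[of a] by linarith
    then show ?thesis using that by (simp add: abs_divide divide_le_eq)
  qed
  have b: "1 / 2 \<le> 1 - a / x" "1 - a / x \<le> 2" if "x \<ge> 2 * \<bar>a\<bar> + 2" for x using q[OF that] by linarith+
  have r: "1 / 2 \<le> sqrt (1 - a / x)" if "x \<ge> 2 * \<bar>a\<bar> + 2" for x
  proof (rule real_le_rsqrt)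
    have "(1 / 2 :: real)\<^sup>2 \<le> 1 / 2" by (simp add: power2_eq_square)
    then show "(1 / 2)\<^sup>2 \<le> 1 - a / x" using b(1)[OF that] by (rule order_trans)
  qed
  have "sqrt (1 - a / s) \<le> 2" using b[OF 1(1)] by (intro real_le_lsqrt) auto
  then show "\<bar>sqrt (1 - a / s)\<bar> \<le> 2 + 2 * \<bar>a\<bar>" using r[OF 1(1)] by simp
  let ?u = "sqrt (1 - a / s)" and ?v = "sqrt (1 - a / M)"
  \<comment> \<open>Both roots are at least 1/2, so their sum is at least 1 and the difference of
    squares bounds the difference.\<close>
  have "\<bar>?u - ?v\<bar> * 1 \<le> \<bar>?u - ?v\<bar> * (?u + ?v)"
    using r[OF 1(1)] r[OF 1(2)] by (intro mult_left_mono) auto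
  also have "\<dots> = \<bar>(?u - ?v) * (?u + ?v)\<bar>"
    unfolding abs_mult using r[OF 1(1)] r[OF 1(2)] by simp
  also have "(?u - ?v) * (?u + ?v) = ?u\<^sup>2 - ?v\<^sup>2" by (simp add: algebra_simps power2_eq_square)
  also have "\<dots> = (1 - a / s) - (1 - a / M)"
    using order_trans[OF _ b(1)[OF 1(1)], of 0] order_trans[OF _ b(1)[OF 1(2)], of 0] by (simp only: real_sqrt_pow2)
  also have "\<dots> = a * (s - M) / (s * M)" using 1 by (simp add: field_simps)
  also have "\<bar>a * (s - M) / (s * M)\<bar> = \<bar>a\<bar> * \<bar>s - M\<bar> / (s * M)" using 1 by (simp add: abs_mult abs_divide)
  also have "\<dots> \<le> \<bar>a\<bar> * \<bar>s - M\<bar> / (1 * M)"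
    using 1 by (intro divide_left_mono mult_mono mult_pos_pos) auto
  also have "\<dots> \<le> (2 + 2 * \<bar>a\<bar>) * \<bar>s - M\<bar> / M"
    using 1 by (simp only: mult_1) (intro divide_right_mono mult_right_mono, auto)
  finally show "\<bar>?u - ?v\<bar> \<le> (2 + 2 * \<bar>a\<bar>) * \<bar>s - M\<bar> / M" by simp
qed

section \<open>The spectral density near threshold and at infinity\<close>

locale spectral_density =
  fixes m a1 a2 g0 g1 g2 c :: real
  assumes m: "m > 0" and a: "a1 < 4 * m^2" "a2 < 4 * m^2"
    and g: "g0 < 4 * m^2" "g1 < 4 * m^2" "g2 < 4 * m^2" and c: "c < 4 * m^2"
begin

definition thr :: real where "thr = 4 * m^2"

definition sg :: "real \<Rightarrow> real" where "sg = vsig m a1 a2 g0 g1 g2"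

definition pv :: "real \<Rightarrow> real" where "pv = pv_g m a1 a2 g0 g1 g2"

lemma thr_pos: "thr > 0" unfolding thr_def using m by simp

text \<open>Numerator and denominator factors are paired so that each quotient is bounded above and
  away from 0 on the cut. The square root at threshold and the decay 1 / M stay explicit in
  \<open>sg_eq\<close>.\<close>

definition prefactor :: "real \<Rightarrow> real" where
  "prefactor M = ((M - a1) / (M - g0)) * (((M - a2) / (M - g1)) * (((M - 0) / (M - g2)) * (1 / (16 * pi\<^sup>2))))"

lemma sg_eq: "M > 0 \<Longrightarrow> sg M = prefactor M * sqrt (1 - thr / M) / M"
  unfolding sg_def vsig_def rho_def prefactor_def thr_def by simp

lemma prefactor_bounds: "\<exists>k>0. \<exists>K>0. \<forall>M\<ge>thr. k \<le> prefactor M \<and> prefactor M \<le> K"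
proof -
  obtain k1 K1 where 1: "k1 > 0" "K1 > 0" "\<And>M. M \<ge> thr \<Longrightarrow> k1 \<le> (M - a1) / (M - g0) \<and> (M - a1) / (M - g0) \<le> K1"
    using shifted_quotient_bounds[of a1 thr g0] a g unfolding thr_def by blast
  obtain k2 K2 where 2: "k2 > 0" "K2 > 0" "\<And>M. M \<ge> thr \<Longrightarrow> k2 \<le> (M - a2) / (M - g1) \<and> (M - a2) / (M - g1) \<le> K2"
    using shifted_quotient_bounds[of a2 thr g1] a g unfolding thr_def by blast
  obtain k3 K3 where 3: "k3 > 0" "K3 > 0" "\<And>M. M \<ge> thr \<Longrightarrow> k3 \<le> (M - 0) / (M - g2) \<and> (M - 0) / (M - g2) \<le> K3"
    using shifted_quotient_bounds[of 0 thr g2] thr_pos g unfolding thr_def by blast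
  have "k1 * (k2 * (k3 * (1 / (16 * pi\<^sup>2)))) \<le> prefactor M \<and> prefactor M \<le> K1 * (K2 * (K3 * (1 / (16 * pi\<^sup>2))))"
    if "M \<ge> thr" for M
  proof -
    have b: "k1 \<le> (M - a1) / (M - g0)" "(M - a1) / (M - g0) \<le> K1" "k2 \<le> (M - a2) / (M - g1)" "(M - a2) / (M - g1) \<le> K2"
      "k3 \<le> (M - 0) / (M - g2)" "(M - 0) / (M - g2) \<le> K3" using 1 2 3 that by auto
    then have p: "0 \<le> (M - a1) / (M - g0)" "0 \<le> (M - a2) / (M - g1)" "0 \<le> (M - 0) / (M - g2)" using 1 2 3 by linarith+
    show ?thesis unfolding prefactor_def
      by (intro conjI mult_mono b mult_nonneg_nonneg p order_refl) (use 1 2 3 in auto)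
  qed
  then show ?thesis using 1 2 3
    by (intro exI[of _ "k1 * (k2 * (k3 * (1 / (16 * pi\<^sup>2))))"] conjI exI[of _ "K1 * (K2 * (K3 * (1 / (16 * pi\<^sup>2))))"]) auto
qed

lemma sg_bounds:
  "\<exists>k>0. \<exists>K>0. \<forall>M\<ge>thr. k * sqrt (1 - thr / M) / M \<le> sg M \<and> 0 \<le> sg M \<and> sg M \<le> K / M"
proof -
  obtain k K where k: "k > 0" "K > 0" "\<And>M. M \<ge> thr \<Longrightarrow> k \<le> prefactor M \<and> prefactor M \<le> K"
    using prefactor_bounds by blast
  have "k * sqrt (1 - thr / M) / M \<le> sg M \<and> 0 \<le> sg M \<and> sg M \<le> K / M" if M: "M \<ge> thr" for M
  proof -
    have pos: "M > 0" using M thr_pos by linarith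
    have s: "0 \<le> sqrt (1 - thr / M)" "sqrt (1 - thr / M) \<le> 1" using M pos thr_pos by auto
    have 1: "k * sqrt (1 - thr / M) / M \<le> sg M"
      unfolding sg_eq[OF pos] using k(3)[OF M] s pos by (intro divide_right_mono mult_right_mono) auto
    moreover have "0 \<le> k * sqrt (1 - thr / M) / M" using k(1) s pos by simp
    moreover have "prefactor M * sqrt (1 - thr / M) \<le> K * 1"
      using k(2,3) k(3)[OF M] k(1) s by (intro mult_mono) auto
    then have "sg M \<le> K / M" unfolding sg_eq[OF pos] using pos by (intro divide_right_mono) auto
    ultimately show ?thesis by linarith
  qed
  then show ?thesis using k(1,2) by blast
qed

lemma sg_pos: "M > thr \<Longrightarrow> sg M > 0"
proof -
  assume M: "M > thr"
  obtain k where k: "k > 0" "k * sqrt (1 - thr / M) / M \<le> sg M" using sg_bounds M by (meson less_imp_le)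
  have "0 < k * sqrt (1 - thr / M) / M" using k(1) M thr_pos by simp
  then show ?thesis using k(2) by linarith
qed

lemma sg_thr: "sg thr = 0"
  using sg_eq[OF thr_pos] thr_pos by simp

lemma sg_measurable [measurable]: "sg \<in> borel_measurable borel"
  unfolding sg_def vsig_def[abs_def] rho_def[abs_def] by measurable

lemma continuous_on_sg: "continuous_on {thr..} sg"
proof -
  have "continuous_on {thr..} (\<lambda>M. prefactor M * sqrt (1 - thr / M) / M)"
    unfolding prefactor_def using thr_pos g unfolding thr_def
    by (intro continuous_intros) auto
  then show ?thesis
    by (rule continuous_on_cong[THEN iffD1, rotated -1]) (use sg_eq thr_pos in auto)
qed

lemma sg_differentiable:
  assumes M: "M > thr" shows "\<exists>D. (sg has_real_derivative D) (at M)"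
proof -
  have pos: "M > 0" "1 - thr / M > 0" using M thr_pos by auto
  have nz: "M - g0 \<noteq> 0" "M - g1 \<noteq> 0" "M - g2 \<noteq> 0" using M g unfolding thr_def by auto
  have "\<exists>D. ((\<lambda>M. prefactor M * sqrt (1 - thr / M) / M) has_real_derivative D) (at M)"
    unfolding prefactor_def by (rule exI) (rule derivative_eq_intros refl | use pos nz in simp)+
  then obtain D where D: "((\<lambda>M. prefactor M * sqrt (1 - thr / M) / M) has_real_derivative D) (at M)" by blast
  have "(sg has_real_derivative D) (at M)"
  proof (rule has_field_derivative_transform_within_open[OF D, of "{0<..}"])
    show "prefactor x * sqrt (1 - thr / x) / x = sg x" if "x \<in> {0<..}" for x using sg_eq[of x] that by simp
  qed (use pos in auto)
  then show ?thesis by blast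
qed

text \<open>The factor in front of 1 / M is slowly varying, so increments are of the size of a
  derivative of order M^-2. This makes the part of the principal value near the pole O(1 /
  M).\<close>

lemma sg_scaled_lipschitz:
  "\<exists>C\<ge>0. \<exists>L>0. \<forall>M\<ge>L. \<forall>s\<in>{M / 2..3 * M / 2}. \<bar>sg s - sg M\<bar> \<le> C * \<bar>s - M\<bar> / M\<^sup>2"
proof -
  define f where "f M = prefactor M * sqrt (1 - thr / M)" for M
  have "slowly_varying f"
    unfolding f_def prefactor_def
    by (intro slowly_varying_mult slowly_varying_quotient slowly_varying_const slowly_varying_sqrt)
  then obtain C L where C: "C \<ge> 0" "\<And>M s. M \<ge> L \<Longrightarrow> s \<in> {M / 2..3 * M / 2} \<Longrightarrow> \<bar>f s\<bar> \<le> C \<and> \<bar>f s - f M\<bar> \<le> C * \<bar>s - M\<bar> / M"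
    unfolding slowly_varying_def by blast
  have "\<bar>sg s - sg M\<bar> \<le> (4 * C) * \<bar>s - M\<bar> / M\<^sup>2" if M: "M \<ge> max 1 L" and s: "s \<in> {M / 2..3 * M / 2}" for M s
  proof -
    have pos: "M > 0" "s > 0" "s \<ge> M / 2" using M s by auto
    have fs: "\<bar>f s - f M\<bar> \<le> C * \<bar>s - M\<bar> / M" and fM: "\<bar>f M\<bar> \<le> C" using C(2)[of M s] C(2)[of M M] M s by auto
    have "sg s - sg M = (f s - f M) / s + f M * (M - s) / (s * M)"
      unfolding sg_eq[OF pos(1)] sg_eq[OF pos(2)] f_def[symmetric] using pos by (simp add: field_simps)
    then have "\<bar>sg s - sg M\<bar> \<le> \<bar>f s - f M\<bar> / s + \<bar>f M\<bar> * \<bar>s - M\<bar> / (s * M)"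
      using pos abs_triangle_ineq[of "(f s - f M) / s" "f M * (M - s) / (s * M)"]
      by (simp add: abs_mult abs_divide abs_minus_commute)
    also have "\<bar>f s - f M\<bar> / s \<le> (C * \<bar>s - M\<bar> / M) / (M / 2)" using fs pos C(1) by (intro frac_le) auto
    also have "\<bar>f M\<bar> * \<bar>s - M\<bar> / (s * M) \<le> C * \<bar>s - M\<bar> / (M / 2 * M)"
      using fM pos C(1) by (intro frac_le mult_mono) auto
    finally show ?thesis using pos by (simp add: field_simps power2_eq_square)
  qed
  then show ?thesis using C(1) by (intro exI[of _ "4 * C"] conjI exI[of _ "max 1 L"]) auto
qed

definition truncated :: "real \<Rightarrow> real \<Rightarrow> real" where
  "truncated \<delta> M = (LINT s:{thr..M - \<delta>}|lborel. sg s / (s - M)) + (LINT s:{M + \<delta>..}|lborel. sg s / (s - M))"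

lemma inverse_square_tail:
  assumes "b > 0"
  shows "set_integrable lborel {b..} (\<lambda>s::real. 1 / s\<^sup>2)" "(LINT s:{b..}|lborel. 1 / s\<^sup>2) = 1 / b"
proof -
  have lim: "((\<lambda>s::real. - (1 / s)) \<longlongrightarrow> - 0) at_top"
    by (intro tendsto_minus) (rule tendsto_divide_0[OF tendsto_const filterlim_at_top_imp_at_infinity[OF filterlim_ident]])
  have d: "((\<lambda>s::real. - (1 / s)) has_real_derivative 1 / x\<^sup>2) (at x)" if "b \<le> x" for x
    using that assms by (auto intro!: derivative_eq_intros simp: power2_eq_square)
  note * = set_integral_FTC_atLeast[OF _ d _ lim]
  show "set_integrable lborel {b..} (\<lambda>s::real. 1 / s\<^sup>2)" by (rule *(1)) auto
  have "(LINT s:{b..}|lborel. 1 / s\<^sup>2) = - 0 - - (1 / b)" by (rule *(2)) auto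
  then show "(LINT s:{b..}|lborel. 1 / s\<^sup>2) = 1 / b" by simp
qed

lemma tail_integrable:
  assumes "M > thr" "\<delta> > 0"
  shows "set_integrable lborel {M + \<delta>..} (\<lambda>s. sg s / (s - M))"
proof -
  obtain K where K: "K > 0" "\<And>M. M \<ge> thr \<Longrightarrow> 0 \<le> sg M \<and> sg M \<le> K / M" using sg_bounds by blast
  have M: "M > 0" using assms thr_pos by linarith
  have dom: "set_integrable lborel {M + \<delta>..} (\<lambda>s. K * (M + \<delta>) / \<delta> * (1 / s\<^sup>2))"
    by (intro set_integrable_mult_right inverse_square_tail(1)) (use M assms in simp)
  show ?thesis
  proof (rule set_integrable_bound[OF dom])
    show "set_borel_measurable lborel {M + \<delta>..} (\<lambda>s. sg s / (s - M))" unfolding set_borel_measurable_def by measurable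
    show "AE s in lborel. s \<in> {M + \<delta>..} \<longrightarrow> norm (sg s / (s - M)) \<le> norm (K * (M + \<delta>) / \<delta> * (1 / s\<^sup>2))"
    proof (intro AE_I2 impI)
      fix s assume s: "s \<in> {M + \<delta>..}"
      have sp: "s > 0" "s - M > 0" "s \<ge> thr" using s M assms by auto
      \<comment> \<open>The difference of the two sides is M (s - M - \<delta>); the inequality
        compares the integrand with 1 / s^2.\<close>
      have "\<delta> * s \<le> (M + \<delta>) * (s - M)" using s M mult_nonneg_nonneg[of M "s - (M + \<delta>)"] by (simp add: algebra_simps)
      then have "1 / (s - M) \<le> (M + \<delta>) / (\<delta> * s)" using sp assms by (simp add: divide_simps mult.commute)
      then have "sg s * (1 / (s - M)) \<le> (K / s) * ((M + \<delta>) / (\<delta> * s))"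
        using K(1) K(2)[OF sp(3)] sp by (intro mult_mono) auto
      moreover have "(K / s) * ((M + \<delta>) / (\<delta> * s)) = K * (M + \<delta>) / \<delta> * (1 / s\<^sup>2)" by (simp add: power2_eq_square)
      moreover have "norm (sg s / (s - M)) = sg s * (1 / (s - M))" using K(2)[OF sp(3)] sp by simp
      ultimately have "norm (sg s / (s - M)) \<le> K * (M + \<delta>) / \<delta> * (1 / s\<^sup>2)" by (simp only:)
      then show "norm (sg s / (s - M)) \<le> norm (K * (M + \<delta>) / \<delta> * (1 / s\<^sup>2))"
        by (rule order_trans) (simp only: real_norm_def abs_ge_self)
    qed
  qed
qed

lemma compact_part_integrable:
  assumes "u \<ge> thr" "M \<notin> {u..v}" shows "set_integrable lborel {u..v} (\<lambda>s. sg s / (s - M))"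
  by (intro borel_integrable_atLeastAtMost' continuous_intros continuous_on_subset[OF continuous_on_sg]) (use assms in auto)

end

section \<open>Principal value: existence, measurability, asymptotics\<close>

context spectral_density
begin

text \<open>Folding the two sides of the pole onto each other leaves this quotient. Its value at 0
  is the continuous extension, so the principal value involves only an ordinary integral.\<close>

definition odd_quotient :: "real \<Rightarrow> real \<Rightarrow> real" where
  "odd_quotient M u = (if u = 0 then 2 * deriv sg M else (sg (M + u) - sg (M - u)) / u)"

lemma sg_DERIV: "M > thr \<Longrightarrow> (sg has_real_derivative deriv sg M) (at M)"
  using sg_differentiable DERIV_imp_deriv by metis

lemma isCont_sg: "M > thr \<Longrightarrow> isCont sg M"
  using sg_DERIV DERIV_isCont by blast

lemma continuous_on_odd_quotient:
  assumes M: "M > thr" "M - h > thr"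
  shows "continuous_on {0..h} (odd_quotient M)"
proof (intro continuous_at_imp_continuous_on ballI)
  fix u assume u: "u \<in> {0..h}"
  show "isCont (odd_quotient M) u"
  proof (cases "u = 0")
    case True
    have "((\<lambda>u. sg (M + u) - sg (M - u)) has_real_derivative deriv sg M - - deriv sg M) (at 0)"
    proof (rule DERIV_diff)
      show "((\<lambda>u. sg (M + u)) has_real_derivative deriv sg M) (at 0)"
        using DERIV_shift[of sg "deriv sg M" 0 M] sg_DERIV[OF M(1)] by (simp add: add.commute)
      have "((\<lambda>u. sg (M - u)) has_real_derivative deriv sg M * (0 - 1)) (at 0)"
        by (rule DERIV_chain2[where f = sg and g = "\<lambda>u. M - u"])
           (use sg_DERIV[OF M(1)] in \<open>auto intro!: derivative_eq_intros\<close>)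
      then show "((\<lambda>u. sg (M - u)) has_real_derivative - deriv sg M) (at 0)" by simp
    qed
    then have "((\<lambda>u. (sg (M + u) - sg (M - u)) / u) \<longlongrightarrow> 2 * deriv sg M) (at 0)"
      unfolding DERIV_def by simp
    moreover have "eventually (\<lambda>u. (sg (M + u) - sg (M - u)) / u = odd_quotient M u) (at 0)"
      by (auto simp: eventually_at_filter odd_quotient_def)
    ultimately have "(odd_quotient M \<longlongrightarrow> 2 * deriv sg M) (at 0)" by (rule Lim_transform_eventually)
    then show ?thesis unfolding True isCont_def by (simp add: odd_quotient_def)
  next
    case False
    then have "u > 0" using u by auto
    then have "eventually (\<lambda>v. v \<in> {0<..}) (nhds u)" by (intro eventually_nhds_in_open) auto
    then have ev: "eventually (\<lambda>v. v > 0) (nhds u)" by simp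
    have c: "isCont sg (M + u)" "isCont sg (M - u)" using u M by (auto intro!: isCont_sg)
    have "isCont (\<lambda>u. (sg (M + u) - sg (M - u)) / u) u"
    proof -
      have "isCont (\<lambda>u. sg (M + u)) u" "isCont (\<lambda>u. sg (M - u)) u"
        using c isCont_o2[of u "\<lambda>u. M + u" sg] isCont_o2[of u "\<lambda>u. M - u" sg] by auto
      then show ?thesis using False by (intro continuous_intros)
    qed
    moreover have "eventually (\<lambda>v. (sg (M + v) - sg (M - v)) / v = odd_quotient M v) (nhds u)"
      using ev by eventually_elim (simp add: odd_quotient_def)
    ultimately show ?thesis by (simp add: isCont_cong)
  qed
qed

text \<open>Between the windows of half-width \<delta> and h, the substitutions s = M + u and s = M
  - u give denominators of opposite sign; adjacent pieces share only single points.\<close>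

lemma truncated_eq:
  assumes M: "M - h > thr" and d: "0 < \<delta>" "\<delta> \<le> h"
  shows "truncated \<delta> M = truncated h M + integral {\<delta>..h} (odd_quotient M)"
proof -
  let ?f = "\<lambda>s. sg s / (s - M)"
  have Mt: "M > thr" using M d by linarith
  have Un: "(LINT s:A \<union> B|lborel. ?f s) = (LINT s:A|lborel. ?f s) + (LINT s:B|lborel. ?f s)"
    if "A \<inter> B \<subseteq> {z}" "A \<in> sets lborel" "B \<in> sets lborel" "set_integrable lborel A ?f" "set_integrable lborel B ?f" for A B z
  proof (rule set_integral_Un_AE[OF _ that(2-5)])
    show "AE x in lborel. \<not> (x \<in> A \<and> x \<in> B)"
      using AE_lborel_singleton[of z] by eventually_elim (use that(1) in auto)
  qed
  have "{thr..M - \<delta>} = {thr..M - h} \<union> {M - h..M - \<delta>}" using M d by auto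
  then have 1: "(LINT s:{thr..M - \<delta>}|lborel. ?f s) = (LINT s:{thr..M - h}|lborel. ?f s) + (LINT s:{M - h..M - \<delta>}|lborel. ?f s)"
    using M d by (simp only:) (rule Un[where z = "M - h"]; (intro compact_part_integrable)?; auto)
  have "{M + \<delta>..} = {M + \<delta>..M + h} \<union> {M + h..}" using d by auto
  then have 2: "(LINT s:{M + \<delta>..}|lborel. ?f s) = (LINT s:{M + \<delta>..M + h}|lborel. ?f s) + (LINT s:{M + h..}|lborel. ?f s)"
    using M Mt d by (simp only:) (rule Un[where z = "M + h"]; (intro compact_part_integrable tail_integrable)?; auto)
  have cp: "continuous_on {\<delta>..h} (\<lambda>u. sg (M + u) / u)" "continuous_on {\<delta>..h} (\<lambda>u. sg (M - u) / u)"
    by (intro continuous_intros continuous_on_compose2[OF continuous_on_sg]; use M Mt d in auto)+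
  have si: "set_integrable lborel {\<delta>..h} (\<lambda>u. sg (M + u) / u)" "set_integrable lborel {\<delta>..h} (\<lambda>u. sg (M - u) / u)"
    by (rule borel_integrable_atLeastAtMost'[OF cp(1)] borel_integrable_atLeastAtMost'[OF cp(2)])+
  have 3: "(LINT s:{M - h..M - \<delta>}|lborel. ?f s) = - (LINT u:{\<delta>..h}|lborel. sg (M - u) / u)"
    unfolding set_lebesgue_integral_def
    by (subst lborel_integral_real_affine[where c = "-1" and t = M])
       (auto simp: indicator_def algebra_simps simp flip: Bochner_Integration.integral_minus intro!: Bochner_Integration.integral_cong)
  have 4: "(LINT s:{M + \<delta>..M + h}|lborel. ?f s) = (LINT u:{\<delta>..h}|lborel. sg (M + u) / u)"
    unfolding set_lebesgue_integral_def
    by (subst lborel_integral_real_affine[where c = "1" and t = M])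
       (auto simp: indicator_def intro!: Bochner_Integration.integral_cong)
  have "(LINT u:{\<delta>..h}|lborel. sg (M + u) / u) - (LINT u:{\<delta>..h}|lborel. sg (M - u) / u)
     = (LINT u:{\<delta>..h}|lborel. sg (M + u) / u - sg (M - u) / u)"
    by (rule set_integral_diff(2)[OF si, symmetric])
  also have "\<dots> = (LINT u:{\<delta>..h}|lborel. odd_quotient M u)"
    using d by (intro set_lebesgue_integral_cong) (auto simp: odd_quotient_def diff_divide_distrib)
  also have "\<dots> = integral {\<delta>..h} (odd_quotient M)"
    using d by (intro set_borel_integral_eq_integral borel_integrable_atLeastAtMost'
       continuous_on_subset[OF continuous_on_odd_quotient[OF Mt M]]) auto
  finally show ?thesis unfolding truncated_def 1 2 3 4 by simp
qed

lemma truncated_tendsto: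
  assumes M: "M - h > thr" and h: "h > 0"
  shows "((\<lambda>\<delta>. truncated \<delta> M) \<longlongrightarrow> truncated h M + integral {0..h} (odd_quotient M)) (at_right 0)"
proof -
  have Mt: "M > thr" using M h by linarith
  have "odd_quotient M integrable_on {0..h}"
    by (rule integrable_continuous_real[OF continuous_on_odd_quotient[OF Mt M]])
  then have "continuous_on {0..h} (\<lambda>\<delta>. integral {\<delta>..h} (odd_quotient M))"
    by (rule indefinite_integral_continuous_1')
  then have "((\<lambda>\<delta>. integral {\<delta>..h} (odd_quotient M)) \<longlongrightarrow> integral {0..h} (odd_quotient M)) (at 0 within {0..h})"
    unfolding continuous_on_def by (rule bspec) (use h in simp)
  then have "((\<lambda>\<delta>. integral {\<delta>..h} (odd_quotient M)) \<longlongrightarrow> integral {0..h} (odd_quotient M)) (at_right 0)"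
    using h by (simp add: at_within_Icc_at_right)
  then have "((\<lambda>\<delta>. truncated h M + integral {\<delta>..h} (odd_quotient M)) \<longlongrightarrow> truncated h M + integral {0..h} (odd_quotient M)) (at_right 0)"
    by (intro tendsto_add tendsto_const)
  moreover have "eventually (\<lambda>\<delta>. truncated h M + integral {\<delta>..h} (odd_quotient M) = truncated \<delta> M) (at_right 0)"
    using eventually_at_right_real[OF h]
  proof eventually_elim
    case (elim \<delta>)
    then show ?case using truncated_eq[OF M, of \<delta>] by (simp only: greaterThanLessThan_iff less_imp_le)
  qed
  ultimately show ?thesis by (rule Lim_transform_eventually)
qed

text \<open>The limit exists, so \<open>Lim\<close> in \<open>pv_g\<close> is a genuine principal
  value above threshold, computed with any admissible half-width h.\<close>

lemma pv_eq:
  assumes "M - h > thr" "h > 0"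
  shows "pv M = truncated h M + integral {0..h} (odd_quotient M)"
  unfolding pv_def pv_g_def sg_def[symmetric] thr_def[symmetric] truncated_def[symmetric]
  by (rule tendsto_Lim[OF _ truncated_tendsto[OF assms]]) simp

text \<open>A pointwise limit of truncations with window 1 / (n + 1), each measurable as a parameter
  integral. Where the defining limit is not controlled, at and below threshold, the value is set to
  0.\<close>

lemma pv_measurable: "(\<lambda>M. if M > thr then pv M else 0) \<in> borel_measurable borel"
proof (rule borel_measurable_LIMSEQ_real[where u = "\<lambda>n M. if M > thr then truncated (1 / real (Suc n)) M else 0"])
  fix M
  show "(\<lambda>n. if M > thr then truncated (1 / real (Suc n)) M else 0) \<longlonglongrightarrow> (if M > thr then pv M else 0)"
  proof (cases "M > thr")
    case True
    define h where "h = (M - thr) / 2"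
    have h: "M - h > thr" "h > 0" using True unfolding h_def by (auto simp: field_simps)
    have lim: "((\<lambda>\<delta>. truncated \<delta> M) \<longlongrightarrow> pv M) (at_right 0)"
      unfolding pv_eq[OF h] by (rule truncated_tendsto[OF h])
    have z: "(\<lambda>n. 1 / real (Suc n)) \<longlonglongrightarrow> 0"
      using LIMSEQ_inverse_real_of_nat by (simp add: inverse_eq_divide)
    have "(\<lambda>n. truncated (1 / real (Suc n)) M) \<longlonglongrightarrow> pv M"
      using lim z unfolding tendsto_at_iff_sequentially by (auto simp: o_def)
    then show ?thesis using True by simp
  qed simp
next
  fix n :: nat
  define \<delta> where "\<delta> = 1 / real (Suc n)"
  have "(\<lambda>M. truncated \<delta> M) \<in> borel_measurable borel"
    unfolding truncated_def set_lebesgue_integral_def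
  proof (intro borel_measurable_add)
    have "(\<lambda>(M, s). (if thr \<le> s \<and> s \<le> M - \<delta> then 1 else 0) *\<^sub>R (sg s / (s - M))) \<in> borel_measurable (borel \<Otimes>\<^sub>M lborel)"
      by measurable
    then show "(\<lambda>M. \<integral>s. indicat_real {thr..M - \<delta>} s *\<^sub>R (sg s / (s - M)) \<partial>lborel) \<in> borel_measurable borel"
      by (intro lborel.borel_measurable_lebesgue_integral) (simp add: indicator_def of_bool_def)
    have "(\<lambda>(M, s). (if M + \<delta> \<le> s then 1 else 0) *\<^sub>R (sg s / (s - M))) \<in> borel_measurable (borel \<Otimes>\<^sub>M lborel)"
      by measurable
    then show "(\<lambda>M. \<integral>s. indicat_real {M + \<delta>..} s *\<^sub>R (sg s / (s - M)) \<partial>lborel) \<in> borel_measurable borel"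
      by (intro lborel.borel_measurable_lebesgue_integral) (simp add: indicator_def of_bool_def)
  qed
  then show "(\<lambda>M. if M > thr then truncated \<delta> M else 0) \<in> borel_measurable borel" by measurable
qed

text \<open>Up to M / 2 the denominator lies between - M and 0 and, from \<open>2 * thr\<close> on,
  \<open>sg s\<close> is at least a multiple of 1 / s, which integrates to a logarithm. Beyond 3 M /
  2 the integrand is O(1 / s^2) and contributes O(1 / M).\<close>

lemma truncated_half_le:
  "\<exists>\<kappa>>0. \<exists>C. \<forall>M\<ge>4 * thr. truncated (M / 2) M \<le> (C - \<kappa> * ln M) / M"
proof -
  obtain k K where k: "k > 0" "K > 0" "\<And>M. M \<ge> thr \<Longrightarrow> k * sqrt (1 - thr / M) / M \<le> sg M \<and> 0 \<le> sg M \<and> sg M \<le> K / M"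
    using sg_bounds by blast
  \<comment> \<open>The 1/2 is the lower bound of \<open>sqrt (1 - thr / s)\<close> for s at least
    \<open>2 * thr\<close>.\<close>
  define \<kappa> where "\<kappa> = k / 2"
  have \<kappa>: "\<kappa> > 0" using k(1) by (simp add: \<kappa>_def)
  have "truncated (M / 2) M \<le> (\<kappa> * ln (4 * thr) + 2 * K - \<kappa> * ln M) / M" if M: "M \<ge> 4 * thr" for M
  proof -
    let ?f = "\<lambda>s. sg s / (s - M)"
    have pos: "M > 0" using M thr_pos by linarith
    have tail: "(LINT s:{M + M / 2..}|lborel. ?f s) \<le> 2 * K / M"
    proof -
      have "(LINT s:{M + M / 2..}|lborel. ?f s) \<le> (LINT s:{M + M / 2..}|lborel. (3 * K) * (1 / s\<^sup>2))"
      proof (rule set_integral_mono)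
        show "set_integrable lborel {M + M / 2..} ?f" using M pos thr_pos by (intro tail_integrable) auto
        show "set_integrable lborel {M + M / 2..} (\<lambda>s. (3 * K) * (1 / s\<^sup>2))"
          by (intro set_integrable_mult_right inverse_square_tail(1)) (use pos in simp)
        fix s assume s: "s \<in> {M + M / 2..}"
        then have sp: "s > 0" "s - M \<ge> s / 3" "s \<ge> thr" using pos M thr_pos by auto
        have "sg s / (s - M) \<le> (K / s) / (s / 3)" using k(2) k(3)[OF sp(3)] sp by (intro frac_le) auto
        also have "\<dots> = (3 * K) * (1 / s\<^sup>2)" by (simp add: power2_eq_square)
        finally show "sg s / (s - M) \<le> (3 * K) * (1 / s\<^sup>2)" .
      qed
      also have "\<dots> = (3 * K) * (1 / (M + M / 2))"
        using pos by (simp only: set_integral_cmult inverse_square_tail(2))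
      also have "\<dots> = 2 * K / M" using pos by (simp add: field_simps)
      finally show ?thesis .
    qed
    have head: "(LINT s:{thr..M - M / 2}|lborel. ?f s) \<le> - (\<kappa> / M) * (ln (M / 2) - ln (2 * thr))"
    proof -
      have "(LINT s:{thr..M - M / 2}|lborel. ?f s) \<le> (LINT s:{thr..M - M / 2}|lborel. - (\<kappa> / M) * (indicat_real {2 * thr..M / 2} s * (1 / s)))"
      proof (rule set_integral_mono)
        show "set_integrable lborel {thr..M - M / 2} ?f" using pos by (intro compact_part_integrable) auto
        have "set_integrable lborel {2 * thr..M / 2} (\<lambda>s. 1 / s)"
          by (intro borel_integrable_atLeastAtMost' continuous_intros) (use thr_pos in auto)
        then have "integrable lborel (\<lambda>s. indicat_real {2 * thr..M / 2} s * (1 / s))" unfolding set_integrable_def by simp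
        then show "set_integrable lborel {thr..M - M / 2} (\<lambda>s. - (\<kappa> / M) * (indicat_real {2 * thr..M / 2} s * (1 / s)))"
          unfolding set_integrable_def by (intro integrable_mult_indicator integrable_mult_right) auto
        fix s assume s: "s \<in> {thr..M - M / 2}"
        have sp: "s > 0" "s \<ge> thr" "M - s > 0" "M - s \<le> M" using s pos thr_pos by auto
        have "?f s = - (sg s / (M - s))" using sp by (simp add: field_simps)
        also have "\<dots> \<le> - (sg s / M)" using sp k(3)[OF sp(2)] by (intro le_imp_neg_le divide_left_mono) auto
        finally have 1: "?f s \<le> - (sg s / M)" .
        have "\<kappa> * (indicat_real {2 * thr..M / 2} s * (1 / s)) \<le> sg s"
        proof (cases "s \<in> {2 * thr..M / 2}")
          case True
          then have "thr / s \<le> 1 / 2" using sp by (simp add: divide_le_eq)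
          then have "1 / 2 \<le> 1 - thr / s" by linarith
          moreover have "(1 / 2 :: real)\<^sup>2 \<le> 1 / 2" by (simp add: power2_eq_square)
          ultimately have "1 / 2 \<le> sqrt (1 - thr / s)" by (intro real_le_rsqrt) (rule order_trans)
          then have "k * (1 / 2) / s \<le> k * sqrt (1 - thr / s) / s"
            using k(1) sp by (intro divide_right_mono mult_left_mono) auto
          also have "\<dots> \<le> sg s" using k(3)[OF sp(2)] by blast
          finally show ?thesis using True unfolding \<kappa>_def by simp
        qed (use k(3)[OF sp(2)] in simp)
        then have "- (sg s / M) \<le> - ((\<kappa> * (indicat_real {2 * thr..M / 2} s * (1 / s))) / M)"
          using pos by (intro le_imp_neg_le divide_right_mono) auto
        from order_trans[OF 1 this] show "?f s \<le> - (\<kappa> / M) * (indicat_real {2 * thr..M / 2} s * (1 / s))"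
          by (simp only: minus_divide_left times_divide_eq_left mult_minus_left)
      qed
      also have "\<dots> = - (\<kappa> / M) * (LINT s:{thr..M - M / 2}|lborel. indicat_real {2 * thr..M / 2} s * (1 / s))"
        by (rule set_integral_cmult)
      also have "(LINT s:{thr..M - M / 2}|lborel. indicat_real {2 * thr..M / 2} s * (1 / s)) = (LINT s:{2 * thr..M / 2}|lborel. 1 / s)"
        unfolding set_lebesgue_integral_def using thr_pos
        by (intro Bochner_Integration.integral_cong) (auto simp: indicator_def)
      also have "\<dots> = integral {2 * thr..M / 2} (\<lambda>s. 1 / s)"
        by (intro set_borel_integral_eq_integral borel_integrable_atLeastAtMost' continuous_intros) (use thr_pos in auto)
      also have "\<dots> = ln (M / 2) - ln (2 * thr)"
      proof (rule integral_unique, rule fundamental_theorem_of_calculus)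
        show "(ln has_vector_derivative 1 / s) (at s within {2 * thr..M / 2})" if "s \<in> {2 * thr..M / 2}" for s
        proof -
          have "(ln has_real_derivative 1 / s) (at s within {2 * thr..M / 2})"
            by (rule has_field_derivative_at_within[OF DERIV_ln_divide]) (use that thr_pos in auto)
          then show ?thesis by (simp add: has_real_derivative_iff_has_vector_derivative)
        qed
      qed (use M in auto)
      finally show ?thesis .
    qed
    have "ln (M / 2) = ln M - ln 2" using pos by (simp add: ln_div)
    moreover have "ln (2 * (2 * thr)) = ln 2 + ln (2 * thr)" using thr_pos by (intro ln_mult_pos) auto
    ultimately have e: "ln (M / 2) - ln (2 * thr) = ln M - ln (4 * thr)" by simp
    have "truncated (M / 2) M \<le> - (\<kappa> / M) * (ln M - ln (4 * thr)) + 2 * K / M"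
      unfolding truncated_def using add_mono[OF head tail] unfolding e .
    also have "\<dots> = (\<kappa> * ln (4 * thr) + 2 * K - \<kappa> * ln M) / M"
      using pos by (simp add: field_simps)
    finally show ?thesis .
  qed
  then show ?thesis using \<kappa> by blast
qed

end

context spectral_density
begin

text \<open>With half-width M / 2 the folded integral is O(1 / M) by the scaled Lipschitz bound, so
  the logarithm of the far part decides.\<close>

lemma pv_upper: "\<exists>\<kappa>>0. \<exists>L. \<forall>M\<ge>L. pv M \<le> - (\<kappa> * ln M / M)"
proof -
  obtain \<kappa> C where \<kappa>: "\<kappa> > 0" "\<And>M. M \<ge> 4 * thr \<Longrightarrow> truncated (M / 2) M \<le> (C - \<kappa> * ln M) / M"
    using truncated_half_le by blast
  obtain C1 L1 where C1: "C1 \<ge> 0" "L1 > 0" "\<And>M s. M \<ge> L1 \<Longrightarrow> s \<in> {M / 2..3 * M / 2} \<Longrightarrow> \<bar>sg s - sg M\<bar> \<le> C1 * \<bar>s - M\<bar> / M\<^sup>2"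
    using sg_scaled_lipschitz by blast
  \<comment> \<open>Beyond the exponential, ln M absorbs the constants at the cost of half of
    \<kappa>.\<close>
  define L where "L = max (max L1 (4 * thr)) (exp (2 * (C + C1) / \<kappa>))"
  have "pv M \<le> - (\<kappa> / 2 * ln M / M)" if M: "M \<ge> L" for M
  proof -
    have big: "M \<ge> L1" "M \<ge> 4 * thr" "M \<ge> exp (2 * (C + C1) / \<kappa>)" using M unfolding L_def by auto
    have pos: "M > 0" using big(2) thr_pos by linarith
    have h: "M - M / 2 > thr" "M / 2 > 0" using big(2) thr_pos by auto
    have Mt: "M > thr" using h by linarith
    have b: "norm (odd_quotient M u) \<le> 2 * C1 / M\<^sup>2" if u: "u \<in> cbox 0 (M / 2) - {0}" for u
    proof -
      have u0: "u > 0" "u \<le> M / 2" using u by auto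
      have "\<bar>sg (M + u) - sg M\<bar> \<le> C1 * \<bar>(M + u) - M\<bar> / M\<^sup>2" using u0 big(1) by (intro C1(3)) auto
      moreover have "\<bar>sg (M - u) - sg M\<bar> \<le> C1 * \<bar>(M - u) - M\<bar> / M\<^sup>2" using u0 big(1) by (intro C1(3)) auto
      ultimately have "\<bar>sg (M + u) - sg M\<bar> \<le> C1 * u / M\<^sup>2" "\<bar>sg (M - u) - sg M\<bar> \<le> C1 * u / M\<^sup>2" using u0 by auto
      then have "\<bar>sg (M + u) - sg (M - u)\<bar> \<le> C1 * u / M\<^sup>2 + C1 * u / M\<^sup>2"
        using abs_triangle_ineq4[of "sg (M + u) - sg M" "sg (M - u) - sg M"] by simp
      also have "\<dots> = (2 * C1 / M\<^sup>2) * u" by simp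
      finally have "\<bar>sg (M + u) - sg (M - u)\<bar> / u \<le> 2 * C1 / M\<^sup>2" using u0 by (simp only: pos_divide_le_eq)
      then show ?thesis using u0 unfolding odd_quotient_def by (simp add: abs_divide)
    qed
    have "(odd_quotient M has_integral integral {0..M / 2} (odd_quotient M)) (cbox 0 (M / 2))"
      using integrable_continuous_real[OF continuous_on_odd_quotient[OF Mt h(1)]] by (simp add: integrable_integral)
    from has_integral_bound_spike_finite[OF _ _ this b, of "{0}"]
    have "norm (integral {0..M / 2} (odd_quotient M)) \<le> 2 * C1 / M\<^sup>2 * (M / 2)" using C1(1) pos by simp
    also have "\<dots> = C1 / M" using pos by (simp add: power2_eq_square)
    finally have "integral {0..M / 2} (odd_quotient M) \<le> C1 / M" by simp
    then have "pv M \<le> (C - \<kappa> * ln M) / M + C1 / M"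
      unfolding pv_eq[OF h] using \<kappa>(2)[OF big(2)] by linarith
    also have "\<dots> = (C + C1 - \<kappa> * ln M) / M" by (simp add: add_divide_distrib diff_divide_distrib)
    also have "\<dots> \<le> (- (\<kappa> / 2 * ln M)) / M"
    proof (intro divide_right_mono)
      have "2 * (C + C1) / \<kappa> \<le> ln M" using big(3) pos by (simp add: ln_ge_iff)
      then have "2 * (C + C1) \<le> \<kappa> * ln M" using \<kappa>(1) by (simp add: pos_divide_le_eq mult.commute)
      then show "C + C1 - \<kappa> * ln M \<le> - (\<kappa> / 2 * ln M)" by simp
    qed (use pos in simp)
    finally show ?thesis by simp
  qed
  then show ?thesis using \<kappa>(1) by (intro exI[of _ "\<kappa> / 2"] conjI exI[of _ L]) auto
qed

section \<open>Integrability of the continuous weight\<close>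

definition weight :: "real \<Rightarrow> real" where
  "weight M = indicat_real {4 * m^2..} M * mu_con m a1 a2 g0 g1 g2 c M"

text \<open>At M = \<open>thr\<close> the density vanishes and with it the weight, whatever value
  \<open>pv_g\<close> takes there.\<close>

lemma weight_eq:
  "weight M = (if M > thr then sg M / ((M - c) * ((if M > thr then pv M else 0)\<^sup>2 + pi\<^sup>2 * (sg M)\<^sup>2)) else 0)"
proof (cases "M = thr")
  case True
  then show ?thesis unfolding weight_def mu_con_def sg_def[symmetric] using sg_thr by simp
next
  case False
  then show ?thesis unfolding weight_def mu_con_def sg_def[symmetric] pv_def[symmetric] thr_def[symmetric]
    by (auto simp: indicator_def)
qed

lemma weight_measurable [measurable]: "weight \<in> borel_measurable borel"
proof -
  note [measurable] = pv_measurable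
  show ?thesis unfolding weight_eq[abs_def] by measurable
qed

lemma weight_eq_0: "M < thr \<Longrightarrow> weight M = 0"
  by (simp add: weight_eq)

lemma weight_nonneg: "weight M \<ge> 0"
proof (cases "M > thr")
  case True
  then have "M - c > 0" using c unfolding thr_def by linarith
  then show ?thesis unfolding weight_eq using sg_pos[OF True] by simp
qed (simp add: weight_eq)

lemma integrable_inverse_sqrt: "integrable lborel (\<lambda>x. indicat_real {b..L} x / sqrt (x - b))"
proof (cases "b \<le> L")
  case True
  show ?thesis
  proof (rule integrable_has_integral_nonneg)
    have "((\<lambda>x. 1 / sqrt (x - b)) has_integral 2 * sqrt (L - b) - 2 * sqrt (b - b)) {b..L}"
    proof (rule fundamental_theorem_of_calculus_interior[OF True])
      show "continuous_on {b..L} (\<lambda>x. 2 * sqrt (x - b))" by (intro continuous_intros)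
      fix x assume "x \<in> {b<..<L}"
      then have "((\<lambda>x. 2 * sqrt (x - b)) has_real_derivative 1 / sqrt (x - b)) (at x)"
        by (auto intro!: derivative_eq_intros simp: divide_simps)
      then show "((\<lambda>x. 2 * sqrt (x - b)) has_vector_derivative 1 / sqrt (x - b)) (at x)"
        by (simp add: has_real_derivative_iff_has_vector_derivative)
    qed
    then have "((\<lambda>x. if x \<in> {b..L} then 1 / sqrt (x - b) else 0) has_integral 2 * sqrt (L - b) - 2 * sqrt (b - b)) UNIV"
      unfolding has_integral_restrict_UNIV .
    moreover have "(\<lambda>x. if x \<in> {b..L} then 1 / sqrt (x - b) else 0) = (\<lambda>x. indicat_real {b..L} x / sqrt (x - b))"
      by (auto simp: indicator_def)
    ultimately show "((\<lambda>x. indicat_real {b..L} x / sqrt (x - b)) has_integral 2 * sqrt (L - b) - 2 * sqrt (b - b)) UNIV" by simp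
    show "0 \<le> indicat_real {b..L} x / sqrt (x - b)" for x by (cases "x \<in> {b..L}") auto
  qed measurable
qed simp

lemma integrable_inverse_log_square:
  assumes "L > 1" shows "integrable lborel (\<lambda>x. indicat_real {L..} x * (1 / (x * (ln x)\<^sup>2)))"
proof -
  have "set_integrable lborel {L..} (\<lambda>x. 1 / (x * (ln x)\<^sup>2))"
  proof (rule set_integral_FTC_atLeast(1)[where F = "\<lambda>x. - (1 / ln x)" and T = "- 0"])
    show "((\<lambda>x. - (1 / ln x)) has_real_derivative 1 / (x * (ln x)\<^sup>2)) (at x)" if "L \<le> x" for x
      using that assms by (auto intro!: derivative_eq_intros simp: power2_eq_square field_simps)
    show "((\<lambda>x::real. - (1 / ln x)) \<longlongrightarrow> - 0) at_top"
      by (intro tendsto_minus tendsto_divide_0[OF tendsto_const] filterlim_at_top_imp_at_infinity ln_at_top)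
  qed (use assms in auto)
  then show ?thesis unfolding set_integrable_def by simp
qed

text \<open>Near threshold the term with \<open>sg\<close> in the denominator leaves 1 /
  \<open>sg\<close>, bounded by an integrable inverse square root. At infinity the term with
  \<open>pv\<close> bounds the weight by a multiple of 1 / (ln M)^2; after division by M it is the
  logarithm that makes the majorant integrable.\<close>

lemma weight_integrable: "integrable lborel (\<lambda>M. weight M / (1 + \<bar>M\<bar>))"
proof -
  obtain k K where k: "k > 0" "K > 0" "\<And>M. M \<ge> thr \<Longrightarrow> k * sqrt (1 - thr / M) / M \<le> sg M \<and> 0 \<le> sg M \<and> sg M \<le> K / M"
    using sg_bounds by blast
  obtain \<kappa> L0 where \<kappa>: "\<kappa> > 0" "\<And>M. M \<ge> L0 \<Longrightarrow> pv M \<le> - (\<kappa> * ln M / M)" using pv_upper by blast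
  \<comment> \<open>The entry with \<open>c\<close> gives M - c at least M / 2 beyond L; L > 1 keeps
    ln M positive.\<close>
  define L where "L = max (max L0 (thr + 1)) (2 * \<bar>c\<bar> + 2)"
  have L: "L \<ge> L0" "L > thr" "L \<ge> 2 * \<bar>c\<bar> + 2" "L > 1" "L > 0" unfolding L_def using thr_pos by auto
  have ct: "thr - c > 0" using c unfolding thr_def by simp
  \<comment> \<open>Collects M - c at least \<open>thr - c\<close> and the lower bound
    \<open>k * sqrt (M - thr) / (L * sqrt L)\<close> of \<open>sg M\<close> up to L.\<close>
  define C1 where "C1 = L * sqrt L / ((thr - c) * pi\<^sup>2 * k)"
  define C2 where "C2 = 2 * K / \<kappa>\<^sup>2"
  have C: "C1 \<ge> 0" "C2 \<ge> 0" unfolding C1_def C2_def using L ct k \<kappa>(1) by auto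
  let ?B1 = "\<lambda>M. C1 * (indicat_real {thr..L} M / sqrt (M - thr))"
  let ?B2 = "\<lambda>M. C2 * (indicat_real {L..} M * (1 / (M * (ln M)\<^sup>2)))"
  have B2nn: "?B2 M \<ge> 0" for M using C(2) L by (cases "M \<in> {L..}") auto
  have B1nn: "?B1 M \<ge> 0" for M using C(1) by (cases "M \<in> {thr..L}") auto
  have bound: "weight M / (1 + \<bar>M\<bar>) \<le> ?B1 M + ?B2 M" for M
  proof -
    consider "M \<le> thr" | "thr < M" "M \<le> L" | "L < M" by linarith
    then show ?thesis
    proof cases
      case 1
      then have "weight M = 0" by (simp add: weight_eq)
      then show ?thesis using B1nn[of M] B2nn[of M] by simp
    next
      case 2
      have pos: "M > 0" using 2 thr_pos by linarith
      have s: "sg M > 0" using sg_pos 2 by blast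
      have Mt: "M - thr > 0" using 2 by simp
      have e: "sqrt (1 - thr / M) = sqrt (M - thr) / sqrt M"
        using pos by (simp add: real_sqrt_divide[symmetric] diff_divide_distrib)
      have "k * (sqrt (M - thr) / sqrt M) / M \<le> sg M" using k(3)[of M] 2 unfolding e by simp
      then have "k * sqrt (M - thr) \<le> sg M * (M * sqrt M)"
        using pos by (simp add: field_simps)
      also have "\<dots> \<le> sg M * (L * sqrt L)" using s pos 2 by (intro mult_left_mono mult_mono) auto
      finally have sgl: "k * sqrt (M - thr) / (L * sqrt L) \<le> sg M" using L by (simp add: pos_divide_le_eq)
      have den: "(thr - c) * (pi\<^sup>2 * (sg M)\<^sup>2) \<le> (M - c) * ((pv M)\<^sup>2 + pi\<^sup>2 * (sg M)\<^sup>2)"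
        using 2 ct by (intro mult_mono) auto
      have "weight M \<le> sg M / ((thr - c) * (pi\<^sup>2 * (sg M)\<^sup>2))"
        unfolding weight_eq using 2 den s ct by (simp) (intro divide_left_mono, auto intro!: mult_pos_pos add_nonneg_pos)
      also have "\<dots> = 1 / ((thr - c) * pi\<^sup>2 * sg M)" using s by (simp add: power2_eq_square)
      also have "\<dots> \<le> 1 / ((thr - c) * pi\<^sup>2 * (k * sqrt (M - thr) / (L * sqrt L)))"
        using sgl ct k(1) Mt L s by (intro divide_left_mono mult_left_mono mult_pos_pos) auto
      also have "\<dots> = C1 * (1 / sqrt (M - thr))" unfolding C1_def by simp
      finally have w: "weight M \<le> C1 * (1 / sqrt (M - thr))" .
      have "weight M / (1 + \<bar>M\<bar>) \<le> weight M / 1" using weight_nonneg[of M] by (intro divide_left_mono) auto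
      also have "\<dots> \<le> ?B1 M" using w 2 by simp
      finally show ?thesis using B2nn[of M] by linarith
    next
      case 3
      have pos: "M > 0" "M > thr" using 3 L by auto
      have s: "sg M > 0" using sg_pos pos by blast
      have lnp: "ln M > 0" using 3 L by simp
      have Mc: "M - c \<ge> M / 2" using 3 L(3) by linarith
      have q: "\<kappa> * ln M / M > 0" using \<kappa>(1) lnp pos by simp
      have "pv M \<le> - (\<kappa> * ln M / M)" using \<kappa>(2)[of M] 3 L(1) by simp
      then have "(\<kappa> * ln M / M)\<^sup>2 \<le> (- pv M)\<^sup>2" using q by (intro power_mono) auto
      then have pv2: "(\<kappa> * ln M / M)\<^sup>2 \<le> (pv M)\<^sup>2 + pi\<^sup>2 * (sg M)\<^sup>2" by (simp add: add_increasing2)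
      have "(M / 2) * (\<kappa> * ln M / M)\<^sup>2 \<le> (M - c) * ((pv M)\<^sup>2 + pi\<^sup>2 * (sg M)\<^sup>2)"
        using Mc pv2 pos by (intro mult_mono) auto
      moreover have "0 < (M / 2) * (\<kappa> * ln M / M)\<^sup>2" by (intro mult_pos_pos zero_less_power q) (use pos in simp)
      ultimately have "sg M / ((M - c) * ((pv M)\<^sup>2 + pi\<^sup>2 * (sg M)\<^sup>2)) \<le> (K / M) / ((M / 2) * (\<kappa> * ln M / M)\<^sup>2)"
        using k(2) k(3)[of M] pos by (intro frac_le) auto
      then have "weight M \<le> (K / M) / ((M / 2) * (\<kappa> * ln M / M)\<^sup>2)" unfolding weight_eq using pos by simp
      also have "\<dots> = C2 / (ln M)\<^sup>2" unfolding C2_def using pos by (simp add: power2_eq_square mult_ac)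
      finally have w: "weight M \<le> C2 / (ln M)\<^sup>2" .
      have "weight M / (1 + \<bar>M\<bar>) \<le> (C2 / (ln M)\<^sup>2) / M"
        using w C(2) pos by (intro frac_le) auto
      also have "\<dots> = ?B2 M" using 3 by (simp add: mult.commute)
      finally show ?thesis using B1nn[of M] by linarith
    qed
  qed
  show ?thesis
  proof (rule Bochner_Integration.integrable_bound)
    show "integrable lborel (\<lambda>M. ?B1 M + ?B2 M)"
      by (intro Bochner_Integration.integrable_add integrable_mult_right integrable_inverse_sqrt integrable_inverse_log_square L(4))
    show "(\<lambda>M. weight M / (1 + \<bar>M\<bar>)) \<in> borel_measurable lborel" by measurable
    show "AE M in lborel. norm (weight M / (1 + \<bar>M\<bar>)) \<le> norm (?B1 M + ?B2 M)"
    proof (intro AE_I2)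
      fix M
      have "0 \<le> weight M / (1 + \<bar>M\<bar>)" using weight_nonneg[of M] by simp
      then show "norm (weight M / (1 + \<bar>M\<bar>)) \<le> norm (?B1 M + ?B2 M)"
        using bound[of M] B1nn[of M] B2nn[of M] unfolding real_norm_def by linarith
    qed
  qed
qed

end

section \<open>Composing Green operators with \<open>Ginv\<close>\<close>

context spectral_density
begin

text \<open>Clamping at threshold keeps all masses nonnegative, as \<open>mass_mixture\<close>
  demands for \<Gamma> = 0, and changes no integral because \<open>weight\<close> vanishes
  below.\<close>

definition \<theta>0 :: "real \<Rightarrow> real" where "\<theta>0 M = max thr M"

text \<open>The factor produced by the resolvent identity. It upgrades a weight integrable only
  against 1 / (1 + |M|) to an integrable one.\<close>

definition resolvent_weight :: "real \<Rightarrow> real \<Rightarrow> real" where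
  "resolvent_weight g M = weight M / (M - g)"

lemma weight_mult_\<theta>0: "weight M * f (\<theta>0 M) = weight M * f M"
  by (cases "M < thr") (auto simp: weight_eq_0 \<theta>0_def max_def)

lemma weight_mixture: "mass_mixture weight \<theta>0 0"
proof
  show "\<theta>0 \<in> borel_measurable borel" unfolding \<theta>0_def[abs_def] by measurable
  show "- 0 \<le> \<theta>0 \<tau>" for \<tau> using thr_pos by (simp add: \<theta>0_def max_def)
  have "(\<lambda>\<tau>. weight \<tau> / (1 + \<bar>\<theta>0 \<tau>\<bar>)) = (\<lambda>\<tau>. weight \<tau> / (1 + \<bar>\<tau>\<bar>))"
    using weight_mult_\<theta>0[where f = "\<lambda>M. 1 / (1 + \<bar>M\<bar>)"] by (simp only: mult_1_right times_divide_eq_right)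
  then show "integrable lborel (\<lambda>\<tau>. weight \<tau> / (1 + \<bar>\<theta>0 \<tau>\<bar>))" using weight_integrable by simp
qed auto

lemma resolvent_weight_integrable:
  assumes "g < thr"
  shows "resolvent_weight g \<in> borel_measurable borel" "integrable lborel (resolvent_weight g)"
proof -
  show meas: "resolvent_weight g \<in> borel_measurable borel"
    unfolding resolvent_weight_def[abs_def] by measurable
  obtain K where K: "K > 0" "\<And>M. M \<ge> thr \<Longrightarrow> (M - (- 1)) / (M - g) \<le> K"
    using shifted_quotient_bounds[of "- 1" thr g] thr_pos assms by auto
  show "integrable lborel (resolvent_weight g)"
  proof (rule Bochner_Integration.integrable_bound[OF integrable_mult_right[OF weight_integrable, of K]])
    show "resolvent_weight g \<in> borel_measurable lborel" using meas by simp
    show "AE M in lborel. norm (resolvent_weight g M) \<le> norm (K * (weight M / (1 + \<bar>M\<bar>)))"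
    proof (intro AE_I2)
      fix M
      show "norm (resolvent_weight g M) \<le> norm (K * (weight M / (1 + \<bar>M\<bar>)))"
      proof (cases "M < thr")
        case False
        then have M: "M \<ge> thr" "M > 0" "M - g > 0" using thr_pos assms by linarith+
        then have "1 + M \<le> K * (M - g)" using K(2)[OF M(1)] by (simp add: pos_divide_le_eq add.commute)
        then have "1 / (M - g) \<le> K / (1 + M)" using M by (simp add: divide_simps mult.commute)
        then have "weight M * (1 / (M - g)) \<le> weight M * (K / (1 + M))"
          using weight_nonneg by (intro mult_left_mono)
        then show ?thesis
          unfolding resolvent_weight_def using M K(1) weight_nonneg[of M] by (simp add: abs_mult mult_ac)
      qed (simp add: resolvent_weight_def weight_eq_0)
    qed
  qed
qed

lemma resolvent_weight_mixture:
  assumes "g < thr" shows "mass_mixture (resolvent_weight g) \<theta>0 0"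
proof -
  interpret W: mass_mixture weight \<theta>0 0 by (rule weight_mixture)
  show ?thesis
  proof
    show m: "resolvent_weight g \<in> borel_measurable borel" by (rule resolvent_weight_integrable[OF assms])
    show "integrable lborel (\<lambda>\<tau>. resolvent_weight g \<tau> / (1 + \<bar>\<theta>0 \<tau>\<bar>))"
    proof (rule Bochner_Integration.integrable_bound[OF resolvent_weight_integrable(2)[OF assms]])
      show "(\<lambda>\<tau>. resolvent_weight g \<tau> / (1 + \<bar>\<theta>0 \<tau>\<bar>)) \<in> borel_measurable lborel"
        using m W.\<theta>_measurable by measurable
      show "AE \<tau> in lborel. norm (resolvent_weight g \<tau> / (1 + \<bar>\<theta>0 \<tau>\<bar>)) \<le> norm (resolvent_weight g \<tau>)"
      proof (intro AE_I2)
        fix \<tau>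
        have "\<bar>resolvent_weight g \<tau>\<bar> / (1 + \<bar>\<theta>0 \<tau>\<bar>) \<le> \<bar>resolvent_weight g \<tau>\<bar> / 1" by (intro divide_left_mono) auto
        then show "norm (resolvent_weight g \<tau> / (1 + \<bar>\<theta>0 \<tau>\<bar>)) \<le> norm (resolvent_weight g \<tau>)" by (simp add: abs_divide)
      qed
    qed
  qed (rule W.\<theta>_measurable order_refl W.\<theta>_ge)+
qed

sublocale W: mass_mixture weight \<theta>0 0
  by (rule weight_mixture)

text \<open>The resolvent identity under the integral; its two terms may be integrated separately
  because \<open>resolvent_weight g\<close> is integrable by itself.\<close>

lemma mix_Gk:
  assumes g: "g < thr" and f: "f \<in> Cpc"
  shows "W.mix (Gk g f) x = (\<integral>M. resolvent_weight g M * Gk (\<theta>0 M) f x \<partial>lborel) - (\<integral>M. resolvent_weight g M \<partial>lborel) * Gk g f x"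
    "integrable lborel (\<lambda>M. resolvent_weight g M * Gk (\<theta>0 M) f x)"
proof -
  interpret R: mass_mixture "resolvent_weight g" \<theta>0 0 by (rule resolvent_weight_mixture[OF g])
  show i: "integrable lborel (\<lambda>M. resolvent_weight g M * Gk (\<theta>0 M) f x)" by (rule R.mix_integrable[OF f])
  have "weight M * Gk (\<theta>0 M) (Gk g f) x = resolvent_weight g M * Gk (\<theta>0 M) f x - resolvent_weight g M * Gk g f x" for M
  proof (cases "M < thr")
    case False
    then have M: "\<theta>0 M = M" "M - g \<noteq> 0" using g by (auto simp: \<theta>0_def)
    have "Gk M (Gk g f) x = (Gk M f x - Gk g f x) / (M - g)"
      using Gk_resolvent[OF f, of M g x] M(2) by (simp add: nonzero_eq_divide_eq mult.commute)
    then show ?thesis unfolding M(1) resolvent_weight_def by (simp add: diff_divide_distrib right_diff_distrib)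
  qed (simp add: resolvent_weight_def weight_eq_0)
  then show "W.mix (Gk g f) x = (\<integral>M. resolvent_weight g M * Gk (\<theta>0 M) f x \<partial>lborel) - (\<integral>M. resolvent_weight g M \<partial>lborel) * Gk g f x"
    unfolding W.mix_def using i resolvent_weight_integrable(2)[OF g]
    by (simp only: Bochner_Integration.integral_diff integrable_mult_left integral_mult_left_zero)
qed

lemma Ginv_eq:
  assumes \<Phi>: "\<Phi> \<in> Cpc"
  shows "Ginv m a1 a2 g0 g1 g2 c \<Phi> =
    (\<lambda>x. (- (1 / gfun m a1 a2 g0 g1 g2 c)) * \<Phi> x + (-1) * W.mix (\<lambda>y. 1 * dalembert \<Phi> y + (- c) * \<Phi> y) x)"
proof
  fix x
  let ?\<psi> = "\<lambda>y. 1 * dalembert \<Phi> y + (- c) * \<Phi> y"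
  have \<psi>: "?\<psi> \<in> Cpc" by (rule Cpc_lincomb[OF Cpc_dalembert[OF \<Phi>] \<Phi>])
  have e: "(\<lambda>y. dalembert \<Phi> y - c * \<Phi> y) = ?\<psi>" by auto
  have "(LINT M:{4 * m^2..}|lborel. mu_con m a1 a2 g0 g1 g2 c M * Gret M ?\<psi> x) = W.mix ?\<psi> x"
    unfolding W.mix_def set_lebesgue_integral_def Gret_eq_Gk[OF \<psi>] weight_mult_\<theta>0[where f = "\<lambda>M. Gk M ?\<psi> x"]
    by (simp only: weight_def real_scaleR_def mult.assoc)
  then show "Ginv m a1 a2 g0 g1 g2 c \<Phi> x = (- (1 / gfun m a1 a2 g0 g1 g2 c)) * \<Phi> x + (-1) * W.mix ?\<psi> x"
    unfolding Ginv_def e by simp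
qed

text \<open>\<open>Gk g\<close> absorbs each wave operator at the price of a local term and a factor
  g. The outcome is sorted by its dependence on g: a part free of g, a part with the factor c - g,
  and parts without \<open>W.mix\<close>. The first two are prepared to cancel in the partial
  fraction sum.\<close>

lemma Gk_Ginv:
  fixes \<beta>0 \<beta>1 :: real
  assumes g: "g < thr" and f: "f \<in> Cpc"
  defines "\<Phi> \<equiv> \<lambda>x. \<beta>1 * dalembert f x + \<beta>0 * f x"
  shows "Gk g (Ginv m a1 a2 g0 g1 g2 c \<Phi>) x =
     - (1 / gfun m a1 a2 g0 g1 g2 c) * \<beta>1 * f x - W.mix \<Phi> x + (c - g) * (\<beta>1 * W.mix f x)
     + (\<beta>1 * g + \<beta>0) * ((g - c) * (\<integral>M. resolvent_weight g M \<partial>lborel) - 1 / gfun m a1 a2 g0 g1 g2 c) * Gk g f x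
     - (\<beta>1 * g + \<beta>0) * (g - c) * (\<integral>M. resolvent_weight g M * Gk (\<theta>0 M) f x \<partial>lborel)"
proof -
  let ?\<psi> = "\<lambda>y. 1 * dalembert \<Phi> y + (- c) * \<Phi> y"
  define \<kappa> where "\<kappa> = 1 / gfun m a1 a2 g0 g1 g2 c"
  have \<Phi>: "\<Phi> \<in> Cpc" unfolding \<Phi>_def by (rule Cpc_lincomb[OF Cpc_dalembert[OF f] f])
  have \<psi>: "?\<psi> \<in> Cpc" by (rule Cpc_lincomb[OF Cpc_dalembert[OF \<Phi>] \<Phi>])
  have Gf: "Gk g f \<in> Cpc" using f by (rule Gk_Cpc)
  have G\<Phi>: "Gk g \<Phi> x = \<beta>1 * f x + (\<beta>1 * g + \<beta>0) * Gk g f x" for x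
    unfolding \<Phi>_def Gk_lincomb[OF Cpc_dalembert[OF f] f] Gk_of_dalembert[OF f] by (simp add: algebra_simps)
  have G\<psi>: "Gk g ?\<psi> = (\<lambda>x. 1 * \<Phi> x + (g - c) * (\<beta>1 * f x + (\<beta>1 * g + \<beta>0) * Gk g f x))"
  proof
    fix x
    show "Gk g ?\<psi> x = 1 * \<Phi> x + (g - c) * (\<beta>1 * f x + (\<beta>1 * g + \<beta>0) * Gk g f x)"
      unfolding Gk_lincomb[OF Cpc_dalembert[OF \<Phi>] \<Phi>] Gk_of_dalembert[OF \<Phi>] G\<Phi> by (simp add: algebra_simps)
  qed
  have "Gk g (Ginv m a1 a2 g0 g1 g2 c \<Phi>) x = (- \<kappa>) * Gk g \<Phi> x + (-1) * Gk g (W.mix ?\<psi>) x"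
    unfolding Ginv_eq[OF \<Phi>] \<kappa>_def by (rule Gk_lincomb[OF \<Phi> W.mix_Cpc[OF \<psi>]])
  also have "Gk g (W.mix ?\<psi>) x = 1 * W.mix \<Phi> x + (g - c) * (\<beta>1 * W.mix f x + (\<beta>1 * g + \<beta>0) * W.mix (Gk g f) x)"
    unfolding W.Gk_mix[OF \<psi>] G\<psi> W.mix_lincomb[OF \<Phi> Cpc_lincomb[OF f Gf]] W.mix_lincomb[OF f Gf] ..
  finally show ?thesis
    unfolding G\<Phi> mix_Gk(1)[OF g f] \<kappa>_def[symmetric] by (simp add: algebra_simps)
qed

end

section \<open>The retarded interaction\<close>

text \<open>\<open>\<beta>0\<close> and \<open>\<beta>1\<close> stand for the differences
  \<open>bt0 - b0\<close> and \<open>bt1 - b1\<close>.\<close>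

locale interaction = spectral_density +
  fixes \<beta>0 \<beta>1 :: real
  assumes distinct: "g0 \<noteq> g1" "g0 \<noteq> g2" "g1 \<noteq> g2"
begin

definition r0 :: real where "r0 = 1 / ((g0 - g1) * (g0 - g2))"
definition r1 :: real where "r1 = 1 / ((g1 - g0) * (g1 - g2))"
definition r2 :: real where "r2 = 1 / ((g2 - g0) * (g2 - g1))"

text \<open>The coefficients belong to a rational function of order M^-3 at infinity, so the M^-1
  and M^-2 terms of its expansion vanish.\<close>

lemma residue_sums: "r0 + r1 + r2 = 0" "r0 * g0 + r1 * g1 + r2 * g2 = 0"
proof -
  have nz: "g0 - g1 \<noteq> 0" "g0 - g2 \<noteq> 0" "g1 - g2 \<noteq> 0" using distinct by auto
  have r1: "r1 = - (1 / ((g0 - g1) * (g1 - g2)))"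
  proof -
    have "(g1 - g0) * (g1 - g2) = - ((g0 - g1) * (g1 - g2))" by (simp add: algebra_simps)
    then show ?thesis unfolding r1_def by simp
  qed
  have r2: "r2 = 1 / ((g0 - g2) * (g1 - g2))"
  proof -
    have "(g2 - g0) * (g2 - g1) = (g0 - g2) * (g1 - g2)" by (simp add: algebra_simps)
    then show ?thesis unfolding r2_def by simp
  qed
  show "r0 + r1 + r2 = 0" "r0 * g0 + r1 * g1 + r2 * g2 = 0"
    unfolding r0_def r1 r2 using nz by (simp_all add: divide_simps) (simp_all add: algebra_simps)
qed

definition continuous_coeff :: "real \<Rightarrow> real" where
  "continuous_coeff g = (\<beta>1 * g + \<beta>0) * (g - c)"

text \<open>The symbol of \<open>Ginv\<close> composed with \<beta>1 box + \<beta>0, evaluated at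
  box = g, where \<open>Gk M\<close> becomes 1 / (g - M).\<close>

definition discrete_coeff :: "real \<Rightarrow> real" where
  "discrete_coeff g = (\<beta>1 * g + \<beta>0) * ((g - c) * (\<integral>M. resolvent_weight g M \<partial>lborel) - 1 / gfun m a1 a2 g0 g1 g2 c)"

definition continuous_weight :: "real \<Rightarrow> real" where
  "continuous_weight M = - (r0 * continuous_coeff g0) * resolvent_weight g0 M
     + (- (r1 * continuous_coeff g1) * resolvent_weight g1 M + - (r2 * continuous_coeff g2) * resolvent_weight g2 M)"

text \<open>The three point masses at \<open>g0\<close>, \<open>g1\<close>, \<open>g2\<close> are spread over unit intervals below the
  threshold, so that a single Lebesgue integral represents the whole operator.\<close>

definition total_weight :: "real \<Rightarrow> real" where
  "total_weight \<tau> = continuous_weight \<tau> + (r0 * discrete_coeff g0 * indicat_real {thr - 1..<thr} \<tau>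
     + (r1 * discrete_coeff g1 * indicat_real {thr - 2..<thr - 1} \<tau> + r2 * discrete_coeff g2 * indicat_real {thr - 3..<thr - 2} \<tau>))"

text \<open>Below \<open>thr - 3\<close> the value is immaterial, as \<open>total_weight\<close>
  vanishes there.\<close>

definition mass :: "real \<Rightarrow> real" where
  "mass \<tau> = (if \<tau> \<ge> thr then \<tau> else if \<tau> \<ge> thr - 1 then g0 else if \<tau> \<ge> thr - 2 then g1 else g2)"

lemma below_threshold: "g0 < thr" "g1 < thr" "g2 < thr"
  using g by (simp_all add: thr_def)

lemma continuous_weight_integrable: "integrable lborel continuous_weight" "continuous_weight \<in> borel_measurable borel"
  unfolding continuous_weight_def[abs_def]
  by (intro Bochner_Integration.integrable_add integrable_mult_right resolvent_weight_integrable below_threshold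
       borel_measurable_add borel_measurable_times borel_measurable_const)+

lemma total_weight_mixture: "finite_mass_mixture total_weight mass (\<bar>g0\<bar> + \<bar>g1\<bar> + \<bar>g2\<bar>)"
proof
  note [measurable] = continuous_weight_integrable(2)
  show m: "total_weight \<in> borel_measurable borel" unfolding total_weight_def[abs_def] by measurable
  show m': "mass \<in> borel_measurable borel" unfolding mass_def[abs_def] by measurable
  show i: "integrable lborel total_weight"
    unfolding total_weight_def[abs_def]
    by (intro Bochner_Integration.integrable_add integrable_mult_right continuous_weight_integrable integrable_real_indicator) auto
  show "- (\<bar>g0\<bar> + \<bar>g1\<bar> + \<bar>g2\<bar>) \<le> mass \<tau>" for \<tau> using thr_pos by (auto simp: mass_def)
  show "integrable lborel (\<lambda>\<tau>. total_weight \<tau> / (1 + \<bar>mass \<tau>\<bar>))"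
  proof (rule Bochner_Integration.integrable_bound[OF i])
    show "(\<lambda>\<tau>. total_weight \<tau> / (1 + \<bar>mass \<tau>\<bar>)) \<in> borel_measurable lborel" using m m' by measurable
    show "AE \<tau> in lborel. norm (total_weight \<tau> / (1 + \<bar>mass \<tau>\<bar>)) \<le> norm (total_weight \<tau>)"
    proof (intro AE_I2)
      fix \<tau>
      have "\<bar>total_weight \<tau>\<bar> / (1 + \<bar>mass \<tau>\<bar>) \<le> \<bar>total_weight \<tau>\<bar> / 1" by (intro divide_left_mono) auto
      then show "norm (total_weight \<tau> / (1 + \<bar>mass \<tau>\<bar>)) \<le> norm (total_weight \<tau>)" by (simp add: abs_divide)
    qed
  qed
qed simp

sublocale T: finite_mass_mixture total_weight mass "\<bar>g0\<bar> + \<bar>g1\<bar> + \<bar>g2\<bar>"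
  by (rule total_weight_mixture)

lemma T_mix_eq:
  assumes f: "f \<in> Cpc"
  shows "T.mix f x = (\<integral>M. continuous_weight M * Gk (\<theta>0 M) f x \<partial>lborel)
     + (r0 * discrete_coeff g0 * Gk g0 f x + (r1 * discrete_coeff g1 * Gk g1 f x + r2 * discrete_coeff g2 * Gk g2 f x))"
proof -
  have e: "total_weight \<tau> * Gk (mass \<tau>) f x = continuous_weight \<tau> * Gk (\<theta>0 \<tau>) f x
     + (r0 * discrete_coeff g0 * Gk g0 f x * indicat_real {thr - 1..<thr} \<tau>
     + (r1 * discrete_coeff g1 * Gk g1 f x * indicat_real {thr - 2..<thr - 1} \<tau>
       + r2 * discrete_coeff g2 * Gk g2 f x * indicat_real {thr - 3..<thr - 2} \<tau>))" for \<tau>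
  proof -
    have z: "continuous_weight \<tau> = 0" if "\<tau> < thr"
      using that by (simp add: continuous_weight_def resolvent_weight_def weight_eq_0)
    consider "\<tau> \<ge> thr" | "thr - 1 \<le> \<tau>" "\<tau> < thr" | "thr - 2 \<le> \<tau>" "\<tau> < thr - 1" | "thr - 3 \<le> \<tau>" "\<tau> < thr - 2" | "\<tau> < thr - 3"
      by linarith
    then show ?thesis
      by cases (auto simp: z total_weight_def mass_def \<theta>0_def indicator_def)
  qed
  have I: "integrable lborel (\<lambda>\<tau>. continuous_weight \<tau> * Gk (\<theta>0 \<tau>) f x)"
    unfolding continuous_weight_def distrib_right mult.assoc
    by (intro Bochner_Integration.integrable_add integrable_mult_right mix_Gk(2) below_threshold f)
  have J: "integrable lborel (\<lambda>\<tau>. a * indicat_real {b..<d} \<tau>)" for a b d :: real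
  proof (intro integrable_mult_right integrable_real_indicator)
    have "bounded {b..<d}" by (rule bounded_subset[of "{b..d}"]) auto
    then show "emeasure lborel {b..<d} < \<infinity>" by (rule emeasure_bounded_finite)
  qed auto
  \<comment> \<open>The intervals have length one, so each carries exactly its coefficient.\<close>
  have K: "(\<integral>\<tau>. a * indicat_real {thr - 1..<thr} \<tau> \<partial>lborel) = a"
    "(\<integral>\<tau>. a * indicat_real {thr - 2..<thr - 1} \<tau> \<partial>lborel) = a"
    "(\<integral>\<tau>. a * indicat_real {thr - 3..<thr - 2} \<tau> \<partial>lborel) = a" for a by simp_all
  show ?thesis unfolding T.mix_def e
    by (simp only: Bochner_Integration.integral_add Bochner_Integration.integrable_add I J K)
qed

lemma continuous_part_eq:
  assumes f: "f \<in> Cpc"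
  shows "(\<integral>M. continuous_weight M * Gk (\<theta>0 M) f x \<partial>lborel) =
    - (r0 * continuous_coeff g0) * (\<integral>M. resolvent_weight g0 M * Gk (\<theta>0 M) f x \<partial>lborel)
    + (- (r1 * continuous_coeff g1) * (\<integral>M. resolvent_weight g1 M * Gk (\<theta>0 M) f x \<partial>lborel)
    + - (r2 * continuous_coeff g2) * (\<integral>M. resolvent_weight g2 M * Gk (\<theta>0 M) f x \<partial>lborel))"
  unfolding continuous_weight_def distrib_right mult.assoc
  using mix_Gk(2)[OF below_threshold(1) f, of x] mix_Gk(2)[OF below_threshold(2) f, of x] mix_Gk(2)[OF below_threshold(3) f, of x]
  by (simp only: Bochner_Integration.integral_add Bochner_Integration.integrable_add integrable_mult_right integral_mult_right_zero)

text \<open>P is common to the three terms and R enters linearly in g, so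
  \<open>residue_sums\<close> annihilates both. With them go the local multiple of \<open>f\<close>
  and the superpositions with \<open>weight\<close>, which is not known to be integrable; only
  integrable weights remain.\<close>

lemma retarded_interaction_eq:
  assumes f: "f \<in> Cpc"
  shows "GLret g0 g1 g2 (Ginv m a1 a2 g0 g1 g2 c (\<lambda>x. \<beta>1 * dalembert f x + \<beta>0 * f x)) = T.mix f"
proof
  fix x
  let ?\<Phi> = "\<lambda>x. \<beta>1 * dalembert f x + \<beta>0 * f x"
  let ?G = "Ginv m a1 a2 g0 g1 g2 c ?\<Phi>"
  have \<Phi>: "?\<Phi> \<in> Cpc" by (rule Cpc_lincomb[OF Cpc_dalembert[OF f] f])
  have G: "?G \<in> Cpc" unfolding Ginv_eq[OF \<Phi>]
    by (rule Cpc_lincomb[OF \<Phi> W.mix_Cpc[OF Cpc_lincomb[OF Cpc_dalembert[OF \<Phi>] \<Phi>]]])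
  define P where "P = - (1 / gfun m a1 a2 g0 g1 g2 c) * \<beta>1 * f x - W.mix ?\<Phi> x"
  define R where "R = \<beta>1 * W.mix f x"
  define E where "E g = discrete_coeff g * Gk g f x - continuous_coeff g * (\<integral>M. resolvent_weight g M * Gk (\<theta>0 M) f x \<partial>lborel)" for g
  have X: "Gk g ?G x = P + (c - g) * R + E g" if "g < thr" for g
    unfolding Gk_Ginv[OF that f] P_def R_def E_def discrete_coeff_def continuous_coeff_def by simp
  have "GLret g0 g1 g2 ?G x = r0 * Gk g0 ?G x + r1 * Gk g1 ?G x + r2 * Gk g2 ?G x"
    unfolding GLret_def Gret_eq_Gk[OF G] r0_def r1_def r2_def ..
  also have "\<dots> = (r0 + r1 + r2) * (P + c * R) - (r0 * g0 + r1 * g1 + r2 * g2) * R + (r0 * E g0 + r1 * E g1 + r2 * E g2)"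
    unfolding X[OF below_threshold(1)] X[OF below_threshold(2)] X[OF below_threshold(3)] by (simp add: algebra_simps)
  also have "\<dots> = r0 * E g0 + r1 * E g1 + r2 * E g2" unfolding residue_sums by simp
  also have "\<dots> = T.mix f x"
    unfolding T_mix_eq[OF f] continuous_part_eq[OF f] E_def by (simp add: algebra_simps)
  finally show "GLret g0 g1 g2 ?G x = T.mix f x" .
qed

end

theorem theorem4p11:
  fixes m a1 a2 bt0 bt1 b0 b1 b2 g0 g1 g2 c \<epsilon> :: real
  assumes "m > 0"
    and "a1 < 4 * m^2" and "a2 < 4 * m^2"
    and "g0 < 4 * m^2" and "g1 < 4 * m^2" and "g2 < 4 * m^2"
    and "g0 \<noteq> g1" and "g0 \<noteq> g2" and "g1 \<noteq> g2"
    and "\<forall>g\<in>{g0, g1, g2}. g * (a1 - g) * (a2 - g) * Jfun m g = b0 + b1 * g + b2 * g^2"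
    and "0 < c" and "c < 4 * m^2"
    and "\<epsilon> > 0"
  shows "\<forall>S\<in>Cpc. tsupp S \<subseteq> {x. x $ 0 \<ge> - \<epsilon>} \<longrightarrow>
     (let W = Wret m a1 a2 g0 g1 g2 c b0 b1 bt0 bt1;
          \<phi> = (\<lambda>x. \<Sum>n. (-1)^n * (W ^^ n) S x)
      in (\<exists>!\<psi>. \<psi> \<in> Cpc \<and> (\<forall>x. \<psi> x + W \<psi> x = S x))
         \<and> \<phi> \<in> Cpc \<and> (\<forall>x. \<phi> x + W \<phi> x = S x)
         \<and> tsupp \<phi> \<subseteq> {x. x $ 0 \<ge> - \<epsilon>}
         \<and> abs_conv_Cpc (\<lambda>n. (\<lambda>x. (-1)^n * (W ^^ n) S x)))"
proof (intro ballI impI)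
  fix S assume S: "S \<in> Cpc" and supp: "tsupp S \<subseteq> {x. x $ 0 \<ge> - \<epsilon>}"
  interpret I: interaction m a1 a2 g0 g1 g2 c "bt0 - b0" "bt1 - b1"
    by unfold_locales (use assms in auto)
  define W where "W = Wret m a1 a2 g0 g1 g2 c b0 b1 bt0 bt1"
  have W: "W f = I.T.mix f" if "f \<in> Cpc" for f
    unfolding W_def Wret_def by (rule I.retarded_interaction_eq[OF that])
  \<comment> \<open>\<open>W\<close> and \<open>mix\<close> are known to agree only on
    \<open>Cpc\<close>, which no iterate leaves.\<close>
  have Wn: "(W ^^ n) S = (I.T.mix ^^ n) S" for n
    by (induction n) (auto simp: W I.T.mix_pow_Cpc[OF S])
  have \<phi>: "(\<Sum>n. (-1)^n * (W ^^ n) S x) = I.T.neumann S x" for x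
    unfolding Wn I.T.neumann_def ..
  have N: "I.T.neumann S \<in> Cpc" by (rule I.T.neumann_Cpc[OF S])
  have supp': "tsupp (I.T.neumann S) \<subseteq> {x. x $ 0 \<ge> - \<epsilon>}"
    using I.T.tsupp_neumann[OF S] Jp_time[OF supp] by blast
  have sol: "\<forall>x. I.T.neumann S x + W (I.T.neumann S) x = S x"
    unfolding W[OF N] using I.T.neumann_solves[OF S] by blast
  have ex1: "\<exists>!\<psi>. \<psi> \<in> Cpc \<and> (\<forall>x. \<psi> x + W \<psi> x = S x)"
  proof (rule ex1I[of _ "I.T.neumann S"])
    show "I.T.neumann S \<in> Cpc \<and> (\<forall>x. I.T.neumann S x + W (I.T.neumann S) x = S x)" using N sol by blast
    fix \<psi> assume "\<psi> \<in> Cpc \<and> (\<forall>x. \<psi> x + W \<psi> x = S x)"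
    then show "\<psi> = I.T.neumann S" using I.T.neumann_unique[OF S, of \<psi>] W[of \<psi>] by simp
  qed
  have conv: "abs_conv_Cpc (\<lambda>n x. (-1)^n * (W ^^ n) S x)"
    unfolding Wn by (rule I.T.neumann_abs_conv[OF S])
  show "let W = Wret m a1 a2 g0 g1 g2 c b0 b1 bt0 bt1;
          \<phi> = (\<lambda>x. \<Sum>n. (-1)^n * (W ^^ n) S x)
      in (\<exists>!\<psi>. \<psi> \<in> Cpc \<and> (\<forall>x. \<psi> x + W \<psi> x = S x))
         \<and> \<phi> \<in> Cpc \<and> (\<forall>x. \<phi> x + W \<phi> x = S x)
         \<and> tsupp \<phi> \<subseteq> {x. x $ 0 \<ge> - \<epsilon>}
         \<and> abs_conv_Cpc (\<lambda>n. (\<lambda>x. (-1)^n * (W ^^ n) S x))"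
    unfolding Let_def W_def[symmetric] \<phi> by (intro conjI ex1 N sol supp' conv)
qed

end
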